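(* Work in two space dimensions, with a kernel $\mathsf J=\mathsf J_c-\mathsf J_e$ and constants $\gamma_c,\gamma_e\ge 0$ satisfying the assumptions (A1)–(A3) and $\gamma_0>0$ stated in the context. Put $B_c=[J_c\star\mathbf 1]+\gamma_c$ and $B_e=[J_e\star\mathbf 1]+\gamma_e$, and assume that $B_c-3B_e=\alpha_0>0$ for some $\alpha_0$ independent of $h$, provided $h$ is sufficiently small. Let smooth, $\Omega$-periodic initial data $\Phi(\cdot,\cdot,0)$ be given, and suppose that $\Phi(x_1,x_2,t)$ is the unique, smooth, $\Omega$-periodic solution on $\Omega$ for $0\le t\le T$, for some $T<\infty$, of the nonlocal Cahn–Hilliard equation $$\partial_t\Phi=\Delta\big(\Phi^3+\gamma_c\Phi-\gamma_e\Phi+(\mathsf J*1)\Phi-\mathsf J*\Phi\big).$$ Set $\Phi^k_{i,j}:=\Phi(p_i,p_j,ks)$. Let $\phi^k\in\mathcal C_{m\times n}$ be the $k$-th periodic solution of the fully discrete nCH scheme defined in the context with time step $s$, grid size $h$ and starting value $\phi^0_{i,j}:=\Phi^0_{i,j}$. Put $e^k_{i,j}:=\Phi^k_{i,j}-\phi^k_{i,j}$. Let $C_*>0$ be any fixed constant. Then there exist $s_0,h_0>0$ and a constant $C>0$, with $C$ independent of $h$ and $s$, such that whenever $0<s\le s_0$, $0<h\le h_0$ and $s\le C_* h$, $$\|e^l\|_2\le C\,(h^2+s^2)$$ for all positive integers $l$ such that $l\,s\le T$.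
   Context: Continuous setting: $\Omega=(0,L_1)\times(0,L_2)$; $C^\infty_{\rm per}(\Omega)$ is the set of smooth $\Omega$-periodic functions on $\mathbb R^2$. The kernel is $\mathsf J=\mathsf J_c-\mathsf J_e$ where: (A1) $\mathsf J_c,\mathsf J_e\in C^\infty_{\rm per}(\Omega)$ are non-negative; (A2) $\mathsf J_c,\mathsf J_e$ are even, $\mathsf J_\alpha(-x_1,-x_2)=\mathsf J_\alpha(x_1,x_2)$; (A3) $\int_\Omega\mathsf J\,d\mathbf x>0$. Periodic convolution: $(\mathsf J*\phi)(\mathbf x)=\int_\Omega\mathsf J(\mathbf y)\phi(\mathbf x-\mathbf y)\,d\mathbf y$; in particular $\mathsf J*1=\int_\Omega \mathsf J\,d\mathbf x$. Constants $\gamma_c,\gamma_e\ge0$ satisfy $\gamma_0:=\gamma_c-\gamma_e+\mathsf J*1>0$. Grid: $h>0$ with $L_1=m h$, $L_2=n h$, $m,n$ positive integers; $p_r:=(r-\tfrac12)h$ for integer or half-integer $r$. $\mathcal C_{m\times n}$ is the space of cell-centered grid functions $\phi_{i,j}=\phi(p_i,p_j)$, $1\le i\le m$, $1\le j\le n$; periodic ones are extended by $\phi_{i+am,j+bn}=\phi_{i,j}$, $a,b\in\mathbb Z$. $\|\phi\|_2=\big(h^2\sum_{i=1}^m\sum_{j=1}^n\phi_{i,j}^2\big)^{1/2}$. $\Delta_h$ is the standard five-point discrete Laplacian, $(\Delta_h\phi)_{i,j}=h^{-2}(\phi_{i+1,j}+\phi_{i-1,j}+\phi_{i,j+1}+\phi_{i,j-1}-4\phi_{i,j})$.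 For a vertex-centered periodic grid function $f_{k+\frac12,l+\frac12}=f(p_{k+\frac12},p_{l+\frac12})$ and periodic $\phi\in\mathcal C_{m\times n}$, the discrete convolution is $[f\star\phi]_{i,j}=h^2\sum_{k=1}^m\sum_{l=1}^n f_{k+\frac12,l+\frac12}\,\phi_{i-k,j-l}$. $J_c,J_e$ denote the vertex-centered grid restrictions $(J_\alpha)_{i+\frac12,j+\frac12}=\mathsf J_\alpha(p_{i+\frac12},p_{j+\frac12})$, $J=J_c-J_e$, and $\mathbf 1$ is the constant grid function 1 (so $[J_\alpha\star\mathbf 1]$ is a constant). Fully discrete nCH scheme with time step $s>0$: given periodic $\phi^{k-1},\phi^k\in\mathcal C_{m\times n}$, $k\ge0$, with the convention $\phi^{-1}:=\phi^0$, find periodic $\phi^{k+1}\in\mathcal C_{m\times n}$ (it exists and is unique) such that $$\phi^{k+1}-\phi^k=s\,\Delta_h w^{k+1/2},$$ $$w^{k+1/2}=\eta(\phi^k,\phi^{k+1})+([J_c\star\mathbf 1]+\gamma_c)\phi^{k+1/2}-([J_e\star\mathbf 1]+\gamma_e)\hat\phi^{k+1/2}-[J\star\hat\phi^{k+1/2}],$$ where $\eta(\phi^k,\phi^{k+1})=\tfrac14\big((\phi^k)^2+(\phi^{k+1})^2\big)(\phi^k+\phi^{k+1})$, $\phi^{k+1/2}=\tfrac12(\phi^k+\phi^{k+1})$, $\hat\phi^{k+1/2}=\tfrac32\phi^k-\tfrac12\phi^{k-1}$. *)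

theory Defs
  imports "HOL-Analysis.Analysis"
begin

text \<open>
  \<open>k\<close>-fold continuous differentiability relative to \<open>S\<close>: \<open>g b\<close> is the partial derivative in
  direction \<open>b\<close>.  The derivatives are taken within \<open>S\<close>, so that on \<open>UNIV \<times> {0..T}\<close> with \<open>T > 0\<close>
  smoothness is smoothness up to the boundary, with one-sided time derivatives at \<open>0\<close> and \<open>T\<close>.
\<close>

primrec Ck_on :: "nat \<Rightarrow> ('a::euclidean_space \<Rightarrow> real) \<Rightarrow> 'a set \<Rightarrow> bool" where
  "Ck_on 0 f S \<longleftrightarrow> continuous_on S f"
| "Ck_on (Suc k) f S \<longleftrightarrow>
     (\<exists>g. (\<forall>x\<in>S. (f has_derivative (\<lambda>v. \<Sum>b\<in>Basis. (v \<bullet> b) * g b x)) (at x within S)) \<and>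
          (\<forall>b\<in>Basis. Ck_on k (g b) S))"

definition smooth_on :: "('a::euclidean_space \<Rightarrow> real) \<Rightarrow> 'a set \<Rightarrow> bool" where
  "smooth_on f S \<longleftrightarrow> (\<forall>k. Ck_on k f S)"

definition Omega :: "real \<Rightarrow> real \<Rightarrow> (real \<times> real) set" where
  "Omega L1 L2 = {0<..<L1} \<times> {0<..<L2}"

definition periodic_fun :: "real \<Rightarrow> real \<Rightarrow> (real \<times> real \<Rightarrow> real) \<Rightarrow> bool" where
  "periodic_fun L1 L2 f \<longleftrightarrow>
     (\<forall>x1 x2. f (x1 + L1, x2) = f (x1, x2) \<and> f (x1, x2 + L2) = f (x1, x2))"

definition smooth_periodic :: "real \<Rightarrow> real \<Rightarrow> (real \<times> real \<Rightarrow> real) \<Rightarrow> bool" where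
  "smooth_periodic L1 L2 f \<longleftrightarrow> smooth_on f UNIV \<and> periodic_fun L1 L2 f"

definition periodic_conv ::
    "real \<Rightarrow> real \<Rightarrow> (real \<times> real \<Rightarrow> real) \<Rightarrow> (real \<times> real \<Rightarrow> real) \<Rightarrow> real \<times> real \<Rightarrow> real" where
  "periodic_conv L1 L2 J \<phi> x = integral (Omega L1 L2) (\<lambda>y. J y * \<phi> (x - y))"

definition laplacian :: "(real \<times> real \<Rightarrow> real) \<Rightarrow> real \<times> real \<Rightarrow> real" where
  "laplacian f = (\<lambda>(x1, x2).
     deriv (deriv (\<lambda>r. f (r, x2))) x1 + deriv (deriv (\<lambda>r. f (x1, r))) x2)"

definition nCH_solution ::
    "real \<Rightarrow> real \<Rightarrow> real \<Rightarrow> real \<Rightarrow> real \<Rightarrow> (real \<times> real \<Rightarrow> real) \<Rightarrow>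
     (real \<times> real \<Rightarrow> real) \<Rightarrow> (real \<times> real \<Rightarrow> real \<Rightarrow> real) \<Rightarrow> bool" where
  "nCH_solution L1 L2 T \<gamma>c \<gamma>e J \<Phi>0 \<Phi> \<longleftrightarrow>
     smooth_on (\<lambda>(x, t). \<Phi> x t) (UNIV \<times> {0..T}) \<and>
     (\<forall>t\<in>{0..T}. periodic_fun L1 L2 (\<lambda>x. \<Phi> x t)) \<and>
     (\<forall>x. \<Phi> x 0 = \<Phi>0 x) \<and>
     (\<forall>x. \<forall>t\<in>{0..T}.
        ((\<lambda>\<tau>. \<Phi> x \<tau>) has_real_derivative
           laplacian (\<lambda>z. \<Phi> z t ^ 3 + \<gamma>c * \<Phi> z t - \<gamma>e * \<Phi> z t
                         + periodic_conv L1 L2 J (\<lambda>_. 1) z * \<Phi> z t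
                         - periodic_conv L1 L2 J (\<lambda>y. \<Phi> y t) z) x)
        (at t within {0..T}))"

text \<open>
  A periodic grid function is its periodic extension to all of \<open>\<int> \<times> \<int>\<close>; the values at
  \<open>1 \<le> i \<le> m\<close>, \<open>1 \<le> j \<le> n\<close> determine it.  A vertex-centered function \<open>f\<close> is indexed by the
  integer part: \<open>f k l\<close> is its value at \<open>(p\<^bsub>k+1/2\<^esub>, p\<^bsub>l+1/2\<^esub>)\<close>.
\<close>

type_synonym grid_fun = "int \<Rightarrow> int \<Rightarrow> real"

definition grid_pt :: "real \<Rightarrow> real \<Rightarrow> real" where
  "grid_pt h r = (r - 1 / 2) * h"

definition periodic_grid :: "nat \<Rightarrow> nat \<Rightarrow> grid_fun \<Rightarrow> bool" where
  "periodic_grid m n \<phi> \<longleftrightarrow>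
     (\<forall>i j a b. \<phi> (i + a * int m) (j + b * int n) = \<phi> i j)"

definition cell_restrict :: "real \<Rightarrow> (real \<times> real \<Rightarrow> real) \<Rightarrow> grid_fun" where
  "cell_restrict h F i j = F (grid_pt h (of_int i), grid_pt h (of_int j))"

definition vertex_restrict :: "real \<Rightarrow> (real \<times> real \<Rightarrow> real) \<Rightarrow> grid_fun" where
  "vertex_restrict h F k l = F (grid_pt h (of_int k + 1 / 2), grid_pt h (of_int l + 1 / 2))"

definition grid_norm :: "real \<Rightarrow> nat \<Rightarrow> nat \<Rightarrow> grid_fun \<Rightarrow> real" where
  "grid_norm h m n \<phi> = sqrt (h\<^sup>2 * (\<Sum>i=1..int m. \<Sum>j=1..int n. (\<phi> i j)\<^sup>2))"

definition discrete_laplacian :: "real \<Rightarrow> grid_fun \<Rightarrow> grid_fun" where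
  "discrete_laplacian h \<phi> i j =
     (\<phi> (i + 1) j + \<phi> (i - 1) j + \<phi> i (j + 1) + \<phi> i (j - 1) - 4 * \<phi> i j) / h\<^sup>2"

definition discrete_conv :: "real \<Rightarrow> nat \<Rightarrow> nat \<Rightarrow> grid_fun \<Rightarrow> grid_fun \<Rightarrow> grid_fun" where
  "discrete_conv h m n f \<phi> i j =
     h\<^sup>2 * (\<Sum>k=1..int m. \<Sum>l=1..int n. f k l * \<phi> (i - k) (j - l))"

text \<open>
  \<open>[J \<star> 1] + \<gamma>\<close>; the index \<open>0 0\<close> is arbitrary because the convolution with \<open>1\<close> is constant.
\<close>

definition B_const :: "real \<Rightarrow> nat \<Rightarrow> nat \<Rightarrow> (real \<times> real \<Rightarrow> real) \<Rightarrow> real \<Rightarrow> real" where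
  "B_const h m n J \<gamma> = discrete_conv h m n (vertex_restrict h J) (\<lambda>_ _. 1) 0 0 + \<gamma>"

lemma B_const_eq:
  "B_const h m n J \<gamma> = discrete_conv h m n (vertex_restrict h J) (\<lambda>_ _. 1) i j + \<gamma>"
  by (simp add: B_const_def discrete_conv_def)

definition eta :: "real \<Rightarrow> real \<Rightarrow> real" where
  "eta a b = (1 / 4) * (a\<^sup>2 + b\<^sup>2) * (a + b)"

text \<open>The arguments \<open>p\<close>, \<open>q\<close>, \<open>r\<close> are the time levels \<open>k - 1\<close>, \<open>k\<close>, \<open>k + 1\<close>.\<close>

definition chem_potential ::
    "real \<Rightarrow> nat \<Rightarrow> nat \<Rightarrow> real \<Rightarrow> real \<Rightarrow> (real \<times> real \<Rightarrow> real) \<Rightarrow> (real \<times> real \<Rightarrow> real) \<Rightarrow>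
     grid_fun \<Rightarrow> grid_fun \<Rightarrow> grid_fun \<Rightarrow> grid_fun" where
  "chem_potential h m n \<gamma>c \<gamma>e Jc Je p q r =
     (let mid = (\<lambda>i j. (q i j + r i j) / 2);
          hat = (\<lambda>i j. 3 / 2 * q i j - 1 / 2 * p i j)
      in (\<lambda>i j. eta (q i j) (r i j)
            + B_const h m n Jc \<gamma>c * mid i j
            - B_const h m n Je \<gamma>e * hat i j
            - discrete_conv h m n (vertex_restrict h (\<lambda>x. Jc x - Je x)) hat i j))"

definition nCH_scheme ::
    "real \<Rightarrow> real \<Rightarrow> nat \<Rightarrow> nat \<Rightarrow> real \<Rightarrow> real \<Rightarrow> (real \<times> real \<Rightarrow> real) \<Rightarrow>
     (real \<times> real \<Rightarrow> real) \<Rightarrow> (nat \<Rightarrow> grid_fun) \<Rightarrow> bool" where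
  "nCH_scheme s h m n \<gamma>c \<gamma>e Jc Je \<phi> \<longleftrightarrow>
     (\<forall>k. periodic_grid m n (\<phi> k)) \<and>
     (\<forall>k i j. \<phi> (k + 1) i j - \<phi> k i j =
        s * discrete_laplacian h
              (chem_potential h m n \<gamma>c \<gamma>e Jc Je
                 (if k = 0 then \<phi> 0 else \<phi> (k - 1)) (\<phi> k) (\<phi> (k + 1))) i j)"

end

theory Submission
  imports Defs
begin

text \<open>
  The error equation is tested with the error \<open>W\<close> of the chemical potential instead of the error
  \<open>e\<close> itself.  As \<open>eta a b * (b - a) = (b ^ 4 - a ^ 4) / 4\<close>, the nonlinear part of \<open>W\<close> times the time
  increment of \<open>e\<close> is the increment of the relative potential
  \<open>P(A, e) = F(A - e) - F(A) + F'(A) e\<close>, \<open>F(x) = x\<^sup>4 / 4\<close>, up to a remainder of order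
  \<open>s (e\<^sup>2 + e\<^sup>4)\<close>.  The extrapolated concave terms contribute the increment of
  \<open>(Bc - Be) / 2 * e\<^sup>2\<close> and of a multiple of the squared increment of \<open>e\<close>, plus a non-negative term; the
  convolution is moved onto \<open>W\<close> by summation by parts and absorbed by the dissipation
  \<open>- s \<bar>\<nabla>W\<bar>\<^sup>2\<close>.  Because \<open>P(A, e) \<ge> e\<^sup>4 / 12\<close>, the resulting energy controls \<open>e\<^sup>2 + e\<^sup>4\<close>, and a
  discrete Gronwall argument closes without any maximum-norm bound on the numerical solution.
  The first step has truncation error \<open>O(h\<^sup>2 + s)\<close> only, which is harmless because it enters once,
  multiplied by \<open>s\<close>, while \<open>e\<close> vanishes initially.
\<close>

subsection \<open>Periodic grid sums\<close>

text \<open>Negative powers of h are the obstacle in both halves. For stability, the multiplier is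
  only the local part \<open>W'\<close> of the potential error: the energy identity is then
  pointwise algebra, and the nonlocal part \<open>V\<close> enters only through its gradient, where
  the differences fall on the smooth kernel and cost no more than a square sum of errors. The
  truncation error is paired with \<open>W'\<close> directly, so no inverse Laplacian is needed; the
  quadratic and cubic terms in that product are dominated by e^2 + e^4, one more reason to keep a
  quartic energy. For consistency, applying the discrete Laplacian to a mere pointwise defect of
  size s^2 or h^2 would cost h^-2. The defects in time are therefore estimated through their second
  space derivatives, and both the continuous and the discrete Laplacian are moved inside the
  convolution before quadrature is used.\<close>

lemma sum_int_Suc: "(\<Sum>i=1..int (Suc m). f i) = (\<Sum>i=1..int m. f i) + (f (int m + 1) :: real)"
proof -
  have "{1..int (Suc m)} = insert (int m + 1) {1..int m}" by auto
  then show ?thesis by (simp add: add.commute)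
qed

lemma sum_periodic_Suc:
  fixes f :: "int \<Rightarrow> real"
  assumes "\<And>i. f (i + int m) = f i"
  shows "(\<Sum>i=1..int m. f (i + 1)) = (\<Sum>i=1..int m. f i)"
proof -
  have "(\<Sum>i=1..int n. f (i + 1)) = (\<Sum>i=1..int n. f i) + f (1 + int n) - f 1" for n
  proof (induction n)
    case (Suc n)
    have "int (Suc n) = int n + 1" by simp
    then show ?case using Suc unfolding sum_int_Suc by (simp add: algebra_simps)
  qed simp
  from this[of m] show ?thesis using assms[of 1] by simp
qed

lemma sum_periodic_shift:
  fixes f :: "int \<Rightarrow> real"
  assumes "\<And>i. f (i + int m) = f i"
  shows "(\<Sum>i=1..int m. f (i + c)) = (\<Sum>i=1..int m. f i)"
proof (induction c rule: int_induct[where k = 0])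
  case base
  then show ?case by simp
next
  case (step1 c)
  have "f (i + int m + c) = f (i + c)" for i
    using assms[of "i + c"] by (simp add: algebra_simps)
  then have "(\<Sum>i=1..int m. f (i + 1 + c)) = (\<Sum>i=1..int m. f (i + c))"
    by (intro sum_periodic_Suc) 
  then show ?case using step1 by (simp add: algebra_simps)
next
  case (step2 c)
  have "f (i + int m + (c - 1)) = f (i + (c - 1))" for i
    using assms[of "i + (c - 1)"] by (simp add: algebra_simps)
  then have "(\<Sum>i=1..int m. f (i + 1 + (c - 1))) = (\<Sum>i=1..int m. f (i + (c - 1)))"
    by (intro sum_periodic_Suc) 
  then show ?case using step2 by simp
qed

text \<open>Reversing the order of the summands leaves only a shift of the index, which a full
  period absorbs.\<close>

lemma sum_periodic_reflect:
  fixes f :: "int \<Rightarrow> real"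
  assumes "\<And>i. f (i + int m) = f i"
  shows "(\<Sum>i=1..int m. f (c - i)) = (\<Sum>i=1..int m. f i)"
proof -
  have "(\<Sum>i=1..int m. f (c - i)) = (\<Sum>i=1..int m. f (i + (c - int m - 1)))"
    by (rule sum.reindex_bij_witness[of _ "\<lambda>i. int m + 1 - i" "\<lambda>i. int m + 1 - i"])
      (auto simp: algebra_simps)
  then show ?thesis using sum_periodic_shift[of f m, OF assms] by simp
qed

text \<open>The weight \<open>h\<^sup>2\<close> is left out, so that pointwise estimates pass
  through the sum without \<open>h\<close>; it is restored in the norm and in the energies.\<close>

definition grid_sum :: "nat \<Rightarrow> nat \<Rightarrow> grid_fun \<Rightarrow> real" where
  "grid_sum m n f = (\<Sum>i=1..int m. \<Sum>j=1..int n. f i j)"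

lemma grid_sum_add: "grid_sum m n (\<lambda>i j. f i j + g i j) = grid_sum m n f + grid_sum m n g"
  by (simp add: grid_sum_def sum.distrib)

lemma grid_sum_diff: "grid_sum m n (\<lambda>i j. f i j - g i j) = grid_sum m n f - grid_sum m n g"
  by (simp add: grid_sum_def sum_subtractf)

lemma grid_sum_minus: "grid_sum m n (\<lambda>i j. - f i j) = - grid_sum m n f"
  by (simp add: grid_sum_def sum_negf)

lemma grid_sum_cmult: "grid_sum m n (\<lambda>i j. c * f i j) = c * grid_sum m n f"
  by (simp add: grid_sum_def sum_distrib_left)

lemma grid_sum_const: "grid_sum m n (\<lambda>i j. c) = real m * real n * c"
  by (simp add: grid_sum_def)

lemma grid_sum_mono:
  "(\<And>i j. f i j \<le> g i j) \<Longrightarrow> grid_sum m n f \<le> grid_sum m n g"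
  unfolding grid_sum_def by (intro sum_mono)

lemma grid_sum_nonneg: "(\<And>i j. 0 \<le> f i j) \<Longrightarrow> 0 \<le> grid_sum m n f"
  unfolding grid_sum_def by (intro sum_nonneg)

lemma periodic_gridD:
  assumes "periodic_grid m n f"
  shows "f (i + int m) j = f i j" "f i (j + int n) = f i j"
  using assms[unfolded periodic_grid_def, rule_format, of i 1 j 0]
    assms[unfolded periodic_grid_def, rule_format, of i 0 j 1] by simp_all

lemma periodic_grid_comp:
  assumes "periodic_grid m n f" "periodic_grid m n g"
  shows "periodic_grid m n (\<lambda>i j. F (f i j) (g i j))"
  using assms unfolding periodic_grid_def by auto

lemma periodic_grid_shift:
  assumes "periodic_grid m n f"
  shows "periodic_grid m n (\<lambda>i j. f (i + a) (j + b))"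
  unfolding periodic_grid_def
proof (intro allI)
  fix i j c d
  show "f (i + c * int m + a) (j + d * int n + b) = f (i + a) (j + b)"
    using assms[unfolded periodic_grid_def, rule_format, of "i + a" c "j + b" d]
    by (simp add: algebra_simps)
qed

lemma grid_sum_shift:
  assumes "periodic_grid m n f"
  shows "grid_sum m n (\<lambda>i j. f (i + a) (j + b)) = grid_sum m n f"
proof -
  have "(\<Sum>j=1..int n. f i (j + b)) = (\<Sum>j=1..int n. f i j)" for i
    by (rule sum_periodic_shift) (rule periodic_gridD(2)[OF assms])
  moreover have "(\<Sum>i=1..int m. \<Sum>j=1..int n. f (i + a) j) = (\<Sum>i=1..int m. \<Sum>j=1..int n. f i j)"
    using periodic_gridD[OF assms]
    by (intro sum_periodic_shift[where f = "\<lambda>i. \<Sum>j=1..int n. f i j"]) simp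
  ultimately show ?thesis by (simp add: grid_sum_def)
qed

lemma grid_sum_reflect:
  assumes "periodic_grid m n f"
  shows "grid_sum m n (\<lambda>i j. f (a - i) (b - j)) = grid_sum m n f"
proof -
  have "(\<Sum>j=1..int n. f i (b - j)) = (\<Sum>j=1..int n. f i j)" for i
    by (rule sum_periodic_reflect) (rule periodic_gridD(2)[OF assms])
  moreover have "(\<Sum>i=1..int m. \<Sum>j=1..int n. f (a - i) j) = (\<Sum>i=1..int m. \<Sum>j=1..int n. f i j)"
    using periodic_gridD[OF assms]
    by (intro sum_periodic_reflect[where f = "\<lambda>i. \<Sum>j=1..int n. f i j"]) simp
  ultimately show ?thesis by (simp add: grid_sum_def)
qed

text \<open>The five-point stencil is the difference of forward differences at a cell and at its
  left and lower neighbours. Moving the neighbour terms \<open>?X\<close> and \<open>?Y\<close>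
  forward by one cell is free by periodicity, so no boundary terms appear.\<close>

lemma grid_sum_by_parts:
  assumes f: "periodic_grid m n f" and g: "periodic_grid m n g"
  shows "grid_sum m n (\<lambda>i j. f i j * discrete_laplacian h g i j) =
    - grid_sum m n (\<lambda>i j. ((f (i + 1) j - f i j) * (g (i + 1) j - g i j)
                         + (f i (j + 1) - f i j) * (g i (j + 1) - g i j)) / h\<^sup>2)"
proof -
  let ?X = "\<lambda>i j. f i j * (g i j - g (i - 1) j)"
  let ?Y = "\<lambda>i j. f i j * (g i j - g i (j - 1))"
  have X: "periodic_grid m n ?X"
    using periodic_grid_comp[OF f periodic_grid_comp[OF g periodic_grid_shift[OF g, of "-1" 0],
        where F="(-)"], where F="(*)"] by simp
  have Y: "periodic_grid m n ?Y"
    using periodic_grid_comp[OF f periodic_grid_comp[OF g periodic_grid_shift[OF g, of 0 "-1"],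
        where F="(-)"], where F="(*)"] by simp
  have "grid_sum m n (\<lambda>i j. f i j * discrete_laplacian h g i j) =
     grid_sum m n (\<lambda>i j. (1 / h\<^sup>2) * ((f i j * (g (i + 1) j - g i j) - ?X i j)
        + (f i j * (g i (j + 1) - g i j) - ?Y i j)))"
    unfolding discrete_laplacian_def
    by (rule arg_cong[where f="grid_sum m n"]) (auto intro!: ext simp: field_simps)
  also have "\<dots> = (1 / h\<^sup>2) * ((grid_sum m n (\<lambda>i j. f i j * (g (i + 1) j - g i j)) - grid_sum m n ?X)
        + (grid_sum m n (\<lambda>i j. f i j * (g i (j + 1) - g i j)) - grid_sum m n ?Y))"
    by (simp only: grid_sum_cmult grid_sum_add grid_sum_diff)
  also have "grid_sum m n ?X = grid_sum m n (\<lambda>i j. f (i + 1) j * (g (i + 1) j - g i j))"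
    using grid_sum_shift[OF X, of 1 0] by simp
  also have "grid_sum m n ?Y = grid_sum m n (\<lambda>i j. f i (j + 1) * (g i (j + 1) - g i j))"
    using grid_sum_shift[OF Y, of 0 1] by simp
  also have "(1 / h\<^sup>2) * ((grid_sum m n (\<lambda>i j. f i j * (g (i + 1) j - g i j))
         - grid_sum m n (\<lambda>i j. f (i + 1) j * (g (i + 1) j - g i j)))
      + (grid_sum m n (\<lambda>i j. f i j * (g i (j + 1) - g i j))
         - grid_sum m n (\<lambda>i j. f i (j + 1) * (g i (j + 1) - g i j)))) =
     grid_sum m n (\<lambda>i j. (1 / h\<^sup>2) * ((f i j * (g (i + 1) j - g i j) - f (i + 1) j * (g (i + 1) j - g i j))
        + (f i j * (g i (j + 1) - g i j) - f i (j + 1) * (g i (j + 1) - g i j))))"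
    by (simp only: grid_sum_cmult grid_sum_add grid_sum_diff)
  also have "\<dots> = grid_sum m n (\<lambda>i j. - (((f (i + 1) j - f i j) * (g (i + 1) j - g i j)
                         + (f i (j + 1) - f i j) * (g i (j + 1) - g i j)) / h\<^sup>2))"
    by (rule arg_cong[where f="grid_sum m n"])
      (intro ext, simp add: diff_divide_distrib add_divide_distrib algebra_simps)
  finally show ?thesis by (simp only: grid_sum_minus)
qed

lemma grid_sum_abs_square:
  "(grid_sum m n (\<lambda>i j. \<bar>f i j\<bar>))\<^sup>2 \<le> real m * real n * grid_sum m n (\<lambda>i j. (f i j)\<^sup>2)"
proof -
  let ?I = "{1..int m} \<times> {1..int n}"
  have "(\<Sum>p\<in>?I. \<bar>f (fst p) (snd p)\<bar>)\<^sup>2 \<le> (\<Sum>p\<in>?I. \<bar>f (fst p) (snd p)\<bar>\<^sup>2) * card ?I"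
    by (rule sum_squared_le_sum_of_squares) 
  then show ?thesis
    by (simp add: grid_sum_def sum.cartesian_product case_prod_beta mult_ac card_cartesian_product)
qed

section \<open>Discrete convolution\<close>

lemma discrete_conv_eq: "discrete_conv h m n f \<phi> i j = h\<^sup>2 * grid_sum m n (\<lambda>k l. f k l * \<phi> (i - k) (j - l))"
  by (simp add: discrete_conv_def grid_sum_def)

text \<open>A substitution in the summation index moves a translation from the argument onto the
  kernel \<open>f\<close>; this is how differences of a convolution come to fall on the smooth
  kernel.\<close>

lemma discrete_conv_shift:
  assumes f: "periodic_grid m n f" and g: "periodic_grid m n g"
  shows "discrete_conv h m n f g (i + a) (j + b) = discrete_conv h m n (\<lambda>k l. f (k + a) (l + b)) g i j"
proof -
  let ?F = "\<lambda>k l. f k l * g (i + a - k) (j + b - l)"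
  have "periodic_grid m n ?F"
    unfolding periodic_grid_def
  proof (intro allI)
    fix k l c d
    have "i + a - (k + c * int m) = i + a - k + (- c) * int m"
      "j + b - (l + d * int n) = j + b - l + (- d) * int n" by (simp_all add: algebra_simps)
    then show "?F (k + c * int m) (l + d * int n) = ?F k l"
      using f g unfolding periodic_grid_def by metis
  qed
  from grid_sum_shift[OF this, of a b]
  have "grid_sum m n ?F = grid_sum m n (\<lambda>k l. f (k + a) (l + b) * g (i - k) (j - l))"
    by (simp add: algebra_simps)
  then show ?thesis by (simp add: discrete_conv_eq)
qed

lemma discrete_conv_periodic:
  assumes "periodic_grid m n g"
  shows "periodic_grid m n (discrete_conv h m n f g)"
  unfolding periodic_grid_def
proof (intro allI)
  fix i j a b
  have "i + a * int m - k = i - k + a * int m" "j + b * int n - l = j - l + b * int n" for k l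
    by simp_all
  then have "g (i + a * int m - k) (j + b * int n - l) = g (i - k) (j - l)" for k l
    using assms unfolding periodic_grid_def by metis
  then show "discrete_conv h m n f g (i + a * int m) (j + b * int n) = discrete_conv h m n f g i j"
    by (simp add: discrete_conv_eq)
qed

text \<open>Young's inequality for a bounded kernel: reflecting the index turns the translated sum
  of absolute values of \<open>g\<close> into the sum over one period.\<close>

lemma discrete_conv_abs_le:
  assumes g: "periodic_grid m n g" and f: "\<And>k l. \<bar>f k l\<bar> \<le> M"
  shows "\<bar>discrete_conv h m n f g i j\<bar> \<le> M * (h\<^sup>2 * grid_sum m n (\<lambda>i j. \<bar>g i j\<bar>))"
proof -
  have "\<bar>grid_sum m n (\<lambda>k l. f k l * g (i - k) (j - l))\<bar> \<le> grid_sum m n (\<lambda>k l. \<bar>f k l * g (i - k) (j - l)\<bar>)"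
    unfolding grid_sum_def by (intro order_trans[OF sum_abs] sum_mono order_trans[OF sum_abs]) simp
  also have "\<dots> \<le> grid_sum m n (\<lambda>k l. M * \<bar>g (i - k) (j - l)\<bar>)"
    by (intro grid_sum_mono) (simp add: abs_mult mult_right_mono f)
  also have "\<dots> = M * grid_sum m n (\<lambda>i j. \<bar>g i j\<bar>)"
    using grid_sum_reflect[of m n "\<lambda>i j. \<bar>g i j\<bar>" i j] g
    by (simp add: grid_sum_cmult periodic_grid_def)
  finally have "h\<^sup>2 * \<bar>grid_sum m n (\<lambda>k l. f k l * g (i - k) (j - l))\<bar> \<le> h\<^sup>2 * (M * grid_sum m n (\<lambda>i j. \<bar>g i j\<bar>))"
    by (simp add: mult_left_mono)
  then show ?thesis by (simp add: discrete_conv_eq abs_mult mult_ac)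
qed

lemma discrete_conv_diff_left:
  "discrete_conv h m n (\<lambda>k l. f k l - f' k l) g i j = discrete_conv h m n f g i j - discrete_conv h m n f' g i j"
  by (simp add: discrete_conv_eq algebra_simps grid_sum_diff)

lemma discrete_conv_diff_right:
  "discrete_conv h m n f (\<lambda>k l. g k l - g' k l) i j = discrete_conv h m n f g i j - discrete_conv h m n f g' i j"
  by (simp add: discrete_conv_eq algebra_simps grid_sum_diff)

text \<open>The difference falls on the kernel and gains a factor \<open>h\<close>; its square gains
  exactly the \<open>h\<^sup>2\<close> that a discrete gradient loses. Cauchy-Schwarz replaces the
  absolute sum by a square sum at the price of the area \<open>L1 * L2\<close>.\<close>

lemma discrete_conv_gradient:
  assumes f: "periodic_grid m n f" and g: "periodic_grid m n g"
    and M: "\<And>k l. \<bar>f (k + a) (l + b) - f k l\<bar> \<le> M * h" and h: "0 < h"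
    and L: "L1 = real m * h" "L2 = real n * h"
  shows "(discrete_conv h m n f g (i + a) (j + b) - discrete_conv h m n f g i j)\<^sup>2
     \<le> h\<^sup>2 * (M\<^sup>2 * L1 * L2 * (h\<^sup>2 * grid_sum m n (\<lambda>i j. (g i j)\<^sup>2)))"
proof -
  let ?S = "grid_sum m n (\<lambda>i j. \<bar>g i j\<bar>)"
  have "\<bar>discrete_conv h m n f g (i + a) (j + b) - discrete_conv h m n f g i j\<bar>
     \<le> M * h * (h\<^sup>2 * ?S)"
    unfolding discrete_conv_shift[OF f g] discrete_conv_diff_left[symmetric]
    by (rule discrete_conv_abs_le[OF g M])
  then have "\<bar>discrete_conv h m n f g (i + a) (j + b) - discrete_conv h m n f g i j\<bar>\<^sup>2
     \<le> (M * h * (h\<^sup>2 * ?S))\<^sup>2"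
    by (rule power_mono) simp
  also have "\<dots> = M\<^sup>2 * h^6 * ?S\<^sup>2" by (simp add: power_mult_distrib)
  also have "\<dots> \<le> M\<^sup>2 * h^6 * (real m * real n * grid_sum m n (\<lambda>i j. (g i j)\<^sup>2))"
    by (intro mult_left_mono grid_sum_abs_square) simp
  also have "\<dots> = h\<^sup>2 * (M\<^sup>2 * L1 * L2 * (h\<^sup>2 * grid_sum m n (\<lambda>i j. (g i j)\<^sup>2)))"
    by (simp add: L power2_eq_square eval_nat_numeral)
  finally show ?thesis by simp
qed

subsection \<open>The relative energy\<close>

text \<open>\<open>F (A - e) - F A + F' A * e\<close> for \<open>F x = x ^ 4 / 4\<close>: the convex potential relative to its tangent at \<open>A\<close>.\<close>

definition rel_potential :: "real \<Rightarrow> real \<Rightarrow> real" where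
  "rel_potential A e = e\<^sup>2 * (6 * A\<^sup>2 - 4 * A * e + e\<^sup>2) / 4"

text \<open>The part of \<open>eta A B - eta (A - e) (B - f)\<close> that is nonlinear in \<open>(e, f)\<close>.\<close>

definition eta_remainder :: "real \<Rightarrow> real \<Rightarrow> real \<Rightarrow> real \<Rightarrow> real" where
  "eta_remainder A B e f = eta e f
     - ((3 * A + B) * e\<^sup>2 + 2 * (A + B) * e * f + (A + 3 * B) * f\<^sup>2) / 4"

text \<open>For fixed \<open>e\<close> the minimum over \<open>A\<close> is attained at
  \<open>A = e / 3\<close>; this gives both the constant 1/12 and the square that remains.\<close>

lemma rel_potential_ge: "e ^ 4 / 12 \<le> rel_potential A e"
proof -
  have "rel_potential A e - e ^ 4 / 12 = e\<^sup>2 * (3 * A - e)\<^sup>2 / 6"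
    unfolding rel_potential_def by (simp add: power2_eq_square field_simps eval_nat_numeral)
  moreover have "0 \<le> e\<^sup>2 * (3 * A - e)\<^sup>2 / 6" by simp
  ultimately show ?thesis by linarith
qed

text \<open>The errors \<open>g\<close>, \<open>e\<close>, \<open>f\<close> belong to the levels k -
  1, k, k + 1. The quartic part uses that \<open>eta a b * (b - a)\<close> is an increment of x^4 /
  4; the increment of the numerical values is \<open>B - A\<close> minus \<open>f - e\<close>, and
  after the linear parts cancel the mismatch is \<open>B - A\<close> times a term of at least second
  order in the errors. For the concave part, the extrapolation differs from the average
  \<open>(e + f) / 2\<close> by half of \<open>(f - e) - (e - g)\<close>, and x (x - y) = (x^2 - y^2
  + (x - y)^2) / 2 with x = f - e and y = e - g yields the three terms with
  \<open>Be / 4\<close>.\<close>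

lemma energy_identity:
  "(eta A B - eta (A - e) (B - f) + Bc * ((e + f) / 2) - Be * (3 / 2 * e - 1 / 2 * g)) * (f - e) =
     (rel_potential B f + (Bc - Be) / 2 * f\<^sup>2 + Be / 4 * (f - e)\<^sup>2)
   - (rel_potential A e + (Bc - Be) / 2 * e\<^sup>2 + Be / 4 * (e - g)\<^sup>2)
   + Be / 4 * ((f - e) - (e - g))\<^sup>2 + (B - A) * eta_remainder A B e f"
  unfolding eta_def rel_potential_def eta_remainder_def
  by (simp add: field_simps power2_eq_square)

lemma abs_mult_le_squares: "\<bar>x * y\<bar> \<le> (x\<^sup>2 + y\<^sup>2) / (2 :: real)"
  using sum_squares_bound[of "\<bar>x\<bar>" "\<bar>y\<bar>"] by (simp add: abs_mult)

text \<open>The interpolation by which an energy made of squares and fourth powers also controls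
  cubic terms.\<close>

lemma abs_cube_le: "\<bar>x\<bar> ^ 3 \<le> x\<^sup>2 + (x :: real) ^ 4"
proof -
  have "\<bar>x * x\<^sup>2\<bar> \<le> (x\<^sup>2 + (x\<^sup>2)\<^sup>2) / 2" by (rule abs_mult_le_squares)
  also have "\<bar>x * x\<^sup>2\<bar> = \<bar>x\<bar> ^ 3" by (simp add: abs_mult eval_nat_numeral)
  also have "(x\<^sup>2)\<^sup>2 = x ^ 4" by (simp flip: power_mult)
  also have "(x\<^sup>2 + x ^ 4) / 2 \<le> x\<^sup>2 + x ^ 4" by simp
  finally show ?thesis .
qed

lemma abs_eta_le: "\<bar>eta x y\<bar> \<le> \<bar>x\<bar> ^ 3 + \<bar>y\<bar> ^ 3"
proof -
  define a b where "a = \<bar>x\<bar>" and "b = \<bar>y\<bar>"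
  have ab: "0 \<le> a" "0 \<le> b" by (simp_all add: a_def b_def)
  have "\<bar>eta x y\<bar> = (1 / 4) * (a\<^sup>2 + b\<^sup>2) * \<bar>x + y\<bar>"
    by (simp add: eta_def abs_mult a_def b_def)
  also have "\<dots> \<le> (1 / 4) * (a\<^sup>2 + b\<^sup>2) * (a + b)"
    by (intro mult_left_mono) (auto simp: a_def b_def)
  also have "\<dots> \<le> a ^ 3 + b ^ 3"
  proof -
    have "a ^ 3 + b ^ 3 - (1 / 4) * (a\<^sup>2 + b\<^sup>2) * (a + b) = (a + b) * (2 * a\<^sup>2 + 2 * b\<^sup>2 + (a - b)\<^sup>2 * 4) / 8"
      by (simp add: field_simps power2_eq_square eval_nat_numeral)
    moreover have "0 \<le> (a + b) * (2 * a\<^sup>2 + 2 * b\<^sup>2 + (a - b)\<^sup>2 * 4) / 8" using ab by simp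
    ultimately show ?thesis by linarith
  qed
  finally show ?thesis by (simp add: a_def b_def)
qed

text \<open>Taylor expansion of \<open>eta\<close> about \<open>(A, B)\<close>: the two coefficients
  are its partial derivatives there.\<close>

lemma eta_diff_eq:
  "eta A B - eta (A - e) (B - f) =
     (3 * A\<^sup>2 + 2 * A * B + B\<^sup>2) / 4 * e + (A\<^sup>2 + 2 * A * B + 3 * B\<^sup>2) / 4 * f + eta_remainder A B e f"
  unfolding eta_def eta_remainder_def by (simp add: field_simps power2_eq_square)

lemma eta_remainder_le:
  assumes "\<bar>A\<bar> \<le> M" "\<bar>B\<bar> \<le> M"
  shows "\<bar>eta_remainder A B e f\<bar> \<le> (1 + 2 * M) * (e\<^sup>2 + e ^ 4 + (f\<^sup>2 + f ^ 4))"
proof -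
  have 1: "\<bar>(3 * A + B) * e\<^sup>2\<bar> \<le> 4 * M * e\<^sup>2" "\<bar>(A + 3 * B) * f\<^sup>2\<bar> \<le> 4 * M * f\<^sup>2"
    unfolding abs_mult using assms by (auto intro!: mult_right_mono)
  have 2: "\<bar>2 * (A + B) * e * f\<bar> \<le> 4 * M * ((e\<^sup>2 + f\<^sup>2) / 2)"
  proof -
    have "\<bar>2 * (A + B) * e * f\<bar> = \<bar>2 * (A + B)\<bar> * \<bar>e * f\<bar>" by (simp add: abs_mult)
    also have "\<dots> \<le> 4 * M * ((e\<^sup>2 + f\<^sup>2) / 2)"
      using assms by (intro mult_mono abs_mult_le_squares) auto
    finally show ?thesis .
  qed
  have 3: "\<bar>eta e f\<bar> \<le> (e\<^sup>2 + e ^ 4) + (f\<^sup>2 + f ^ 4)"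
    using abs_eta_le[of e f] abs_cube_le[of e] abs_cube_le[of f] by linarith
  have "\<bar>w - (x + y + z) / 4\<bar> \<le> W + (X + Y + Z) / 4"
    if "\<bar>x\<bar> \<le> X" "\<bar>z\<bar> \<le> Z" "\<bar>y\<bar> \<le> Y" "\<bar>w\<bar> \<le> W" for w x y z W X Y Z :: real
    using that by (simp add: abs_le_iff field_simps)
  from this[OF 1 2 3] have "\<bar>eta_remainder A B e f\<bar>
      \<le> (e\<^sup>2 + e ^ 4) + (f\<^sup>2 + f ^ 4) + (4 * M * e\<^sup>2 + 4 * M * ((e\<^sup>2 + f\<^sup>2) / 2) + 4 * M * f\<^sup>2) / 4"
    unfolding eta_remainder_def .
  also have "\<dots> \<le> (1 + 2 * M) * (e\<^sup>2 + e ^ 4 + (f\<^sup>2 + f ^ 4))"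
  proof -
    have "0 \<le> M * e\<^sup>2" "0 \<le> M * f\<^sup>2" "0 \<le> M * e ^ 4" "0 \<le> M * f ^ 4" using assms by auto
    then show ?thesis by (simp add: algebra_simps)
  qed
  finally show ?thesis .
qed

text \<open>This bounds the multiplier of the truncation error. The linear part is kept apart: times
  a truncation error it is small of second order by Young's inequality, while the nonlinear part is
  already of the size of the energy.\<close>

lemma local_potential_le:
  assumes AB: "\<bar>A\<bar> \<le> M" "\<bar>B\<bar> \<le> M" and c: "\<bar>Bc\<bar> \<le> M" "\<bar>Be\<bar> \<le> M"
  shows "\<bar>eta A B - eta (A - e) (B - f) + Bc * ((e + f) / 2) - Be * (3 / 2 * e - 1 / 2 * g)\<bar>
    \<le> (2 * M\<^sup>2 + 2 * M) * (\<bar>e\<bar> + \<bar>f\<bar> + \<bar>g\<bar>) + (1 + 2 * M) * (e\<^sup>2 + e ^ 4 + (f\<^sup>2 + f ^ 4))"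
proof -
  have M: "0 \<le> M" using AB by linarith
  have "A\<^sup>2 \<le> M\<^sup>2" "B\<^sup>2 \<le> M\<^sup>2"
    using AB M by (simp_all flip: abs_le_square_iff)
  moreover have "\<bar>A * B\<bar> \<le> M\<^sup>2"
    using AB by (simp add: abs_mult power2_eq_square mult_mono)
  ultimately have "\<bar>3 * A\<^sup>2 + 2 * (A * B) + B\<^sup>2\<bar> \<le> 8 * M\<^sup>2"
    "\<bar>A\<^sup>2 + 2 * (A * B) + 3 * B\<^sup>2\<bar> \<le> 8 * M\<^sup>2"
    using zero_le_power2[of A] zero_le_power2[of B] by linarith+
  then have "\<bar>(3 * A\<^sup>2 + 2 * A * B + B\<^sup>2) / 4\<bar> \<le> 2 * M\<^sup>2" "\<bar>(A\<^sup>2 + 2 * A * B + 3 * B\<^sup>2) / 4\<bar> \<le> 2 * M\<^sup>2"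
    by (simp_all add: mult.assoc)
  then have 1: "\<bar>(3 * A\<^sup>2 + 2 * A * B + B\<^sup>2) / 4 * e\<bar> \<le> 2 * M\<^sup>2 * \<bar>e\<bar>"
    "\<bar>(A\<^sup>2 + 2 * A * B + 3 * B\<^sup>2) / 4 * f\<bar> \<le> 2 * M\<^sup>2 * \<bar>f\<bar>"
    unfolding abs_mult[of _ e] abs_mult[of _ f] by (intro mult_right_mono; simp)+
  have 2: "\<bar>Bc * ((e + f) / 2)\<bar> \<le> M * ((\<bar>e\<bar> + \<bar>f\<bar>) / 2)"
    unfolding abs_mult[of Bc] using c M by (intro mult_mono) auto
  have "\<bar>3 / 2 * e - 1 / 2 * g\<bar> \<le> 3 / 2 * \<bar>e\<bar> + 1 / 2 * \<bar>g\<bar>" by linarith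
  then have 3: "\<bar>Be * (3 / 2 * e - 1 / 2 * g)\<bar> \<le> M * (3 / 2 * \<bar>e\<bar> + 1 / 2 * \<bar>g\<bar>)"
    unfolding abs_mult[of Be] using c M by (intro mult_mono) auto
  have tri: "\<bar>x + y + z + u - v\<bar> \<le> \<bar>x\<bar> + \<bar>y\<bar> + \<bar>z\<bar> + \<bar>u\<bar> + \<bar>v\<bar>" for x y z u v :: real by linarith
  have "\<bar>eta A B - eta (A - e) (B - f) + Bc * ((e + f) / 2) - Be * (3 / 2 * e - 1 / 2 * g)\<bar>
    \<le> 2 * M\<^sup>2 * \<bar>e\<bar> + 2 * M\<^sup>2 * \<bar>f\<bar> + (1 + 2 * M) * (e\<^sup>2 + e ^ 4 + (f\<^sup>2 + f ^ 4))
     + M * ((\<bar>e\<bar> + \<bar>f\<bar>) / 2) + M * (3 / 2 * \<bar>e\<bar> + 1 / 2 * \<bar>g\<bar>)"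
    unfolding eta_diff_eq
    by (rule order_trans[OF tri]) (intro add_mono 1 2 3 eta_remainder_le[OF AB])
  also have "\<dots> \<le> (2 * M\<^sup>2 + 2 * M) * (\<bar>e\<bar> + \<bar>f\<bar> + \<bar>g\<bar>) + (1 + 2 * M) * (e\<^sup>2 + e ^ 4 + (f\<^sup>2 + f ^ 4))"
  proof -
    have "(2 * M\<^sup>2 + 2 * M) * (\<bar>e\<bar> + \<bar>f\<bar> + \<bar>g\<bar>)
      - (2 * M\<^sup>2 * \<bar>e\<bar> + 2 * M\<^sup>2 * \<bar>f\<bar> + M * ((\<bar>e\<bar> + \<bar>f\<bar>) / 2) + M * (3 / 2 * \<bar>e\<bar> + 1 / 2 * \<bar>g\<bar>))
      = 2 * M\<^sup>2 * \<bar>g\<bar> + 3 / 2 * M * \<bar>f\<bar> + 3 / 2 * M * \<bar>g\<bar>"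
      by (simp add: field_simps)
    moreover have "0 \<le> 2 * M\<^sup>2 * \<bar>g\<bar> + 3 / 2 * M * \<bar>f\<bar> + 3 / 2 * M * \<bar>g\<bar>" using M by simp
    ultimately show ?thesis by argo
  qed
  finally show ?thesis .
qed

section \<open>Energy estimate for one time step\<close>

definition rel_energy :: "nat \<Rightarrow> nat \<Rightarrow> real \<Rightarrow> real \<Rightarrow> grid_fun \<Rightarrow> grid_fun \<Rightarrow> grid_fun \<Rightarrow> real" where
  "rel_energy m n Bc Be A g e = grid_sum m n (\<lambda>i j. rel_potential (A i j) (e i j)
      + (Bc - Be) / 2 * (e i j)\<^sup>2 + Be / 4 * (e i j - g i j)\<^sup>2)"

text \<open>Fourth powers come from \<open>rel_potential\<close>, squares from the gap between
  \<open>Bc\<close> and \<open>Be\<close>; the term left by the extrapolation is non-negative and is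
  dropped.\<close>

lemma rel_energy_ge:
  assumes "\<alpha> \<le> Bc - Be" "0 \<le> Be"
  shows "min (1 / 12) (\<alpha> / 2) * grid_sum m n (\<lambda>i j. (e i j)\<^sup>2 + e i j ^ 4) \<le> rel_energy m n Bc Be A g e"
  unfolding rel_energy_def grid_sum_cmult[symmetric]
proof (rule grid_sum_mono)
  fix i j
  have "min (1 / 12) (\<alpha> / 2) * e i j ^ 4 \<le> 1 / 12 * e i j ^ 4"
    by (intro mult_right_mono) auto
  moreover have "min (1 / 12) (\<alpha> / 2) * (e i j)\<^sup>2 \<le> (Bc - Be) / 2 * (e i j)\<^sup>2"
    using assms by (intro mult_right_mono) auto
  moreover have "0 \<le> Be / 4 * (e i j - g i j)\<^sup>2" using assms by simp
  ultimately show "min (1 / 12) (\<alpha> / 2) * ((e i j)\<^sup>2 + e i j ^ 4)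
      \<le> rel_potential (A i j) (e i j) + (Bc - Be) / 2 * (e i j)\<^sup>2 + Be / 4 * (e i j - g i j)\<^sup>2"
    using rel_potential_ge[of "e i j" "A i j"] by (simp add: distrib_left)
qed

text \<open>Here \<open>A\<close>, \<open>B\<close> are the exact values at the old and the new
  level. The increment equation is multiplied by \<open>W'\<close> rather than by
  \<open>W' - V\<close>, so that \<open>energy_identity\<close> applies cell by cell. Writing
  \<open>W'\<close> as \<open>W + V\<close> in front of the Laplacian of \<open>W\<close> then gives
  the dissipation and one cross term with the gradient of \<open>V\<close>.\<close>

lemma energy_step:
  fixes A B e f g V \<tau> :: grid_fun and Bc Be :: real
  defines "W' \<equiv> (\<lambda>i j. eta (A i j) (B i j) - eta (A i j - e i j) (B i j - f i j)
      + Bc * ((e i j + f i j) / 2) - Be * (3 / 2 * e i j - 1 / 2 * g i j))"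
  assumes err: "\<And>i j. f i j - e i j = s * (discrete_laplacian h (\<lambda>i j. W' i j - V i j) i j + \<tau> i j)"
    and per: "periodic_grid m n (\<lambda>i j. W' i j - V i j)" "periodic_grid m n V"
    and s: "0 < s" and h: "0 < h" and Be: "0 \<le> Be"
  shows "rel_energy m n Bc Be B e f \<le> rel_energy m n Bc Be A g e
     + s * grid_sum m n (\<lambda>i j. ((V (i + 1) j - V i j)\<^sup>2 + (V i (j + 1) - V i j)\<^sup>2) / (4 * h\<^sup>2))
     + s * grid_sum m n (\<lambda>i j. \<bar>\<tau> i j\<bar> * \<bar>W' i j\<bar>)
     + grid_sum m n (\<lambda>i j. \<bar>B i j - A i j\<bar> * \<bar>eta_remainder (A i j) (B i j) (e i j) (f i j)\<bar>)"
proof -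
  define W where "W = (\<lambda>i j. W' i j - V i j)"
  let ?G = "\<lambda>i j. ((W (i + 1) j - W i j) * (W (i + 1) j - W i j)
                         + (W i (j + 1) - W i j) * (W i (j + 1) - W i j)) / h\<^sup>2"
  let ?GV = "\<lambda>i j. ((V (i + 1) j - V i j) * (W (i + 1) j - W i j)
                         + (V i (j + 1) - V i j) * (W i (j + 1) - W i j)) / h\<^sup>2"
  let ?Q = "\<lambda>i j. ((V (i + 1) j - V i j)\<^sup>2 + (V i (j + 1) - V i j)\<^sup>2) / (4 * h\<^sup>2)"
  let ?R = "\<lambda>i j. eta_remainder (A i j) (B i j) (e i j) (f i j)"
  have "grid_sum m n (\<lambda>i j. W' i j * (f i j - e i j)) =
      grid_sum m n (\<lambda>i j. s * (W i j * discrete_laplacian h W i j + V i j * discrete_laplacian h W i j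
         + \<tau> i j * W' i j))"
    by (rule arg_cong[where f="grid_sum m n"]) (auto intro!: ext simp: err W_def algebra_simps)
  also have "\<dots> = s * (- grid_sum m n ?G + - grid_sum m n ?GV + grid_sum m n (\<lambda>i j. \<tau> i j * W' i j))"
    using per unfolding W_def[symmetric]
    by (simp add: grid_sum_cmult grid_sum_add grid_sum_by_parts)
  also have "\<dots> = s * grid_sum m n (\<lambda>i j. - ?G i j + - ?GV i j + \<tau> i j * W' i j)"
    by (simp only: grid_sum_add grid_sum_minus)
  also have "\<dots> \<le> s * grid_sum m n (\<lambda>i j. ?Q i j + \<bar>\<tau> i j\<bar> * \<bar>W' i j\<bar>)"
  proof (intro mult_left_mono grid_sum_mono)
    fix i j
    define a b c d where "a = W (i + 1) j - W i j" and "b = W i (j + 1) - W i j"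
      and "c = V (i + 1) j - V i j" and "d = V i (j + 1) - V i j"
    \<comment> \<open>Completing the square: the dissipation absorbs the cross term and leaves a
      quarter of the squared gradient of \<open>V\<close>, hence the denominator
      \<open>4 * h\<^sup>2\<close>.\<close>
    have "(a * a + b * b) / h\<^sup>2 + (c * a + d * b) / h\<^sup>2 + (c\<^sup>2 + d\<^sup>2) / (4 * h\<^sup>2)
        = ((a + c / 2)\<^sup>2 + (b + d / 2)\<^sup>2) / h\<^sup>2"
      using h by (simp add: field_simps power2_eq_square)
    moreover have "0 \<le> ((a + c / 2)\<^sup>2 + (b + d / 2)\<^sup>2) / h\<^sup>2" by simp
    ultimately have "- ((a * a + b * b) / h\<^sup>2) + - ((c * a + d * b) / h\<^sup>2) \<le> (c\<^sup>2 + d\<^sup>2) / (4 * h\<^sup>2)"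
      by linarith
    moreover have "\<tau> i j * W' i j \<le> \<bar>\<tau> i j\<bar> * \<bar>W' i j\<bar>" by (simp flip: abs_mult)
    ultimately show "- ?G i j + - ?GV i j + \<tau> i j * W' i j \<le> ?Q i j + \<bar>\<tau> i j\<bar> * \<bar>W' i j\<bar>"
      unfolding a_def b_def c_def d_def by linarith
  qed (use s in simp)
  finally have up: "grid_sum m n (\<lambda>i j. W' i j * (f i j - e i j)) \<le>
      s * grid_sum m n ?Q + s * grid_sum m n (\<lambda>i j. \<bar>\<tau> i j\<bar> * \<bar>W' i j\<bar>)"
    by (simp only: grid_sum_add distrib_left)
  have "grid_sum m n (\<lambda>i j. (rel_potential (B i j) (f i j) + (Bc - Be) / 2 * (f i j)\<^sup>2 + Be / 4 * (f i j - e i j)\<^sup>2)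
      - (rel_potential (A i j) (e i j) + (Bc - Be) / 2 * (e i j)\<^sup>2 + Be / 4 * (e i j - g i j)\<^sup>2)
      - \<bar>B i j - A i j\<bar> * \<bar>?R i j\<bar>) \<le> grid_sum m n (\<lambda>i j. W' i j * (f i j - e i j))"
  proof (rule grid_sum_mono)
    fix i j
    have "- (\<bar>B i j - A i j\<bar> * \<bar>?R i j\<bar>) \<le> (B i j - A i j) * ?R i j"
      unfolding abs_mult[symmetric] using abs_ge_minus_self[of "(B i j - A i j) * ?R i j"] by linarith
    moreover have "0 \<le> Be / 4 * ((f i j - e i j) - (e i j - g i j))\<^sup>2" using Be by simp
    ultimately show "(rel_potential (B i j) (f i j) + (Bc - Be) / 2 * (f i j)\<^sup>2 + Be / 4 * (f i j - e i j)\<^sup>2)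
      - (rel_potential (A i j) (e i j) + (Bc - Be) / 2 * (e i j)\<^sup>2 + Be / 4 * (e i j - g i j)\<^sup>2)
      - \<bar>B i j - A i j\<bar> * \<bar>?R i j\<bar> \<le> W' i j * (f i j - e i j)"
      unfolding W'_def energy_identity by linarith
  qed
  then have "rel_energy m n Bc Be B e f - rel_energy m n Bc Be A g e
      - grid_sum m n (\<lambda>i j. \<bar>B i j - A i j\<bar> * \<bar>?R i j\<bar>) \<le> grid_sum m n (\<lambda>i j. W' i j * (f i j - e i j))"
    by (simp only: rel_energy_def grid_sum_diff)
  with up show ?thesis by linarith
qed

text \<open>\<open>M\<close> bounds all data at once. In \<open>N\<close> the first term stems from
  the gradient of the kernel; \<open>(1 + M) * (1 + 2 * M)\<close> joins the nonlinear part of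
  \<open>W'\<close> paired with \<open>\<tau>\<close> and the remainder multiplied by
  \<open>B - A\<close>; \<open>2 * M\<^sup>2 + 2 * M\<close> is the linear part of
  \<open>W'\<close>. Only this linear part keeps the factor \<open>\<kappa>\<close>; for the
  nonlinear part \<open>\<kappa> \<le> 1\<close> suffices, since it goes into the energy.\<close>

lemma energy_step_bound:
  fixes A B e f g \<tau> K :: grid_fun and Bc Be h :: real and m n :: nat
  defines "W \<equiv> (\<lambda>i j. eta (A i j) (B i j) - eta (A i j - e i j) (B i j - f i j)
      + Bc * ((e i j + f i j) / 2) - Be * (3 / 2 * e i j - 1 / 2 * g i j)
      - discrete_conv h m n K (\<lambda>i j. 3 / 2 * e i j - 1 / 2 * g i j) i j)"
  defines "E \<equiv> (\<lambda>x. h\<^sup>2 * grid_sum m n (\<lambda>i j. (x i j)\<^sup>2 + x i j ^ 4))"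
  assumes err: "\<And>i j. f i j - e i j = s * (discrete_laplacian h W i j + \<tau> i j)"
    and per: "periodic_grid m n A" "periodic_grid m n B" "periodic_grid m n e"
      "periodic_grid m n f" "periodic_grid m n g" "periodic_grid m n K"
    and s: "0 < s" and h: "0 < h" and L: "L1 = real m * h" "L2 = real n * h"
    and Be: "0 \<le> Be" "Be \<le> M" and Bc: "\<bar>Bc\<bar> \<le> M"
    and AB: "\<And>i j. \<bar>A i j\<bar> \<le> M" "\<And>i j. \<bar>B i j\<bar> \<le> M" "\<And>i j. \<bar>B i j - A i j\<bar> \<le> M * s"
    and K: "\<And>i j. \<bar>K (i + 1) j - K i j\<bar> \<le> M * h" "\<And>i j. \<bar>K i (j + 1) - K i j\<bar> \<le> M * h"
    and \<tau>: "\<And>i j. \<bar>\<tau> i j\<bar> \<le> \<kappa>" and \<kappa>: "\<kappa> \<le> 1"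
    and N: "N = 5 * M\<^sup>2 * (L1 * L2)\<^sup>2 + (1 + M) * (1 + 2 * M) + 2 * M\<^sup>2 + 2 * M"
  shows "h\<^sup>2 * rel_energy m n Bc Be B e f \<le> h\<^sup>2 * rel_energy m n Bc Be A g e
     + s * N * (E f + E e + E g)
     + s * \<kappa> * N * (h\<^sup>2 * grid_sum m n (\<lambda>i j. \<bar>e i j\<bar> + \<bar>f i j\<bar> + \<bar>g i j\<bar>))"
proof -
  define hat where "hat = (\<lambda>i j. 3 / 2 * e i j - 1 / 2 * g i j)"
  define V where "V = discrete_conv h m n K hat"
  define W' where "W' = (\<lambda>i j. eta (A i j) (B i j) - eta (A i j - e i j) (B i j - f i j)
      + Bc * ((e i j + f i j) / 2) - Be * (3 / 2 * e i j - 1 / 2 * g i j))"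
  have M: "0 \<le> M" using Be by linarith
  have W: "W = (\<lambda>i j. W' i j - V i j)" by (simp add: W_def W'_def V_def hat_def)
  have hat_per: "periodic_grid m n hat"
    using per unfolding hat_def periodic_grid_def by simp
  have V_per: "periodic_grid m n V"
    unfolding V_def by (rule discrete_conv_periodic[OF hat_per])
  have W_per: "periodic_grid m n (\<lambda>i j. W' i j - V i j)"
    using per V_per unfolding W'_def periodic_grid_def by simp
  let ?Q = "\<lambda>i j. ((V (i + 1) j - V i j)\<^sup>2 + (V i (j + 1) - V i j)\<^sup>2) / (4 * h\<^sup>2)"
  let ?R = "\<lambda>i j. eta_remainder (A i j) (B i j) (e i j) (f i j)"
  let ?Z = "h\<^sup>2 * grid_sum m n (\<lambda>i j. \<bar>e i j\<bar> + \<bar>f i j\<bar> + \<bar>g i j\<bar>)"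
  have E0: "0 \<le> E x" for x unfolding E_def by (intro mult_nonneg_nonneg grid_sum_nonneg) auto
  have step: "h\<^sup>2 * rel_energy m n Bc Be B e f \<le> h\<^sup>2 * (rel_energy m n Bc Be A g e
     + s * grid_sum m n ?Q + s * grid_sum m n (\<lambda>i j. \<bar>\<tau> i j\<bar> * \<bar>W' i j\<bar>)
     + grid_sum m n (\<lambda>i j. \<bar>B i j - A i j\<bar> * \<bar>?R i j\<bar>))"
    unfolding W'_def
    by (intro mult_left_mono energy_step)
      (use err[unfolded W, unfolded W'_def] W_per[unfolded W'_def] V_per s h Be in simp_all)
  define X where "X = M\<^sup>2 * L1 * L2 * (h\<^sup>2 * grid_sum m n (\<lambda>i j. (hat i j)\<^sup>2))"
  have LL: "0 \<le> L1 * L2" using L h by simp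
  have X: "X \<le> M\<^sup>2 * (L1 * L2) * (5 * (E e + E g))"
  proof -
    have "grid_sum m n (\<lambda>i j. (hat i j)\<^sup>2) \<le> grid_sum m n (\<lambda>i j. 5 * (((e i j)\<^sup>2 + e i j ^ 4) + ((g i j)\<^sup>2 + g i j ^ 4)))"
    proof (rule grid_sum_mono)
      fix i j
      have q: "0 \<le> x ^ 4" for x :: real by simp
      have "5 * (e i j)\<^sup>2 + 5 * (g i j)\<^sup>2 - (hat i j)\<^sup>2
          = (e i j + g i j)\<^sup>2 * (3 / 4) + 2 * (e i j)\<^sup>2 + 4 * (g i j)\<^sup>2"
        unfolding hat_def by (simp add: power2_eq_square field_simps)
      moreover have "0 \<le> (e i j + g i j)\<^sup>2 * (3 / 4) + 2 * (e i j)\<^sup>2 + 4 * (g i j)\<^sup>2" by simp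
      ultimately have "(hat i j)\<^sup>2 \<le> 5 * (e i j)\<^sup>2 + 5 * (g i j)\<^sup>2" by (metis diff_ge_0_iff_ge)
      then show "(hat i j)\<^sup>2 \<le> 5 * (((e i j)\<^sup>2 + e i j ^ 4) + ((g i j)\<^sup>2 + g i j ^ 4))"
        using q[of "e i j"] q[of "g i j"] by (simp only: distrib_left)
    qed
    also have "\<dots> = 5 * (grid_sum m n (\<lambda>i j. (e i j)\<^sup>2 + e i j ^ 4) + grid_sum m n (\<lambda>i j. (g i j)\<^sup>2 + g i j ^ 4))"
      by (simp only: grid_sum_cmult grid_sum_add)
    finally have "h\<^sup>2 * grid_sum m n (\<lambda>i j. (hat i j)\<^sup>2) \<le> 5 * (E e + E g)"
      unfolding E_def using mult_left_mono[of _ _ "h\<^sup>2"] by (fastforce simp: algebra_simps)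
    then have "M\<^sup>2 * (L1 * L2) * (h\<^sup>2 * grid_sum m n (\<lambda>i j. (hat i j)\<^sup>2)) \<le> M\<^sup>2 * (L1 * L2) * (5 * (E e + E g))"
      using LL by (intro mult_left_mono) auto
    then show ?thesis by (simp add: X_def mult.assoc)
  qed
  \<comment> \<open>One factor \<open>L1 * L2\<close> comes from Cauchy-Schwarz in the convolution,
    the other from summing a uniform bound over all cells.\<close>
  have Q: "h\<^sup>2 * grid_sum m n ?Q \<le> 5 * M\<^sup>2 * (L1 * L2)\<^sup>2 * (E f + E e + E g)"
  proof -
    have "?Q i j \<le> X / 2" for i j
    proof -
      have "(V (i + 1) j - V i j)\<^sup>2 \<le> h\<^sup>2 * X" "(V i (j + 1) - V i j)\<^sup>2 \<le> h\<^sup>2 * X"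
        using discrete_conv_gradient[OF per(6) hat_per, of 1 0 M h L1 L2 i j]
          discrete_conv_gradient[OF per(6) hat_per, of 0 1 M h L1 L2 i j] K h L
        by (simp_all add: V_def X_def)
      moreover have "(u + v) / (4 * h\<^sup>2) \<le> X / 2" if "u \<le> h\<^sup>2 * X" "v \<le> h\<^sup>2 * X" for u v
      proof -
        have "u + v \<le> X / 2 * (4 * h\<^sup>2)" using that by (simp add: algebra_simps)
        then show ?thesis using h by (subst pos_divide_le_eq) auto
      qed
      ultimately show ?thesis by blast
    qed
    then have "grid_sum m n ?Q \<le> grid_sum m n (\<lambda>i j. X / 2)" by (rule grid_sum_mono)
    then have "h\<^sup>2 * grid_sum m n ?Q \<le> h\<^sup>2 * (real m * real n * (X / 2))"
      unfolding grid_sum_const by (rule mult_left_mono) simp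
    also have "\<dots> = (L1 * L2) / 2 * X" by (simp add: L power2_eq_square)
    also have "\<dots> \<le> (L1 * L2) / 2 * (M\<^sup>2 * (L1 * L2) * (5 * (E e + E g)))"
      using LL by (intro mult_left_mono X) simp
    also have "\<dots> = 5 / 2 * M\<^sup>2 * (L1 * L2)\<^sup>2 * (E e + E g)" by (simp add: power2_eq_square)
    also have "\<dots> \<le> 5 * M\<^sup>2 * (L1 * L2)\<^sup>2 * (E f + E e + E g)"
      using E0[of e] E0[of f] E0[of g] by (intro mult_mono) auto
    finally show ?thesis .
  qed
  have EE: "h\<^sup>2 * grid_sum m n (\<lambda>i j. (e i j)\<^sup>2 + e i j ^ 4 + ((f i j)\<^sup>2 + f i j ^ 4)) \<le> E f + E e + E g"
    using E0[of g] by (simp add: grid_sum_add E_def distrib_left)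
  have \<kappa>0: "0 \<le> \<kappa>" using \<tau>[of 0 0] by linarith
  have T: "h\<^sup>2 * grid_sum m n (\<lambda>i j. \<bar>\<tau> i j\<bar> * \<bar>W' i j\<bar>)
      \<le> \<kappa> * (2 * M\<^sup>2 + 2 * M) * ?Z + (1 + 2 * M) * (E f + E e + E g)"
  proof -
    have "grid_sum m n (\<lambda>i j. \<bar>\<tau> i j\<bar> * \<bar>W' i j\<bar>) \<le>
      grid_sum m n (\<lambda>i j. \<kappa> * (2 * M\<^sup>2 + 2 * M) * (\<bar>e i j\<bar> + \<bar>f i j\<bar> + \<bar>g i j\<bar>)
        + (1 + 2 * M) * ((e i j)\<^sup>2 + e i j ^ 4 + ((f i j)\<^sup>2 + f i j ^ 4)))"
    proof (rule grid_sum_mono)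
      fix i j
      let ?S = "\<bar>e i j\<bar> + \<bar>f i j\<bar> + \<bar>g i j\<bar>" and ?F = "(e i j)\<^sup>2 + e i j ^ 4 + ((f i j)\<^sup>2 + f i j ^ 4)"
      have "\<bar>W' i j\<bar> \<le> (2 * M\<^sup>2 + 2 * M) * ?S + (1 + 2 * M) * ?F"
        unfolding W'_def using AB Bc Be by (intro local_potential_le) auto
      then have "\<bar>\<tau> i j\<bar> * \<bar>W' i j\<bar> \<le> \<kappa> * ((2 * M\<^sup>2 + 2 * M) * ?S + (1 + 2 * M) * ?F)"
        using \<tau> \<kappa>0 by (intro mult_mono) auto
      also have "\<dots> = \<kappa> * (2 * M\<^sup>2 + 2 * M) * ?S + \<kappa> * ((1 + 2 * M) * ?F)"
        by (subst distrib_left) (simp only: mult.assoc)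
      also have "\<dots> \<le> \<kappa> * (2 * M\<^sup>2 + 2 * M) * ?S + 1 * ((1 + 2 * M) * ?F)"
        using \<kappa> M by (intro add_left_mono mult_right_mono mult_nonneg_nonneg) auto
      finally show "\<bar>\<tau> i j\<bar> * \<bar>W' i j\<bar> \<le> \<kappa> * (2 * M\<^sup>2 + 2 * M) * ?S + (1 + 2 * M) * ?F"
        by simp
    qed
    then have "h\<^sup>2 * grid_sum m n (\<lambda>i j. \<bar>\<tau> i j\<bar> * \<bar>W' i j\<bar>) \<le>
       h\<^sup>2 * (\<kappa> * (2 * M\<^sup>2 + 2 * M) * grid_sum m n (\<lambda>i j. \<bar>e i j\<bar> + \<bar>f i j\<bar> + \<bar>g i j\<bar>)
        + (1 + 2 * M) * grid_sum m n (\<lambda>i j. (e i j)\<^sup>2 + e i j ^ 4 + ((f i j)\<^sup>2 + f i j ^ 4)))"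
      unfolding grid_sum_add[of m n "\<lambda>i j. \<kappa> * (2 * M\<^sup>2 + 2 * M) * (\<bar>e i j\<bar> + \<bar>f i j\<bar> + \<bar>g i j\<bar>)"] grid_sum_cmult
      by (rule mult_left_mono) simp
    also have "\<dots> = \<kappa> * (2 * M\<^sup>2 + 2 * M) * ?Z + (1 + 2 * M) *
       (h\<^sup>2 * grid_sum m n (\<lambda>i j. (e i j)\<^sup>2 + e i j ^ 4 + ((f i j)\<^sup>2 + f i j ^ 4)))"
      by (simp only: distrib_left mult_ac)
    also have "\<dots> \<le> \<kappa> * (2 * M\<^sup>2 + 2 * M) * ?Z + (1 + 2 * M) * (E f + E e + E g)"
      using M by (intro add_left_mono mult_left_mono EE) auto
    finally show ?thesis .
  qed
  have R: "h\<^sup>2 * grid_sum m n (\<lambda>i j. \<bar>B i j - A i j\<bar> * \<bar>?R i j\<bar>)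
     \<le> s * (M * (1 + 2 * M) * (E f + E e + E g))"
  proof -
    have "grid_sum m n (\<lambda>i j. \<bar>B i j - A i j\<bar> * \<bar>?R i j\<bar>) \<le>
      grid_sum m n (\<lambda>i j. s * M * (1 + 2 * M) * ((e i j)\<^sup>2 + e i j ^ 4 + ((f i j)\<^sup>2 + f i j ^ 4)))"
    proof (rule grid_sum_mono)
      fix i j
      have "\<bar>B i j - A i j\<bar> * \<bar>?R i j\<bar> \<le> (M * s) * ((1 + 2 * M) * ((e i j)\<^sup>2 + e i j ^ 4 + ((f i j)\<^sup>2 + f i j ^ 4)))"
        using AB M s by (intro mult_mono eta_remainder_le) auto
      then show "\<bar>B i j - A i j\<bar> * \<bar>?R i j\<bar> \<le> s * M * (1 + 2 * M) * ((e i j)\<^sup>2 + e i j ^ 4 + ((f i j)\<^sup>2 + f i j ^ 4))"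
        by (simp only: mult_ac)
    qed
    then have "h\<^sup>2 * grid_sum m n (\<lambda>i j. \<bar>B i j - A i j\<bar> * \<bar>?R i j\<bar>) \<le>
       h\<^sup>2 * (s * M * (1 + 2 * M) * grid_sum m n (\<lambda>i j. (e i j)\<^sup>2 + e i j ^ 4 + ((f i j)\<^sup>2 + f i j ^ 4)))"
      unfolding grid_sum_cmult by (rule mult_left_mono) simp
    also have "\<dots> = s * M * (1 + 2 * M) *
       (h\<^sup>2 * grid_sum m n (\<lambda>i j. (e i j)\<^sup>2 + e i j ^ 4 + ((f i j)\<^sup>2 + f i j ^ 4)))"
      by (simp only: mult_ac)
    also have "\<dots> \<le> s * M * (1 + 2 * M) * (E f + E e + E g)"
      using M s by (intro mult_left_mono EE) auto
    finally show ?thesis by (simp only: mult.assoc)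
  qed
  have Z: "0 \<le> \<kappa> * ?Z" using \<kappa>0 by (intro mult_nonneg_nonneg grid_sum_nonneg) auto
  have "h\<^sup>2 * (rel_energy m n Bc Be A g e
     + s * grid_sum m n ?Q + s * grid_sum m n (\<lambda>i j. \<bar>\<tau> i j\<bar> * \<bar>W' i j\<bar>)
     + grid_sum m n (\<lambda>i j. \<bar>B i j - A i j\<bar> * \<bar>?R i j\<bar>)) =
     h\<^sup>2 * rel_energy m n Bc Be A g e + s * (h\<^sup>2 * grid_sum m n ?Q)
      + s * (h\<^sup>2 * grid_sum m n (\<lambda>i j. \<bar>\<tau> i j\<bar> * \<bar>W' i j\<bar>))
      + h\<^sup>2 * grid_sum m n (\<lambda>i j. \<bar>B i j - A i j\<bar> * \<bar>?R i j\<bar>)"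
    by (simp only: distrib_left mult_ac)
  also have "\<dots> \<le> h\<^sup>2 * rel_energy m n Bc Be A g e + s * (5 * M\<^sup>2 * (L1 * L2)\<^sup>2 * (E f + E e + E g))
      + s * (\<kappa> * (2 * M\<^sup>2 + 2 * M) * ?Z + (1 + 2 * M) * (E f + E e + E g))
      + s * (M * (1 + 2 * M) * (E f + E e + E g))"
    using s by (intro add_mono mult_left_mono Q T R) auto
  also have "\<dots> = h\<^sup>2 * rel_energy m n Bc Be A g e
      + s * (5 * M\<^sup>2 * (L1 * L2)\<^sup>2 + (1 + M) * (1 + 2 * M)) * (E f + E e + E g) + s * (2 * M\<^sup>2 + 2 * M) * (\<kappa> * ?Z)"
    by (simp only: distrib_left distrib_right mult_ac add_ac mult_1)
  also have "\<dots> \<le> h\<^sup>2 * rel_energy m n Bc Be A g e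
      + s * N * (E f + E e + E g) + s * N * (\<kappa> * ?Z)"
    using s M Z E0 by (intro add_mono mult_right_mono mult_left_mono add_nonneg_nonneg) (auto simp: N)
  finally show ?thesis using step by (simp only: mult_ac)
qed

section \<open>Discrete Gronwall inequality\<close>

lemma discrete_gronwall:
  fixes x :: "nat \<Rightarrow> real"
  assumes "\<And>l. l \<le> L \<Longrightarrow> x l \<le> a + b * (\<Sum>k<l. x k)" and b: "0 \<le> b" and l: "l \<le> L"
  shows "x l \<le> a * (1 + b) ^ l"
  using l
proof (induction l rule: less_induct)
  case (less l)
  \<comment> \<open>The sequence \<open>a * (1 + b) ^ l\<close> satisfies the hypothesis with
    equality.\<close>
  have geo: "b * (\<Sum>k<l. a * (1 + b) ^ k) = a * (1 + b) ^ l - a" for l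
    by (induction l) (simp_all add: algebra_simps)
  have "x l \<le> a + b * (\<Sum>k<l. x k)" using less assms by blast
  also have "\<dots> \<le> a + b * (\<Sum>k<l. a * (1 + b) ^ k)"
    using less b by (intro add_left_mono mult_left_mono sum_mono) auto
  also have "\<dots> = a * (1 + b) ^ l" by (simp add: geo)
  finally show ?case .
qed

text \<open>The new value of \<open>E\<close> occurs on both sides;
  \<open>8 * (s * N) \<le> c\<close> makes its weight on the right at most \<open>c / 4\<close> in a
  regular step, so coercivity absorbs it. The first step has its own hypothesis: its Young
  inequality spends \<open>c / 4\<close> of the coercivity and leaves \<open>a\<close> without a
  factor \<open>s\<close>, while the later steps contribute \<open>s * b\<close> each, at most
  \<open>T * b\<close> in total. The factor 12 is 2 from \<open>step\<close>, 3 for the three time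
  levels and 2 for the absorption.\<close>

lemma energy_gronwall:
  fixes E H :: "nat \<Rightarrow> real"
  assumes c: "0 < c" and s: "0 < s" and N: "0 \<le> N" and sN: "8 * (s * N) \<le> c"
    and E: "\<And>k. 0 \<le> E k" "E 0 = 0" and coer: "\<And>k. c * E k \<le> H k"
    and first: "0 < L \<Longrightarrow> H 1 \<le> (s * N + c / 4) * E 1 + a"
    and step: "\<And>k. 0 < k \<Longrightarrow> k < L \<Longrightarrow> H (k + 1) \<le> H k + 2 * s * N * (E (k + 1) + E k + E (k - 1)) + s * b"
    and ab: "0 \<le> a" "0 \<le> b" and T: "real L * s \<le> T"
  shows "E L \<le> 2 / c * (2 * a + T * b) * exp (12 * N / c * T)"
proof -
  have H1: "H 1 \<le> 2 * a" if "0 < L"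
  proof -
    have "c * E 1 \<le> (s * N + c / 4) * E 1 + a" using first[OF that] coer[of 1] by linarith
    moreover have "8 * (s * N) * E 1 \<le> c * E 1" using sN E by (intro mult_right_mono) auto
    ultimately have "c * E 1 / 2 \<le> a - c * E 1 / 8" by (simp add: algebra_simps)
    moreover have "0 \<le> c * E 1" using c E by simp
    ultimately have *: "c * E 1 \<le> 2 * a" by linarith
    have "H 1 \<le> (s * N) * E 1 + c * E 1 / 4 + a" using first[OF that] by (simp add: algebra_simps)
    then show ?thesis using * \<open>8 * (s * N) * E 1 \<le> c * E 1\<close> ab by linarith
  qed
  have sNE: "0 \<le> s * N * E k" for k using s N E by simp
  have sumH: "H (Suc l) \<le> 2 * a + real l * s * b
      + 2 * s * N * ((\<Sum>k<Suc (Suc l). E k) + (\<Sum>k<Suc l. E k) + (\<Sum>k<l. E k))"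
    if "Suc l \<le> L" for l
    using that
  proof (induction l)
    case 0
    then show ?case using H1 sNE[of 0] sNE[of 1] by (simp add: algebra_simps)
  next
    case (Suc l)
    have "H (Suc (Suc l)) \<le> H (Suc l) + 2 * s * N * (E (Suc (Suc l)) + E (Suc l) + E l) + s * b"
      using step[of "Suc l"] Suc by simp
    then show ?case using Suc by (simp add: algebra_simps)
  qed
  have main: "E l \<le> 2 / c * (2 * a + T * b) + 12 * N / c * s * (\<Sum>k<l. E k)" if l: "l \<le> L" for l
  proof (cases l)
    case 0
    have "0 \<le> T" using T s by (meson mult_nonneg_nonneg of_nat_0_le_iff order_trans less_imp_le)
    then show ?thesis using 0 E c ab by simp
  next
    case (Suc l')
    have "real l' * s \<le> real L * s" using l Suc s by (intro mult_right_mono) auto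
    then have *: "real l' * s * b \<le> T * b" using T ab by (intro mult_right_mono) auto
    let ?S = "\<Sum>k<l. E k"
    \<comment> \<open>Only the first sum reaches the current level \<open>l\<close>; apart from
      \<open>E l\<close>, each of the three is at most the sum over the earlier levels.\<close>
    have "(\<Sum>k<Suc (Suc l'). E k) + (\<Sum>k<Suc l'. E k) + (\<Sum>k<l'. E k) \<le> E l + 3 * ?S"
      using E by (simp add: Suc)
    then have "2 * s * N * ((\<Sum>k<Suc (Suc l'). E k) + (\<Sum>k<Suc l'. E k) + (\<Sum>k<l'. E k))
        \<le> 2 * s * N * (E l + 3 * ?S)"
      using s N by (intro mult_left_mono) auto
    then have "c * E l \<le> 2 * a + T * b + 2 * s * N * (E l + 3 * ?S)"
      using sumH[of l'] * l coer[of l] unfolding Suc by linarith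
    moreover have "8 * (s * N) * E l \<le> c * E l" using sN E by (intro mult_right_mono) auto
    moreover have "0 \<le> c * E l" using c E by simp
    ultimately have "c * E l \<le> 2 * (2 * a + T * b) + 12 * N * s * ?S"
      by (simp add: algebra_simps)
    then have "E l \<le> (2 * (2 * a + T * b) + 12 * N * s * ?S) / c"
      using c by (simp add: pos_le_divide_eq mult.commute)
    then show ?thesis by (simp add: add_divide_distrib)
  qed
  have "0 \<le> T" using T s by (meson mult_nonneg_nonneg of_nat_0_le_iff order_trans less_imp_le)
  then have nn: "0 \<le> 2 / c * (2 * a + T * b)" using c ab by simp
  have "E L \<le> 2 / c * (2 * a + T * b) * (1 + 12 * N / c * s) ^ L"
    by (rule discrete_gronwall[where L = L]) (use main s N c in auto)
  also have "\<dots> \<le> 2 / c * (2 * a + T * b) * exp (12 * N / c * s) ^ L"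
    using nn s N c by (intro mult_left_mono power_mono exp_ge_add_one_self) auto
  also have "\<dots> = 2 / c * (2 * a + T * b) * exp (12 * N / c * (real L * s))"
    by (simp add: exp_of_nat_mult[symmetric] mult_ac)
  also have "\<dots> \<le> 2 / c * (2 * a + T * b) * exp (12 * N / c * T)"
    using nn T N c by (intro mult_left_mono) (auto intro!: mult_left_mono divide_right_mono)
  finally show ?thesis .
qed

section \<open>Stability: from consistency to convergence\<close>

lemma chem_potential_diff:
  "chem_potential h m n \<gamma>c \<gamma>e Jc Je A' A B i j
    - chem_potential h m n \<gamma>c \<gamma>e Jc Je (\<lambda>i j. A' i j - g i j) (\<lambda>i j. A i j - e i j) (\<lambda>i j. B i j - f i j) i j
  = eta (A i j) (B i j) - eta (A i j - e i j) (B i j - f i j)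
      + B_const h m n Jc \<gamma>c * ((e i j + f i j) / 2)
      - B_const h m n Je \<gamma>e * (3 / 2 * e i j - 1 / 2 * g i j)
      - discrete_conv h m n (vertex_restrict h (\<lambda>x. Jc x - Je x)) (\<lambda>i j. 3 / 2 * e i j - 1 / 2 * g i j) i j"
proof -
  let ?K = "vertex_restrict h (\<lambda>x. Jc x - Je x)"
  have "(\<lambda>i j. 3 / 2 * e i j - 1 / 2 * g i j) =
    (\<lambda>i j. (3 / 2 * A i j - 1 / 2 * A' i j) - (3 / 2 * (A i j - e i j) - 1 / 2 * (A' i j - g i j)))"
    by (intro ext) (simp add: field_simps)
  then have "discrete_conv h m n ?K (\<lambda>i j. 3 / 2 * e i j - 1 / 2 * g i j) i j =
    discrete_conv h m n ?K (\<lambda>i j. (3 / 2 * A i j - 1 / 2 * A' i j)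
      - (3 / 2 * (A i j - e i j) - 1 / 2 * (A' i j - g i j))) i j"
    by (rule arg_cong[where f = "\<lambda>x. discrete_conv h m n ?K x i j"])
  then show ?thesis
    unfolding chem_potential_def Let_def discrete_conv_diff_right by (simp add: field_simps)
qed

lemma discrete_laplacian_diff:
  "discrete_laplacian h (\<lambda>i j. f i j - g i j) i j = discrete_laplacian h f i j - discrete_laplacian h g i j"
  by (simp add: discrete_laplacian_def diff_divide_distrib[symmetric])

lemma grid_norm_eq: "grid_norm h m n f = sqrt (h\<^sup>2 * grid_sum m n (\<lambda>i j. (f i j)\<^sup>2))"
  by (simp add: grid_norm_def grid_sum_def)

text \<open>The stability half makes no reference to the differential equation: \<open>A\<close> is
  any periodic grid sequence, bounded and Lipschitz in time up to level \<open>l\<close>, that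
  satisfies the scheme up to \<open>\<tau>\<close>. Subtraction on the naturals makes
  \<open>A (0 - 1)\<close> equal to \<open>A 0\<close>, which is the starting convention.
  \<open>D * (h\<^sup>2 + s) \<le> 1\<close> keeps both orders of truncation error below 1, as
  \<open>energy_step_bound\<close> requires.\<close>

lemma convergence_of_consistency:
  fixes A \<phi> \<tau> :: "nat \<Rightarrow> grid_fun" and Jc Je :: "real \<times> real \<Rightarrow> real"
  assumes \<alpha>: "0 < \<alpha>" "\<alpha> \<le> B_const h m n Jc \<gamma>c - B_const h m n Je \<gamma>e"
    and Be: "0 \<le> B_const h m n Je \<gamma>e" "B_const h m n Je \<gamma>e \<le> M" and Bc: "\<bar>B_const h m n Jc \<gamma>c\<bar> \<le> M"
    and K: "periodic_grid m n (vertex_restrict h (\<lambda>x. Jc x - Je x))"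
      "\<And>i j. \<bar>vertex_restrict h (\<lambda>x. Jc x - Je x) (i + 1) j - vertex_restrict h (\<lambda>x. Jc x - Je x) i j\<bar> \<le> M * h"
      "\<And>i j. \<bar>vertex_restrict h (\<lambda>x. Jc x - Je x) i (j + 1) - vertex_restrict h (\<lambda>x. Jc x - Je x) i j\<bar> \<le> M * h"
    and s: "0 < s" "s \<le> 1" and h: "0 < h" and L: "L1 = real m * h" "L2 = real n * h"
    and scheme: "nCH_scheme s h m n \<gamma>c \<gamma>e Jc Je \<phi>" and init: "\<And>i j. \<phi> 0 i j = A 0 i j"
    and A: "\<And>k. periodic_grid m n (A k)" "\<And>k i j. k \<le> l \<Longrightarrow> \<bar>A k i j\<bar> \<le> M"
      "\<And>k i j. k < l \<Longrightarrow> \<bar>A (k + 1) i j - A k i j\<bar> \<le> M * s"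
    and \<tau>: "\<And>k i j. k < l \<Longrightarrow> A (k + 1) i j - A k i j =
        s * (discrete_laplacian h (chem_potential h m n \<gamma>c \<gamma>e Jc Je (A (k - 1)) (A k) (A (k + 1))) i j + \<tau> k i j)"
      "\<And>k i j. 0 < k \<Longrightarrow> k < l \<Longrightarrow> \<bar>\<tau> k i j\<bar> \<le> D * (h\<^sup>2 + s\<^sup>2)"
      "\<And>i j. 0 < l \<Longrightarrow> \<bar>\<tau> 0 i j\<bar> \<le> D * (h\<^sup>2 + s)"
    and D: "0 \<le> D" "D * (h\<^sup>2 + s) \<le> 1" and T: "real l * s \<le> T"
    and N: "N = 5 * M\<^sup>2 * (L1 * L2)\<^sup>2 + (1 + M) * (1 + 2 * M) + 2 * M\<^sup>2 + 2 * M"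
    and c: "c = min (1 / 12) (\<alpha> / 2)" and sN: "8 * (s * N) \<le> c"
  shows "grid_norm h m n (\<lambda>i j. A l i j - \<phi> l i j) \<le>
    sqrt (2 / c * (2 * (L1 * L2 * N\<^sup>2 / c) + T * (3 * N * (L1 * L2))) * exp (12 * N / c * T)) * D * (h\<^sup>2 + s\<^sup>2)"
proof -
  define e where "e = (\<lambda>k i j. A k i j - \<phi> k i j)"
  define En where "En = (\<lambda>x. h\<^sup>2 * grid_sum m n (\<lambda>i j. (x i j)\<^sup>2 + x i j ^ 4))"
  define Bc where "Bc = B_const h m n Jc \<gamma>c"
  define Be' where "Be' = B_const h m n Je \<gamma>e"
  define H where "H = (\<lambda>k. h\<^sup>2 * rel_energy m n Bc Be' (A k) (e (k - 1)) (e k))"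
  define \<kappa> where "\<kappa> = D * (h\<^sup>2 + s\<^sup>2)"
  define Z where "Z = (\<lambda>k. h\<^sup>2 * grid_sum m n (\<lambda>i j. \<bar>e k i j\<bar> + \<bar>e (k + 1) i j\<bar> + \<bar>e (k - 1) i j\<bar>))"
  have M: "0 \<le> M" using Be by linarith
  have N0: "0 \<le> N" using M by (simp add: N)
  have c0: "0 < c" using \<alpha> by (simp add: c)
  have ss: "s\<^sup>2 \<le> s" using s by (simp add: power2_eq_square mult_left_le)
  have \<kappa>1: "\<kappa> \<le> 1" "0 \<le> \<kappa>"
    using D ss mult_left_mono[of "h\<^sup>2 + s\<^sup>2" "h\<^sup>2 + s" D] by (auto simp: \<kappa>_def)
  have \<phi>: "\<And>k. periodic_grid m n (\<phi> k)"
    "\<And>k i j. \<phi> (k + 1) i j - \<phi> k i j =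
        s * discrete_laplacian h (chem_potential h m n \<gamma>c \<gamma>e Jc Je (\<phi> (k - 1)) (\<phi> k) (\<phi> (k + 1))) i j"
  proof -
    have "(if k = 0 then \<phi> 0 else \<phi> (k - 1)) = \<phi> (k - 1)" for k by simp
    then show "\<And>k. periodic_grid m n (\<phi> k)"
    "\<And>k i j. \<phi> (k + 1) i j - \<phi> k i j =
        s * discrete_laplacian h (chem_potential h m n \<gamma>c \<gamma>e Jc Je (\<phi> (k - 1)) (\<phi> k) (\<phi> (k + 1))) i j"
      using scheme unfolding nCH_scheme_def by auto
  qed
  have per: "periodic_grid m n (e k)" for k
    using A(1)[of k] \<phi>(1)[of k] unfolding e_def periodic_grid_def by simp
  have e0: "e 0 = (\<lambda>i j. 0)" by (simp add: e_def init)
  have En0: "0 \<le> En x" for x unfolding En_def by (intro mult_nonneg_nonneg grid_sum_nonneg) auto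
  have EnZ: "En (\<lambda>i j. 0) = 0" by (simp add: En_def grid_sum_const)
  have area: "h\<^sup>2 * (real m * real n * x) = L1 * L2 * x" for x by (simp add: L power2_eq_square)
  have energy: "H (k + 1) \<le> H k + s * N * (En (e (k + 1)) + En (e k) + En (e (k - 1))) + s * \<kappa>' * N * Z k"
    if k: "k < l" and \<kappa>': "\<And>i j. \<bar>\<tau> k i j\<bar> \<le> \<kappa>'" "\<kappa>' \<le> 1" for k \<kappa>'
  proof -
    let ?W = "\<lambda>i j. eta (A k i j) (A (k + 1) i j) - eta (A k i j - e k i j) (A (k + 1) i j - e (k + 1) i j)
      + Bc * ((e k i j + e (k + 1) i j) / 2) - Be' * (3 / 2 * e k i j - 1 / 2 * e (k - 1) i j)
      - discrete_conv h m n (vertex_restrict h (\<lambda>x. Jc x - Je x)) (\<lambda>i j. 3 / 2 * e k i j - 1 / 2 * e (k - 1) i j) i j"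
    have \<phi>e: "(\<lambda>i j. A k i j - e k i j) = \<phi> k" for k by (simp add: e_def)
    have W: "?W = (\<lambda>i j. chem_potential h m n \<gamma>c \<gamma>e Jc Je (A (k - 1)) (A k) (A (k + 1)) i j
        - chem_potential h m n \<gamma>c \<gamma>e Jc Je (\<phi> (k - 1)) (\<phi> k) (\<phi> (k + 1)) i j)"
      unfolding \<phi>e[symmetric] chem_potential_diff Bc_def Be'_def ..
    have err: "e (k + 1) i j - e k i j = s * (discrete_laplacian h ?W i j + \<tau> k i j)" for i j
    proof -
      have "e (k + 1) i j - e k i j = (A (k + 1) i j - A k i j) - (\<phi> (k + 1) i j - \<phi> k i j)"
        by (simp add: e_def)
      then show ?thesis
        unfolding W discrete_laplacian_diff \<tau>(1)[OF k] \<phi>(2) by (simp add: algebra_simps)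
    qed
    show ?thesis
      unfolding H_def Z_def En_def diff_add_inverse2
      by (rule energy_step_bound[OF err]) (use A k per K s h L Be Bc \<kappa>' N in \<open>auto simp: Bc_def Be'_def\<close>)
  qed
  have first: "H 1 \<le> (s * N + c / 4) * En (e 1) + L1 * L2 * (\<kappa> * N)\<^sup>2 / c" if l: "0 < l"
  proof -
    \<comment> \<open>\<open>p\<close> is the weight of the first-step truncation error after
      multiplication by the step size. As \<open>s \<le> 1\<close>,
      \<open>s * (h\<^sup>2 + s)\<close> is at most \<open>h\<^sup>2 + s\<^sup>2\<close>, which
      restores second order. Young's inequality then spends the share \<open>c / 4\<close> that
      \<open>energy_gronwall\<close> allows.\<close>
    define p where "p = s * (D * (h\<^sup>2 + s)) * N"
    have "s * h\<^sup>2 \<le> h\<^sup>2" using s by (simp add: mult_left_le_one_le)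
    then have "s * (D * (h\<^sup>2 + s)) \<le> \<kappa>"
      using D mult_left_mono[of "s * (h\<^sup>2 + s)" "h\<^sup>2 + s\<^sup>2" D]
      by (simp add: \<kappa>_def algebra_simps power2_eq_square)
    then have p: "0 \<le> p" "p \<le> \<kappa> * N"
      using s D N0 by (auto simp: p_def mult_right_mono)
    have "p * \<bar>x\<bar> \<le> c / 4 * (x\<^sup>2 + x ^ 4) + p\<^sup>2 / c" for x
    proof -
      have "c / 4 * x\<^sup>2 + p\<^sup>2 / c - p * \<bar>x\<bar> = (c * \<bar>x\<bar> - 2 * p)\<^sup>2 / (4 * c)"
        using c0 by (simp add: power2_eq_square field_simps)
      moreover have "0 \<le> (c * \<bar>x\<bar> - 2 * p)\<^sup>2 / (4 * c)" "0 \<le> c / 4 * x ^ 4" using c0 by auto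
      ultimately show ?thesis by (simp add: distrib_left)
    qed
    then have "grid_sum m n (\<lambda>i j. p * \<bar>e 1 i j\<bar>) \<le> grid_sum m n (\<lambda>i j. c / 4 * ((e 1 i j)\<^sup>2 + e 1 i j ^ 4) + p\<^sup>2 / c)"
      by (intro grid_sum_mono)
    also have "\<dots> = c / 4 * grid_sum m n (\<lambda>i j. (e 1 i j)\<^sup>2 + e 1 i j ^ 4) + real m * real n * (p\<^sup>2 / c)"
      by (simp only: grid_sum_add[of m n "\<lambda>i j. c / 4 * ((e 1 i j)\<^sup>2 + e 1 i j ^ 4)"] grid_sum_cmult grid_sum_const)
    finally have "h\<^sup>2 * (p * grid_sum m n (\<lambda>i j. \<bar>e 1 i j\<bar>)) \<le>
       h\<^sup>2 * (c / 4 * grid_sum m n (\<lambda>i j. (e 1 i j)\<^sup>2 + e 1 i j ^ 4) + real m * real n * (p\<^sup>2 / c))"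
      unfolding grid_sum_cmult by (rule mult_left_mono) simp
    moreover have "h\<^sup>2 * (c / 4 * G + real m * real n * (p\<^sup>2 / c)) = c / 4 * (h\<^sup>2 * G) + L1 * L2 * (p\<^sup>2 / c)" for G
      by (simp only: distrib_left area) (simp only: mult.left_commute)
    ultimately have "p * Z 0 \<le> c / 4 * En (e 1) + L1 * L2 * (p\<^sup>2 / c)"
      by (simp add: Z_def En_def e0 mult.left_commute)
    moreover have "L1 * L2 * (p\<^sup>2 / c) \<le> L1 * L2 * ((\<kappa> * N)\<^sup>2 / c)"
      using p c0 L h by (intro mult_left_mono divide_right_mono power_mono) auto
    moreover have "H 1 \<le> H 0 + s * N * (En (e 1) + En (e 0) + En (e 0)) + p * Z 0"
      using energy[of 0 "D * (h\<^sup>2 + s)"] \<tau>(3) D l by (simp add: p_def)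
    moreover have "H 0 = 0" by (simp add: H_def e0 rel_energy_def rel_potential_def grid_sum_const)
    ultimately show ?thesis by (simp add: e0 EnZ algebra_simps)
  qed
  have step: "H (k + 1) \<le> H k + 2 * s * N * (En (e (k + 1)) + En (e k) + En (e (k - 1))) + s * (3 * N * (L1 * L2) * \<kappa>\<^sup>2)"
    if k: "0 < k" "k < l" for k
  proof -
    \<comment> \<open>The factor \<open>s\<close> in front is the one that summation over the steps
      consumes, so Young's inequality needs no small weight here; its extra copy of the energies is
      what doubles the coefficient to \<open>2 * s * N\<close>.\<close>
    have a: "\<kappa> * \<bar>x\<bar> \<le> \<kappa>\<^sup>2 + (x\<^sup>2 + x ^ 4)" for x
    proof -
      have "\<kappa> * \<bar>x\<bar> \<le> (\<kappa>\<^sup>2 + x\<^sup>2) / 2"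
        using abs_mult_le_squares[of \<kappa> x] \<kappa>1 by (simp add: abs_mult)
      also have "\<dots> \<le> \<kappa>\<^sup>2 + (x\<^sup>2 + x ^ 4)" by simp
      finally show ?thesis .
    qed
    have *: "\<kappa> * \<bar>x\<bar> + \<kappa> * \<bar>y\<bar> + \<kappa> * \<bar>z\<bar> \<le> 3 * \<kappa>\<^sup>2 + (y\<^sup>2 + y ^ 4) + (x\<^sup>2 + x ^ 4) + (z\<^sup>2 + z ^ 4)" for x y z
      using add_mono[OF add_mono[OF a[of x] a[of y]] a[of z]] by simp
    have "grid_sum m n (\<lambda>i j. \<kappa> * \<bar>e k i j\<bar> + \<kappa> * \<bar>e (k + 1) i j\<bar> + \<kappa> * \<bar>e (k - 1) i j\<bar>) \<le>
      grid_sum m n (\<lambda>i j. 3 * \<kappa>\<^sup>2 + ((e (k + 1) i j)\<^sup>2 + e (k + 1) i j ^ 4) + ((e k i j)\<^sup>2 + e k i j ^ 4)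
          + ((e (k - 1) i j)\<^sup>2 + e (k - 1) i j ^ 4))"
      by (intro grid_sum_mono *)
    then have "h\<^sup>2 * grid_sum m n (\<lambda>i j. \<kappa> * (\<bar>e k i j\<bar> + \<bar>e (k + 1) i j\<bar> + \<bar>e (k - 1) i j\<bar>)) \<le>
      h\<^sup>2 * (real m * real n * (3 * \<kappa>\<^sup>2) + grid_sum m n (\<lambda>i j. (e (k + 1) i j)\<^sup>2 + e (k + 1) i j ^ 4)
       + grid_sum m n (\<lambda>i j. (e k i j)\<^sup>2 + e k i j ^ 4) + grid_sum m n (\<lambda>i j. (e (k - 1) i j)\<^sup>2 + e (k - 1) i j ^ 4))"
      by (intro mult_left_mono) (simp_all add: grid_sum_add grid_sum_const distrib_left)
    moreover have "h\<^sup>2 * (real m * real n * (3 * \<kappa>\<^sup>2) + X + Y + V) = 3 * (L1 * L2) * \<kappa>\<^sup>2 + (h\<^sup>2 * X + h\<^sup>2 * Y + h\<^sup>2 * V)" for X Y V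
      unfolding distrib_left area by simp
    ultimately have "\<kappa> * Z k \<le> 3 * (L1 * L2) * \<kappa>\<^sup>2 + (En (e (k + 1)) + En (e k) + En (e (k - 1)))"
      unfolding grid_sum_cmult by (simp only: Z_def En_def mult.left_commute)
    then have "s * N * (\<kappa> * Z k) \<le> s * N * (3 * (L1 * L2) * \<kappa>\<^sup>2 + (En (e (k + 1)) + En (e k) + En (e (k - 1))))"
      using s N0 by (intro mult_left_mono) auto
    then show ?thesis using energy[of k \<kappa>] k \<tau>(2)[of k] \<kappa>1 by (simp add: \<kappa>_def algebra_simps)
  qed
  have "En (e l) \<le> 2 / c * (2 * (L1 * L2 * (\<kappa> * N)\<^sup>2 / c) + T * (3 * N * (L1 * L2) * \<kappa>\<^sup>2)) * exp (12 * N / c * T)"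
  proof (rule energy_gronwall[where H = H and s = s])
    show "c * En (e k) \<le> H k" for k
      using mult_left_mono[OF rel_energy_ge[OF \<alpha>(2) Be(1), of m n "e k" "A k" "e (k - 1)"], of "h\<^sup>2"]
      by (simp add: c En_def H_def Bc_def Be'_def mult_ac)
    have "0 \<le> L1 * L2" using L h by simp
    then show "0 \<le> L1 * L2 * (\<kappa> * N)\<^sup>2 / c" "0 \<le> 3 * N * (L1 * L2) * \<kappa>\<^sup>2" using c0 N0 by simp_all
  qed (use c0 s N0 sN En0 EnZ e0 first step T in auto)
  also have "\<dots> = 2 / c * (2 * (L1 * L2 * N\<^sup>2 / c) + T * (3 * N * (L1 * L2))) * exp (12 * N / c * T) * \<kappa>\<^sup>2"
    by (simp add: power_mult_distrib algebra_simps)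
  finally have "En (e l) \<le> 2 / c * (2 * (L1 * L2 * N\<^sup>2 / c) + T * (3 * N * (L1 * L2))) * exp (12 * N / c * T) * \<kappa>\<^sup>2" .
  moreover have "h\<^sup>2 * grid_sum m n (\<lambda>i j. (e l i j)\<^sup>2) \<le> En (e l)"
    unfolding En_def by (intro mult_left_mono grid_sum_mono) auto
  ultimately have "grid_norm h m n (e l) \<le>
      sqrt (2 / c * (2 * (L1 * L2 * N\<^sup>2 / c) + T * (3 * N * (L1 * L2))) * exp (12 * N / c * T) * \<kappa>\<^sup>2)"
    unfolding grid_norm_eq by (intro real_sqrt_le_mono) simp
  also have "\<dots> = sqrt (2 / c * (2 * (L1 * L2 * N\<^sup>2 / c) + T * (3 * N * (L1 * L2))) * exp (12 * N / c * T)) * D * (h\<^sup>2 + s\<^sup>2)"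
    unfolding real_sqrt_mult[of _ "\<kappa>\<^sup>2"] using \<kappa>1 by (simp add: \<kappa>_def mult.assoc)
  finally show ?thesis by (simp add: e_def)
qed

subsection \<open>Partial derivatives and bounds from \<open>Ck_on\<close>\<close>

lemma Ck_on_imp_continuous_on: "Ck_on k f S \<Longrightarrow> continuous_on S f"
proof (cases k)
  case (Suc l)
  assume "Ck_on k f S"
  then show ?thesis
    unfolding Suc Ck_on.simps continuous_on_eq_continuous_within by (blast intro: has_derivative_continuous)
qed simp

lemma Ck_on_Suc_imp: "Ck_on (Suc k) f S \<Longrightarrow> Ck_on k f S"
proof (induction k arbitrary: f)
  case 0
  then show ?case using Ck_on_imp_continuous_on[of "Suc 0" f S] by simp
next
  case (Suc k)
  from Suc.prems obtain g where
    g: "\<forall>x\<in>S. (f has_derivative (\<lambda>v. \<Sum>b\<in>Basis. (v \<bullet> b) * g b x)) (at x within S)"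
    "\<forall>b\<in>Basis. Ck_on (Suc k) (g b) S" unfolding Ck_on.simps(2)[of "Suc k" f S] by (elim exE conjE)
  show ?case unfolding Ck_on.simps(2)[of k f S]
    by (intro exI[of _ g] conjI g(1) ballI Suc.IH) (rule g(2)[rule_format])
qed

lemma Ck_on_const: "Ck_on k (\<lambda>_. c) S"
proof (induction k arbitrary: c)
  case (Suc k)
  then show ?case unfolding Ck_on.simps by (intro exI[of _ "\<lambda>_ _. 0"]) simp
qed simp

lemma Ck_on_add: "Ck_on k f S \<Longrightarrow> Ck_on k g S \<Longrightarrow> Ck_on k (\<lambda>x. f x + g x) S"
proof (induction k arbitrary: f g)
  case 0
  then show ?case by (simp add: continuous_on_add)
next
  case (Suc k)
  from Suc.prems obtain f' g' where
    f': "\<forall>x\<in>S. (f has_derivative (\<lambda>v. \<Sum>b\<in>Basis. (v \<bullet> b) * f' b x)) (at x within S)"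
      "\<forall>b\<in>Basis. Ck_on k (f' b) S" and
    g': "\<forall>x\<in>S. (g has_derivative (\<lambda>v. \<Sum>b\<in>Basis. (v \<bullet> b) * g' b x)) (at x within S)"
      "\<forall>b\<in>Basis. Ck_on k (g' b) S" unfolding Ck_on.simps by (elim exE conjE)
  have "((\<lambda>x. f x + g x) has_derivative (\<lambda>v. \<Sum>b\<in>Basis. (v \<bullet> b) * (f' b x + g' b x))) (at x within S)"
    if "x \<in> S" for x
    using has_derivative_add[OF f'(1)[rule_format, OF that] g'(1)[rule_format, OF that]]
    by (simp add: distrib_left sum.distrib)
  then show ?case unfolding Ck_on.simps(2)
    by (intro exI[of _ "\<lambda>b x. f' b x + g' b x"] conjI ballI Suc.IH) (rule f'(2)[rule_format] g'(2)[rule_format] | assumption)+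
qed

lemma Ck_on_mult: "Ck_on k f S \<Longrightarrow> Ck_on k g S \<Longrightarrow> Ck_on k (\<lambda>x. f x * g x) S"
proof (induction k arbitrary: f g)
  case 0
  then show ?case by (simp add: continuous_on_mult)
next
  case (Suc k)
  from Suc.prems obtain f' g' where
    f': "\<forall>x\<in>S. (f has_derivative (\<lambda>v. \<Sum>b\<in>Basis. (v \<bullet> b) * f' b x)) (at x within S)"
      "\<forall>b\<in>Basis. Ck_on k (f' b) S" and
    g': "\<forall>x\<in>S. (g has_derivative (\<lambda>v. \<Sum>b\<in>Basis. (v \<bullet> b) * g' b x)) (at x within S)"
      "\<forall>b\<in>Basis. Ck_on k (g' b) S" unfolding Ck_on.simps by (elim exE conjE)
  have fg: "Ck_on k f S" "Ck_on k g S" using Suc.prems Ck_on_Suc_imp by blast+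
  have "((\<lambda>x. f x * g x) has_derivative (\<lambda>v. \<Sum>b\<in>Basis. (v \<bullet> b) * (f x * g' b x + f' b x * g x))) (at x within S)"
    if "x \<in> S" for x
  proof -
    have "f x * (\<Sum>b\<in>Basis. (v \<bullet> b) * g' b x) + (\<Sum>b\<in>Basis. (v \<bullet> b) * f' b x) * g x
        = (\<Sum>b\<in>Basis. (v \<bullet> b) * (f x * g' b x + f' b x * g x))" for v
      unfolding sum_distrib_left sum_distrib_right sum.distrib[symmetric]
      by (intro sum.cong refl) (simp add: distrib_left mult_ac)
    then show ?thesis
      using has_derivative_mult[OF f'(1)[rule_format, OF that] g'(1)[rule_format, OF that]] by simp
  qed
  then show ?case unfolding Ck_on.simps(2)
    by (intro exI[of _ "\<lambda>b x. f x * g' b x + f' b x * g x"] conjI ballI Ck_on_add Suc.IH)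
      (rule fg f'(2)[rule_format] g'(2)[rule_format] | assumption)+
qed

text \<open>This lets the kernels be treated as functions of space and time, so that one set of
  derivative and boundedness lemmas serves both them and the solution.\<close>

lemma Ck_on_fst:
  assumes "Ck_on k J UNIV"
  shows "Ck_on k (\<lambda>p :: 'a::euclidean_space \<times> real. J (fst p)) (UNIV \<times> I)"
  using assms
proof (induction k arbitrary: J)
  case 0
  have "continuous_on (UNIV \<times> I) (\<lambda>p :: 'a \<times> real. fst p)"
    by (rule continuous_on_fst[OF continuous_on_id])
  then show ?case using 0 continuous_on_compose2[of UNIV J "UNIV \<times> I" fst] by simp
next
  case (Suc k)
  from Suc.prems obtain g where
    g: "\<forall>x. (J has_derivative (\<lambda>v. \<Sum>b\<in>Basis. (v \<bullet> b) * g b x)) (at x)"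
      "\<forall>b\<in>Basis. Ck_on k (g b) UNIV" unfolding Ck_on.simps by auto
  \<comment> \<open>A basis vector of the product is \<open>(u, 0)\<close> with \<open>u\<close> in
    the basis, or \<open>(0, 1)\<close>. Since 0 is no basis vector, membership of
    \<open>fst b\<close> separates the two cases, and the time derivative is set to 0.\<close>
  define g' :: "'a \<times> real \<Rightarrow> 'a \<times> real \<Rightarrow> real" where
    "g' = (\<lambda>b p. if fst b \<in> Basis then g (fst b) (fst p) else 0)"
  have "((\<lambda>p. J (fst p)) has_derivative (\<lambda>v. \<Sum>b\<in>Basis. (v \<bullet> b) * g' b p)) (at p within UNIV \<times> I)" for p
  proof -
    have "((\<lambda>p. J (fst p)) has_derivative (\<lambda>v. \<Sum>b\<in>Basis. (fst v \<bullet> b) * g b (fst p))) (at p within UNIV \<times> I)"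
      using has_derivative_compose[OF has_derivative_fst[OF has_derivative_ident] g(1)[rule_format, of "fst p"]]
      by simp
    moreover have "(\<Sum>b\<in>Basis. (fst v \<bullet> b) * g b (fst p)) = (\<Sum>b\<in>Basis. (v \<bullet> b) * g' b p)" for v
    proof -
      let ?F = "\<lambda>b. (v \<bullet> b) * g' b p"
      have B: "(Basis :: ('a \<times> real) set) = (\<lambda>u. (u, 0)) ` Basis \<union> {(0, 1)}" by (simp add: Basis_prod_def)
      have "sum ?F Basis = sum ?F ((\<lambda>u. (u, 0)) ` Basis) + ?F (0, 1)"
        unfolding B by (subst sum.union_disjoint) (auto simp: nonzero_Basis)
      also have "?F (0, 1) = 0" by (simp add: g'_def)
      also have "sum ?F ((\<lambda>u. (u, 0)) ` Basis) = (\<Sum>b\<in>Basis. (fst v \<bullet> b) * g b (fst p))"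
        by (subst sum.reindex) (auto simp: inj_on_def g'_def inner_prod_def intro!: sum.cong)
      finally show ?thesis by simp
    qed
    ultimately show ?thesis by simp
  qed
  moreover have "Ck_on k (g' b) (UNIV \<times> I)" for b
  proof (cases "fst b \<in> Basis")
    case True
    then show ?thesis using Suc.IH g(2) by (simp add: g'_def)
  qed (simp add: g'_def Ck_on_const)
  ultimately show ?case unfolding Ck_on.simps(2) by (intro exI[of _ g']) blast
qed

text \<open>The set \<open>U\<close> admits lines that stay in \<open>S\<close> on one side only, as
  is needed for time derivatives at the ends of the time interval.\<close>

lemma Ck_on_directional:
  fixes F :: "'a::euclidean_space \<Rightarrow> real"
  assumes F: "(F has_derivative (\<lambda>v. \<Sum>b\<in>Basis. (v \<bullet> b) * g b)) (at p within S)"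
    and b: "b0 \<in> Basis" and S: "\<And>r. r \<in> U \<Longrightarrow> p + (r - r0) *\<^sub>R b0 \<in> S"
  shows "((\<lambda>r. F (p + (r - r0) *\<^sub>R b0)) has_real_derivative g b0) (at r0 within U)"
proof -
  have "((\<lambda>r. F (p + (r - r0) *\<^sub>R b0)) has_derivative
      (\<lambda>r. \<Sum>b\<in>Basis. ((r *\<^sub>R b0) \<bullet> b) * g b)) (at r0 within U)"
  proof (rule has_derivative_in_compose[where f' = "\<lambda>r. r *\<^sub>R b0"])
    show "((\<lambda>r. p + (r - r0) *\<^sub>R b0) has_derivative (\<lambda>r. r *\<^sub>R b0)) (at r0 within U)"
      by (rule has_derivative_eq_rhs, (rule derivative_intros)+) simp
    show "(F has_derivative (\<lambda>v. \<Sum>b\<in>Basis. (v \<bullet> b) * g b))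
        (at (p + (r0 - r0) *\<^sub>R b0) within (\<lambda>r. p + (r - r0) *\<^sub>R b0) ` U)"
      using has_derivative_subset[OF F, of "(\<lambda>r. p + (r - r0) *\<^sub>R b0) ` U"] S by auto
  qed
  moreover have "(\<Sum>b\<in>Basis. ((r *\<^sub>R b0) \<bullet> b) * g b) = r * g b0" for r
  proof -
    have "(\<Sum>b\<in>Basis. ((r *\<^sub>R b0) \<bullet> b) * g b) = (\<Sum>b\<in>Basis. if b = b0 then r * g b0 else 0)"
      using b by (intro sum.cong refl) (simp add: inner_Basis)
    then show ?thesis using b by simp
  qed
  moreover have "(\<lambda>r. r * g b0) = (*) (g b0)" by (simp add: fun_eq_iff)
  ultimately show ?thesis unfolding has_field_derivative_def by (simp only:)
qed

text \<open>Periodicity is bundled with differentiability because on an unbounded domain it is what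
  makes continuous functions bounded; partial derivatives inherit both properties, so bounds are
  available at every order.\<close>

definition st_smooth :: "real \<Rightarrow> real \<Rightarrow> real \<Rightarrow> nat \<Rightarrow> (real \<times> real \<Rightarrow> real \<Rightarrow> real) \<Rightarrow> bool" where
  "st_smooth L1 L2 T k f \<longleftrightarrow> Ck_on k (\<lambda>(x, t). f x t) (UNIV \<times> {0..T}) \<and>
     (\<forall>t\<in>{0..T}. periodic_fun L1 L2 (\<lambda>x. f x t))"

text \<open>The derivatives inherit periodicity by uniqueness of derivatives. For the time
  derivative, which is one-sided at 0 and \<open>T\<close>, uniqueness needs a nondegenerate
  interval, hence \<open>0 < T\<close>.\<close>

lemma st_smooth_partials:
  assumes f: "st_smooth L1 L2 T (Suc k) f" and T: "0 < T"
  shows "\<exists>fx fy ft. st_smooth L1 L2 T k fx \<and> st_smooth L1 L2 T k fy \<and> st_smooth L1 L2 T k ft \<and>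
     (\<forall>t\<in>{0..T}. \<forall>x y. ((\<lambda>r. f (r, y) t) has_real_derivative fx (x, y) t) (at x)) \<and>
     (\<forall>t\<in>{0..T}. \<forall>x y. ((\<lambda>r. f (x, r) t) has_real_derivative fy (x, y) t) (at y)) \<and>
     (\<forall>t\<in>{0..T}. \<forall>p. ((\<lambda>r. f p r) has_real_derivative ft p t) (at t within {0..T}))"
proof -
  from f obtain g where
    g: "\<forall>p\<in>UNIV \<times> {0..T}. ((\<lambda>(x, t). f x t) has_derivative (\<lambda>v. \<Sum>b\<in>Basis. (v \<bullet> b) * g b p)) (at p within UNIV \<times> {0..T})"
      "\<forall>b\<in>Basis. Ck_on k (g b) (UNIV \<times> {0..T})" by (auto simp: st_smooth_def)
  define fx where "fx = (\<lambda>x t. g ((1, 0), 0) (x, t))"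
  define fy where "fy = (\<lambda>x t. g ((0, 1), 0) (x, t))"
  define ft where "ft = (\<lambda>x t. g ((0, 0), 1) (x, t))"
  have B: "((1, 0), 0) \<in> (Basis :: ((real \<times> real) \<times> real) set)" "((0, 1), 0) \<in> (Basis :: ((real \<times> real) \<times> real) set)"
    "((0, 0), 1) \<in> (Basis :: ((real \<times> real) \<times> real) set)"
    by (auto simp: Basis_prod_def zero_prod_def)
  have dx: "((\<lambda>r. f (r, y) t) has_real_derivative fx (x, y) t) (at x)" if "t \<in> {0..T}" for x y t
    using Ck_on_directional[OF g(1)[rule_format, of "((x, y), t)"] B(1), of UNIV x] that
    by (simp add: fx_def)
  have dy: "((\<lambda>r. f (x, r) t) has_real_derivative fy (x, y) t) (at y)" if "t \<in> {0..T}" for x y t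
    using Ck_on_directional[OF g(1)[rule_format, of "((x, y), t)"] B(2), of UNIV y] that
    by (simp add: fy_def)
  have dt: "((\<lambda>r. f p r) has_real_derivative ft p t) (at t within {0..T})" if "t \<in> {0..T}" for p t
    using Ck_on_directional[OF g(1)[rule_format, of "(p, t)"] B(3), of "{0..T}" t] that
    by (simp add: ft_def flip: zero_prod_def)
  have per: "f (x + L1, y) t = f (x, y) t" "f (x, y + L2) t = f (x, y) t" if "t \<in> {0..T}" for x y t
    using f that by (auto simp: st_smooth_def periodic_fun_def)
  have "fx (x + L1, y) t = fx (x, y) t" "fx (x, y + L2) t = fx (x, y) t"
     "fy (x + L1, y) t = fy (x, y) t" "fy (x, y + L2) t = fy (x, y) t"
     "ft (x + L1, y) t = ft (x, y) t" "ft (x, y + L2) t = ft (x, y) t" if t: "t \<in> {0..T}" for x y t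
  proof -
    show "fx (x + L1, y) t = fx (x, y) t"
      using DERIV_unique[OF dx[OF t, of y x]] dx[OF t, of y "x + L1"] per(1)[OF t]
      by (simp add: DERIV_shift)
    show "fx (x, y + L2) t = fx (x, y) t"
      using DERIV_unique[OF dx[OF t, of y x]] dx[OF t, of "y + L2" x] per(2)[OF t] by simp
    show "fy (x + L1, y) t = fy (x, y) t"
      using DERIV_unique[OF dy[OF t, of x y]] dy[OF t, of "x + L1" y] per(1)[OF t] by simp
    show "fy (x, y + L2) t = fy (x, y) t"
      using DERIV_unique[OF dy[OF t, of x y]] dy[OF t, of x "y + L2"] per(2)[OF t]
      by (simp add: DERIV_shift)
    have ft: "ft p t = ft q t" if "\<And>r. r \<in> {0..T} \<Longrightarrow> f p r = f q r" for p q
    proof -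
      have "((\<lambda>r. f p r) has_real_derivative ft q t) (at t within {0..T})"
        using dt[OF t, of q] by (rule has_field_derivative_transform_within[OF _ zero_less_one t]) (simp add: that)
      then show ?thesis
        using vector_derivative_unique_within_closed_interval[of 0 T t "f p" "ft p t" "ft q t"] dt[OF t, of p] T t
        by (simp add: has_real_derivative_iff_has_vector_derivative cbox_interval)
    qed
    show "ft (x + L1, y) t = ft (x, y) t" "ft (x, y + L2) t = ft (x, y) t" using per by (auto intro!: ft)
  qed
  then have "st_smooth L1 L2 T k fx" "st_smooth L1 L2 T k fy" "st_smooth L1 L2 T k ft"
    unfolding st_smooth_def periodic_fun_def using g(2) B by (simp_all add: fx_def fy_def ft_def)
  then show ?thesis using dx dy dt
    by (intro exI[of _ fx] exI[of _ fy] exI[of _ ft] conjI ballI allI) 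
qed

lemma periodic_of_int:
  fixes g :: "real \<Rightarrow> 'a"
  assumes "\<And>r. g (r + L) = g r"
  shows "g (r + of_int k * L) = g r"
proof (induction k rule: int_induct[where k = 0])
  case (step1 i)
  then show ?case using assms[of "r + of_int i * L"] by (simp add: algebra_simps)
next
  case (step2 i)
  then show ?case using assms[of "r + of_int (i - 1) * L"] by (simp add: algebra_simps)
qed simp

lemma periodic_reduce:
  fixes r L :: real
  assumes "0 < L"
  shows "\<exists>k::int. r + of_int k * L \<in> {0..L}"
proof
  have "of_int \<lfloor>r / L\<rfloor> \<le> r / L" "r / L < of_int \<lfloor>r / L\<rfloor> + 1" by linarith+
  then have "of_int \<lfloor>r / L\<rfloor> * L \<le> r" "r < (of_int \<lfloor>r / L\<rfloor> + 1) * L"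
    unfolding pos_le_divide_eq[OF assms] pos_divide_less_eq[OF assms] .
  then show "r + of_int (- \<lfloor>r / L\<rfloor>) * L \<in> {0..L}" by (simp add: algebra_simps)
qed

lemma periodic_fun_of_int:
  assumes "periodic_fun L1 L2 f"
  shows "f (x + of_int a * L1, y + of_int b * L2) = f (x, y)"
proof -
  have "f (x + of_int a * L1, y + of_int b * L2) = f (x, y + of_int b * L2)"
    by (rule periodic_of_int[of "\<lambda>r. f (r, y + of_int b * L2)"]) (use assms in \<open>simp add: periodic_fun_def\<close>)
  also have "\<dots> = f (x, y)"
    by (rule periodic_of_int[of "\<lambda>r. f (x, r)"]) (use assms in \<open>simp add: periodic_fun_def\<close>)
  finally show ?thesis .
qed

lemma st_smooth_bounded:
  assumes f: "st_smooth L1 L2 T k f" and L: "0 < L1" "0 < L2"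
  shows "\<exists>M\<ge>0. \<forall>t\<in>{0..T}. \<forall>p. \<bar>f p t\<bar> \<le> M"
proof -
  let ?C = "cbox (0, 0) (L1, L2) \<times> {0..T}"
  have "continuous_on ?C (\<lambda>(x, t). f x t)"
    using f[unfolded st_smooth_def] by (intro continuous_on_subset[OF Ck_on_imp_continuous_on]) auto
  then have "bounded ((\<lambda>(x, t). f x t) ` ?C)"
    by (intro compact_imp_bounded compact_continuous_image compact_Times) auto
  then obtain M where M: "\<And>p. p \<in> ?C \<Longrightarrow> \<bar>(\<lambda>(x, t). f x t) p\<bar> \<le> M" unfolding bounded_iff real_norm_def by blast
  have "\<bar>f p t\<bar> \<le> \<bar>M\<bar>" if t: "t \<in> {0..T}" for p t
  proof -
    obtain x y where p: "p = (x, y)" by (cases p)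
    obtain a b :: int where ab: "x + of_int a * L1 \<in> {0..L1}" "y + of_int b * L2 \<in> {0..L2}"
      using periodic_reduce[OF L(1)] periodic_reduce[OF L(2)] by meson
    have "f (x + of_int a * L1, y + of_int b * L2) t = f (x, y) t"
      using f t unfolding st_smooth_def by (intro periodic_fun_of_int[of L1 L2 "\<lambda>p. f p t"]) blast
    moreover have "((x + of_int a * L1, y + of_int b * L2), t) \<in> ?C" using ab t by (simp add: cbox_Pair_eq del: interval_cbox)
    ultimately show ?thesis using M[of "((x + of_int a * L1, y + of_int b * L2), t)"] p by simp
  qed
  then show ?thesis by (intro exI[of _ "\<bar>M\<bar>"]) auto
qed

subsection \<open>Taylor expansion and the periodic trapezoidal rule\<close>

text \<open>A convex set \<open>S\<close> covers both the whole line in space and the closed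
  interval in time with its one-sided derivatives. In this and the next three lemmas
  \<open>F\<close> lists the successive derivatives, and the remainder constants are those of
  \<open>field_Taylor\<close>, which are not sharp.\<close>

lemma taylor_1:
  fixes g :: "real \<Rightarrow> real"
  assumes S: "convex S" "w \<in> S" "z \<in> S"
    and f: "\<And>x. x \<in> S \<Longrightarrow> (g has_real_derivative g1 x) (at x within S)"
    and B: "\<And>x. x \<in> S \<Longrightarrow> \<bar>g1 x\<bar> \<le> M"
  shows "\<bar>g z - g w\<bar> \<le> M * \<bar>z - w\<bar>"
proof -
  define F where "F = (!) [g, g1]"
  have "norm (F 0 z - (\<Sum>i\<le>0. F i w * (z - w) ^ i / fact i)) \<le> M * norm (z - w) ^ Suc 0 / fact 0"
  proof (rule field_Taylor[OF S(1) _ _ S(2,3)])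
    fix i :: nat and x assume "i \<le> 0" "x \<in> S"
    then have "i = 0" by auto
    then show "(F i has_real_derivative F (Suc i) x) (at x within S)"
      using f \<open>x \<in> S\<close> by (auto simp: F_def)
  qed (use B in \<open>simp add: F_def numeral_eq_Suc\<close>)
  then show ?thesis by (simp add: F_def numeral_eq_Suc fact_numeral algebra_simps)
qed

lemma taylor_2:
  fixes g :: "real \<Rightarrow> real"
  assumes S: "convex S" "w \<in> S" "z \<in> S"
    and f: "\<And>x. x \<in> S \<Longrightarrow> (g has_real_derivative g1 x) (at x within S)"
      "\<And>x. x \<in> S \<Longrightarrow> (g1 has_real_derivative g2 x) (at x within S)"
    and B: "\<And>x. x \<in> S \<Longrightarrow> \<bar>g2 x\<bar> \<le> M"
  shows "\<bar>g z - g w - g1 w * (z - w)\<bar> \<le> M * \<bar>z - w\<bar>\<^sup>2"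
proof -
  define F where "F = (!) [g, g1, g2]"
  have "norm (F 0 z - (\<Sum>i\<le>1. F i w * (z - w) ^ i / fact i)) \<le> M * norm (z - w) ^ Suc 1 / fact 1"
  proof (rule field_Taylor[OF S(1) _ _ S(2,3)])
    fix i :: nat and x assume "i \<le> 1" "x \<in> S"
    then have "i = 0 \<or> i = Suc 0" by auto
    then show "(F i has_real_derivative F (Suc i) x) (at x within S)"
      using f \<open>x \<in> S\<close> by (auto simp: F_def)
  qed (use B in \<open>simp add: F_def numeral_eq_Suc\<close>)
  then show ?thesis by (simp add: F_def numeral_eq_Suc fact_numeral algebra_simps)
qed

lemma taylor_3:
  fixes g :: "real \<Rightarrow> real"
  assumes S: "convex S" "w \<in> S" "z \<in> S"
    and f: "\<And>x. x \<in> S \<Longrightarrow> (g has_real_derivative g1 x) (at x within S)"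
      "\<And>x. x \<in> S \<Longrightarrow> (g1 has_real_derivative g2 x) (at x within S)"
      "\<And>x. x \<in> S \<Longrightarrow> (g2 has_real_derivative g3 x) (at x within S)"
    and B: "\<And>x. x \<in> S \<Longrightarrow> \<bar>g3 x\<bar> \<le> M"
  shows "\<bar>g z - g w - g1 w * (z - w) - g2 w * (z - w)\<^sup>2 / 2\<bar> \<le> M * \<bar>z - w\<bar> ^ 3 / 2"
proof -
  define F where "F = (!) [g, g1, g2, g3]"
  have "norm (F 0 z - (\<Sum>i\<le>2. F i w * (z - w) ^ i / fact i)) \<le> M * norm (z - w) ^ Suc 2 / fact 2"
  proof (rule field_Taylor[OF S(1) _ _ S(2,3)])
    fix i :: nat and x assume "i \<le> 2" "x \<in> S"
    then have "i = 0 \<or> i = Suc 0 \<or> i = Suc (Suc 0)" by auto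
    then show "(F i has_real_derivative F (Suc i) x) (at x within S)"
      using f \<open>x \<in> S\<close> by (auto simp: F_def)
  qed (use B in \<open>simp add: F_def numeral_eq_Suc\<close>)
  then show ?thesis by (simp add: F_def numeral_eq_Suc fact_numeral algebra_simps)
qed

lemma taylor_4:
  fixes g :: "real \<Rightarrow> real"
  assumes S: "convex S" "w \<in> S" "z \<in> S"
    and f: "\<And>x. x \<in> S \<Longrightarrow> (g has_real_derivative g1 x) (at x within S)"
      "\<And>x. x \<in> S \<Longrightarrow> (g1 has_real_derivative g2 x) (at x within S)"
      "\<And>x. x \<in> S \<Longrightarrow> (g2 has_real_derivative g3 x) (at x within S)"
      "\<And>x. x \<in> S \<Longrightarrow> (g3 has_real_derivative g4 x) (at x within S)"
    and B: "\<And>x. x \<in> S \<Longrightarrow> \<bar>g4 x\<bar> \<le> M"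
  shows "\<bar>g z - g w - g1 w * (z - w) - g2 w * (z - w)\<^sup>2 / 2 - g3 w * (z - w) ^ 3 / 6\<bar> \<le> M * \<bar>z - w\<bar> ^ 4 / 6"
proof -
  define F where "F = (!) [g, g1, g2, g3, g4]"
  have "norm (F 0 z - (\<Sum>i\<le>3. F i w * (z - w) ^ i / fact i)) \<le> M * norm (z - w) ^ Suc 3 / fact 3"
  proof (rule field_Taylor[OF S(1) _ _ S(2,3)])
    fix i :: nat and x assume "i \<le> 3" "x \<in> S"
    then have "i = 0 \<or> i = Suc 0 \<or> i = Suc (Suc 0) \<or> i = Suc (Suc (Suc 0))" by auto
    then show "(F i has_real_derivative F (Suc i) x) (at x within S)"
      using f \<open>x \<in> S\<close> by (auto simp: F_def)
  qed (use B in \<open>simp add: F_def numeral_eq_Suc\<close>)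
  then show ?thesis by (simp add: F_def numeral_eq_Suc fact_numeral algebra_simps)
qed

lemma second_difference_le:
  fixes g :: "real \<Rightarrow> real"
  assumes "\<And>x. (g has_real_derivative g1 x) (at x)" "\<And>x. (g1 has_real_derivative g2 x) (at x)"
    and "\<And>x. \<bar>g2 x\<bar> \<le> M"
  shows "\<bar>g (x + h) + g (x - h) - 2 * g x\<bar> \<le> 2 * M * h\<^sup>2"
proof -
  have "\<bar>g (x + h) - g x - g1 x * (x + h - x)\<bar> \<le> M * \<bar>x + h - x\<bar>\<^sup>2"
    by (rule taylor_2[of UNIV]) (use assms in auto)
  moreover have "\<bar>g (x - h) - g x - g1 x * (x - h - x)\<bar> \<le> M * \<bar>x - h - x\<bar>\<^sup>2"
    by (rule taylor_2[of UNIV]) (use assms in auto)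
  ultimately show ?thesis by simp
qed

lemma second_difference_derivative:
  fixes g :: "real \<Rightarrow> real"
  assumes "\<And>x. (g has_real_derivative g1 x) (at x)" "\<And>x. (g1 has_real_derivative g2 x) (at x)"
    and "\<And>x. (g2 has_real_derivative g3 x) (at x)" "\<And>x. (g3 has_real_derivative g4 x) (at x)"
    and "\<And>x. \<bar>g4 x\<bar> \<le> M"
  shows "\<bar>g (x + h) + g (x - h) - 2 * g x - h\<^sup>2 * g2 x\<bar> \<le> M * h ^ 4"
proof -
  have "\<bar>h\<bar> ^ 4 = h ^ 4" by (rule power_even_abs) simp
  then have "\<bar>g (x + h) - g x - g1 x * h - g2 x * h\<^sup>2 / 2 - g3 x * h ^ 3 / 6\<bar> \<le> M * h ^ 4 / 6"
    "\<bar>g (x - h) - g x + g1 x * h - g2 x * h\<^sup>2 / 2 + g3 x * h ^ 3 / 6\<bar> \<le> M * h ^ 4 / 6"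
    using taylor_4[of UNIV x "x + h" g g1 g2 g3 g4 M] taylor_4[of UNIV x "x - h" g g1 g2 g3 g4 M] assms
    by simp_all
  moreover have "0 \<le> M * h ^ 4" using order_trans[OF abs_ge_zero assms(5)] by simp
  ultimately show ?thesis by (simp add: abs_le_iff field_simps)
qed

section \<open>Composite trapezoidal rule over a period\<close>

lemma trapezoid_cell:
  fixes g :: "real \<Rightarrow> real"
  assumes g: "\<And>x. (g has_real_derivative g1 x) (at x)" "\<And>x. (g1 has_real_derivative g2 x) (at x)"
    and M: "\<And>x. \<bar>g2 x\<bar> \<le> M" and h: "0 < h"
  shows "\<bar>integral {a..a + h} g - h * (g a + g (a + h)) / 2\<bar> \<le> 2 * M * h ^ 3"
proof -
  have M0: "0 \<le> M" using order_trans[OF abs_ge_zero M] by simp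
  have T: "\<bar>g x - g a - g1 a * (x - a)\<bar> \<le> M * \<bar>x - a\<bar>\<^sup>2" for x
    by (rule taylor_2[of UNIV]) (use g M in auto)
  have cont: "continuous_on {a..a + h} g"
    using g(1) by (meson DERIV_isCont continuous_at_imp_continuous_on)
  \<comment> \<open>The integral and the trapezoidal value are both compared with the tangent at the
    left end point; the two errors are at most \<open>M * h ^ 3\<close> and half of that.\<close>
  let ?l = "\<lambda>x. g a + g1 a * (x - a)"
  have l: "(?l has_integral (g a * h + g1 a * h\<^sup>2 / 2)) {a..a + h}"
  proof -
    have "(?l has_integral ((\<lambda>x. g a * (x - a) + g1 a * (x - a)\<^sup>2 / 2) (a + h) - (\<lambda>x. g a * (x - a) + g1 a * (x - a)\<^sup>2 / 2) a)) {a..a + h}"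
      using h by (intro fundamental_theorem_of_calculus)
        (auto intro!: derivative_eq_intros simp flip: has_real_derivative_iff_has_vector_derivative)
    then show ?thesis by simp
  qed
  have d: "((\<lambda>x. g x - ?l x) has_integral (integral {a..a + h} g - (g a * h + g1 a * h\<^sup>2 / 2))) (cbox a (a + h))"
    unfolding cbox_interval by (intro has_integral_diff l integrable_integral integrable_continuous_real cont)
  have "norm (integral {a..a + h} g - (g a * h + g1 a * h\<^sup>2 / 2)) \<le> M * h\<^sup>2 * measure lborel (cbox a (a + h))"
  proof (rule has_integral_bound[OF _ d])
    fix x assume x: "x \<in> cbox a (a + h)"
    have "\<bar>g x - ?l x\<bar> \<le> M * \<bar>x - a\<bar>\<^sup>2" using T[of x] by (simp add: algebra_simps)
    also have "\<dots> \<le> M * h\<^sup>2" using x M0 by (intro mult_left_mono power_mono) auto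
    finally show "norm (g x - ?l x) \<le> M * h\<^sup>2" by simp
  qed (use M0 in simp)
  then have "\<bar>integral {a..a + h} g - (g a * h + g1 a * h\<^sup>2 / 2)\<bar> \<le> M * h ^ 3"
    using h by (simp add: power2_eq_square power3_eq_cube mult.assoc)
  moreover have "\<bar>h / 2 * (g (a + h) - g a - g1 a * h)\<bar> \<le> h / 2 * (M * h\<^sup>2)"
    unfolding abs_mult using T[of "a + h"] h by (intro mult_mono) auto
  moreover have "0 \<le> M * h ^ 3" using M0 h by simp
  moreover have "h / 2 * (M * h\<^sup>2) = M * h ^ 3 / 2" by (simp add: power2_eq_square power3_eq_cube)
  moreover have "integral {a..a + h} g - h * (g a + g (a + h)) / 2 =
      (integral {a..a + h} g - (g a * h + g1 a * h\<^sup>2 / 2)) - h / 2 * (g (a + h) - g a - g1 a * h)"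
    by (simp add: field_simps power2_eq_square)
  ultimately show ?thesis by linarith
qed

lemma trapezoid_periodic:
  fixes g :: "real \<Rightarrow> real"
  assumes g: "\<And>x. (g has_real_derivative g1 x) (at x)" "\<And>x. (g1 has_real_derivative g2 x) (at x)"
    and M: "\<And>x. \<bar>g2 x\<bar> \<le> M" and h: "0 < h" and per: "g (real m * h) = g 0"
  shows "\<bar>h * (\<Sum>k=1..int m. g (of_int k * h)) - integral {0..real m * h} g\<bar> \<le> 2 * M * (real m * h) * h\<^sup>2"
proof -
  have cont: "continuous_on A g" for A
    using g(1) by (meson DERIV_isCont continuous_at_imp_continuous_on)
  \<comment> \<open>The scheme samples right end points only. The induction keeps the boundary
    correction that separates this sum from the trapezoidal one; over a full period it
    vanishes.\<close>
  have "\<bar>integral {0..real m * h} g - h * (\<Sum>k=1..int m. g (of_int k * h)) - h * (g 0 - g (real m * h)) / 2\<bar>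
      \<le> 2 * M * h ^ 3 * real m" for m
  proof (induction m)
    case (Suc m)
    have "integral {0..real m * h} g + integral {real m * h..real m * h + h} g = integral {0..real m * h + h} g"
      using h by (intro Henstock_Kurzweil_Integration.integral_combine integrable_continuous_real cont) auto
    moreover have "\<bar>integral {real m * h..real m * h + h} g - h * (g (real m * h) + g (real m * h + h)) / 2\<bar> \<le> 2 * M * h ^ 3"
      by (rule trapezoid_cell[OF g M h])
    moreover have "{1..int (Suc m)} = insert (int m + 1) {1..int m}" by auto
    then have "(\<Sum>k=1..int (Suc m). g (of_int k * h)) = (\<Sum>k=1..int m. g (of_int k * h)) + g (real m * h + h)"
      by (simp add: algebra_simps)
    moreover have "real (Suc m) * h = real m * h + h" by (simp add: algebra_simps)
    ultimately show ?case using Suc.IH by (simp add: algebra_simps add_divide_distrib diff_divide_distrib)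
  qed simp
  from this[of m, unfolded per] have "\<bar>integral {0..real m * h} g - h * (\<Sum>k=1..int m. g (of_int k * h))\<bar> \<le> 2 * M * h ^ 3 * real m"
    by simp
  then show ?thesis by (simp add: abs_minus_commute power2_eq_square power3_eq_cube mult_ac)
qed

lemma Omega_eq_box: "Omega L1 L2 = box (0, 0) (L1, L2)"
  by (auto simp: Omega_def box_def Basis_prod_def)

lemma integral_Omega:
  fixes q :: "real \<times> real \<Rightarrow> real"
  assumes "continuous_on UNIV q"
  shows "integral (Omega L1 L2) q = integral {0..L1} (\<lambda>x. integral {0..L2} (\<lambda>y. q (x, y)))"
proof -
  have "continuous_on (cbox (0, 0) (L1, L2)) q" using assms continuous_on_subset by blast
  from integral_prod_continuous[OF this] show ?thesis
    by (simp add: Omega_eq_box integral_open_interval cbox_interval)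
qed

text \<open>The error in \<open>y\<close> at fixed \<open>x\<close> is integrated over
  \<open>x\<close>, and the error in \<open>x\<close> is summed over the nodes in \<open>y\<close>;
  each contributes \<open>2 * M * L1 * L2 * h\<^sup>2\<close>.\<close>

lemma trapezoid_periodic_2d:
  fixes q :: "real \<times> real \<Rightarrow> real"
  assumes cont: "continuous_on UNIV q" and per: "periodic_fun L1 L2 q"
    and x: "\<And>x y. ((\<lambda>r. q (r, y)) has_real_derivative qx (x, y)) (at x)"
      "\<And>x y. ((\<lambda>r. qx (r, y)) has_real_derivative qxx (x, y)) (at x)" "\<And>p. \<bar>qxx p\<bar> \<le> M"
    and y: "\<And>x y. ((\<lambda>r. q (x, r)) has_real_derivative qy (x, y)) (at y)"
      "\<And>x y. ((\<lambda>r. qy (x, r)) has_real_derivative qyy (x, y)) (at y)" "\<And>p. \<bar>qyy p\<bar> \<le> M"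
    and h: "0 < h" and L: "L1 = real m * h" "L2 = real n * h"
  shows "\<bar>h\<^sup>2 * (\<Sum>k=1..int m. \<Sum>l=1..int n. q (of_int k * h, of_int l * h)) - integral (Omega L1 L2) q\<bar>
     \<le> 4 * M * L1 * L2 * h\<^sup>2"
proof -
  have M0: "0 \<le> M" using order_trans[OF abs_ge_zero x(3)] by simp
  have L0: "0 \<le> L1" "0 \<le> L2" using L h by auto
  have cx: "continuous_on A (\<lambda>x. q (x, y))" for A y
    by (rule continuous_on_compose2[OF cont]) (auto intro!: continuous_intros)
  define G where "G = (\<lambda>x. integral {0..L2} (\<lambda>y. q (x, y)))"
  define S where "S = (\<lambda>x. h * (\<Sum>l=1..int n. q (x, of_int l * h)))"
  have SG: "\<bar>S x - G x\<bar> \<le> 2 * M * L2 * h\<^sup>2" for x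
    unfolding S_def G_def L(2)
    by (rule trapezoid_periodic[of "\<lambda>r. q (x, r)" "\<lambda>r. qy (x, r)" "\<lambda>r. qyy (x, r)", OF y(1,2,3) h])
      (use per[unfolded periodic_fun_def, rule_format, of x 0] L in simp)
  have Gc: "continuous_on {0..L1} G"
  proof -
    have "continuous_on ({0..L1} \<times> cbox 0 L2) (\<lambda>(x, y). q (x, y))"
      using continuous_on_subset[OF cont] by simp
    from integral_continuous_on_param[OF this] show ?thesis by (simp add: G_def cbox_interval)
  qed
  have Sc: "continuous_on {0..L1} S" unfolding S_def by (intro continuous_intros cx)
  have "\<bar>integral {0..L1} S - integral {0..L1} G\<bar> \<le> 2 * M * L2 * h\<^sup>2 * L1"
  proof -
    have "((\<lambda>x. S x - G x) has_integral (integral {0..L1} S - integral {0..L1} G)) (cbox 0 L1)"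
      using Sc Gc unfolding cbox_interval
      by (intro has_integral_diff integrable_integral integrable_continuous_real)
    from has_integral_bound[OF _ this, of "2 * M * L2 * h\<^sup>2"] show ?thesis
      using SG M0 L0 by simp
  qed
  moreover have "\<bar>h * (\<Sum>l=1..int n. h * (\<Sum>k=1..int m. q (of_int k * h, of_int l * h))) - integral {0..L1} S\<bar>
     \<le> 2 * M * L1 * h\<^sup>2 * L2"
  proof -
    have per1: "q (real m * h, y) = q (0, y)" for y
      using per[unfolded periodic_fun_def, rule_format, of 0 y] L by simp
    have "integral {0..L1} S = h * (\<Sum>l=1..int n. integral {0..L1} (\<lambda>x. q (x, of_int l * h)))"
      unfolding S_def integral_mult_right
      by (subst integral_sum) (auto intro!: integrable_continuous_real cx)
    then have "\<bar>h * (\<Sum>l=1..int n. h * (\<Sum>k=1..int m. q (of_int k * h, of_int l * h))) - integral {0..L1} S\<bar>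
        = h * \<bar>\<Sum>l=1..int n. h * (\<Sum>k=1..int m. q (of_int k * h, of_int l * h)) - integral {0..L1} (\<lambda>x. q (x, of_int l * h))\<bar>"
      using h by (simp add: sum_subtractf abs_mult flip: right_diff_distrib)
    also have "\<dots> \<le> h * (\<Sum>l=1..int n. 2 * M * L1 * h\<^sup>2)"
      using h by (intro mult_left_mono order_trans[OF sum_abs] sum_mono)
        (auto simp: L(1) intro!: trapezoid_periodic[of "\<lambda>r. q (r, y)" "\<lambda>r. qx (r, y)" "\<lambda>r. qxx (r, y)" for y] x per1)
    also have "\<dots> = 2 * M * L1 * h\<^sup>2 * L2" by (simp add: L(2))
    finally show ?thesis .
  qed
  moreover have "h\<^sup>2 * (\<Sum>k=1..int m. \<Sum>l=1..int n. q (of_int k * h, of_int l * h)) =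
      h * (\<Sum>l=1..int n. h * (\<Sum>k=1..int m. q (of_int k * h, of_int l * h)))"
    by (subst sum.swap) (simp add: sum_distrib_left power2_eq_square mult.assoc)
  moreover have "integral (Omega L1 L2) q = integral {0..L1} G" by (simp add: integral_Omega[OF cont] G_def)
  ultimately show ?thesis by (simp add: algebra_simps)
qed

subsection \<open>Consistency\<close>

text \<open>The five-point stencil on functions of a continuous variable, so that Taylor expansion
  is available before restriction to the grid.\<close>

definition dlap :: "real \<Rightarrow> (real \<times> real \<Rightarrow> real) \<Rightarrow> real \<times> real \<Rightarrow> real" where
  "dlap h q p = ((q (fst p + h, snd p) + q (fst p - h, snd p) - 2 * q p)
     + (q (fst p, snd p + h) + q (fst p, snd p - h) - 2 * q p)) / h\<^sup>2"

lemma discrete_laplacian_restrict: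
  "discrete_laplacian h (cell_restrict h q) i j = dlap h q (grid_pt h (of_int i), grid_pt h (of_int j))"
  unfolding discrete_laplacian_def dlap_def cell_restrict_def grid_pt_def
  by (simp add: algebra_simps)

lemma dlap_add: "dlap h (\<lambda>z. q z + q' z) p = dlap h q p + dlap h q' p"
  by (simp add: dlap_def add_divide_distrib[symmetric])

lemma dlap_diff: "dlap h (\<lambda>z. q z - q' z) p = dlap h q p - dlap h q' p"
  by (simp add: dlap_def diff_divide_distrib[symmetric])

lemma dlap_cmult: "dlap h (\<lambda>z. c * q z) p = c * dlap h q p"
  by (simp add: dlap_def algebra_simps)

text \<open>Intended for defects that are already small in time: smallness of their second
  derivatives survives the discrete Laplacian, with nothing lost to the division by
  \<open>h\<^sup>2\<close>.\<close>

lemma dlap_le: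
  assumes x: "\<And>x y. ((\<lambda>r. q (r, y)) has_real_derivative qx (x, y)) (at x)"
      "\<And>x y. ((\<lambda>r. qx (r, y)) has_real_derivative qxx (x, y)) (at x)" "\<And>p. \<bar>qxx p\<bar> \<le> M"
    and y: "\<And>x y. ((\<lambda>r. q (x, r)) has_real_derivative qy (x, y)) (at y)"
      "\<And>x y. ((\<lambda>r. qy (x, r)) has_real_derivative qyy (x, y)) (at y)" "\<And>p. \<bar>qyy p\<bar> \<le> M"
    and h: "0 < h"
  shows "\<bar>dlap h q p\<bar> \<le> 4 * M"
proof -
  obtain a b where p: "p = (a, b)" by (cases p)
  have X: "\<bar>q (a + h, b) + q (a - h, b) - 2 * q (a, b)\<bar> \<le> 2 * M * h\<^sup>2"
    by (rule second_difference_le[of "\<lambda>r. q (r, b)", OF x(1,2,3)])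
  have Y: "\<bar>q (a, b + h) + q (a, b - h) - 2 * q (a, b)\<bar> \<le> 2 * M * h\<^sup>2"
    by (rule second_difference_le[of "\<lambda>r. q (a, r)", OF y(1,2,3)])
  have "\<bar>dlap h q p\<bar> = \<bar>(q (a + h, b) + q (a - h, b) - 2 * q (a, b))
     + (q (a, b + h) + q (a, b - h) - 2 * q (a, b))\<bar> / h\<^sup>2"
    by (simp add: dlap_def p)
  also have "\<dots> \<le> (2 * M * h\<^sup>2 + 2 * M * h\<^sup>2) / h\<^sup>2"
    by (intro divide_right_mono order_trans[OF abs_triangle_ineq] add_mono X Y) simp
  also have "\<dots> = 4 * M" using h by simp
  finally show ?thesis .
qed

lemma dlap_derivative:
  assumes x: "\<And>x y. ((\<lambda>r. q (r, y)) has_real_derivative qx (x, y)) (at x)"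
      "\<And>x y. ((\<lambda>r. qx (r, y)) has_real_derivative qxx (x, y)) (at x)"
      "\<And>x y. ((\<lambda>r. qxx (r, y)) has_real_derivative qx3 (x, y)) (at x)"
      "\<And>x y. ((\<lambda>r. qx3 (r, y)) has_real_derivative qx4 (x, y)) (at x)" "\<And>p. \<bar>qx4 p\<bar> \<le> M"
    and y: "\<And>x y. ((\<lambda>r. q (x, r)) has_real_derivative qy (x, y)) (at y)"
      "\<And>x y. ((\<lambda>r. qy (x, r)) has_real_derivative qyy (x, y)) (at y)"
      "\<And>x y. ((\<lambda>r. qyy (x, r)) has_real_derivative qy3 (x, y)) (at y)"
      "\<And>x y. ((\<lambda>r. qy3 (x, r)) has_real_derivative qy4 (x, y)) (at y)" "\<And>p. \<bar>qy4 p\<bar> \<le> M"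
    and h: "0 < h"
  shows "\<bar>dlap h q p - (qxx p + qyy p)\<bar> \<le> 2 * M * h\<^sup>2"
proof -
  obtain a b where p: "p = (a, b)" by (cases p)
  have X: "\<bar>q (a + h, b) + q (a - h, b) - 2 * q (a, b) - h\<^sup>2 * qxx (a, b)\<bar> \<le> M * h ^ 4"
    by (rule second_difference_derivative[of "\<lambda>r. q (r, b)", OF x])
  have Y: "\<bar>q (a, b + h) + q (a, b - h) - 2 * q (a, b) - h\<^sup>2 * qyy (a, b)\<bar> \<le> M * h ^ 4"
    by (rule second_difference_derivative[of "\<lambda>r. q (a, r)", OF y])
  have "dlap h q p - (qxx p + qyy p) = ((q (a + h, b) + q (a - h, b) - 2 * q (a, b) - h\<^sup>2 * qxx (a, b))
     + (q (a, b + h) + q (a, b - h) - 2 * q (a, b) - h\<^sup>2 * qyy (a, b))) / h\<^sup>2"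
    using h by (simp add: dlap_def p diff_divide_distrib add_divide_distrib)
  also have "\<bar>\<dots>\<bar> \<le> (M * h ^ 4 + M * h ^ 4) / h\<^sup>2"
    unfolding abs_divide
    by (simp only: abs_power2) (intro divide_right_mono order_trans[OF abs_triangle_ineq] add_mono X Y zero_le_power2)
  also have "\<dots> = 2 * M * h\<^sup>2" using h by (simp add: power2_eq_square eval_nat_numeral)
  finally show ?thesis .
qed

text \<open>
  \<open>tm\<close> is the level before \<open>t\<close>, and \<open>\<rho>\<close> the order of the extrapolation from \<open>tm\<close> and \<open>t\<close>; in the
  first step \<open>tm = t = 0\<close> and the extrapolation is only first order.
\<close>

definition step_times :: "real \<Rightarrow> real \<Rightarrow> real \<Rightarrow> real \<Rightarrow> real \<Rightarrow> bool" where
  "step_times T t s tm \<rho> \<longleftrightarrow> 0 \<le> t \<and> 0 < s \<and> s \<le> 1 \<and> t + s \<le> T \<and>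
     (tm = t \<and> \<rho> = s \<or> s \<le> t \<and> tm = t - s \<and> \<rho> = s\<^sup>2)"

lemma step_times_square_le: "step_times T t s tm \<rho> \<Longrightarrow> s\<^sup>2 \<le> \<rho>"
  by (auto simp: step_times_def power2_eq_square mult_left_le)

lemma step_times_mem:
  assumes "step_times T t s tm \<rho>"
  shows "t \<in> {0..T}" "t + s \<in> {0..T}" "t + s / 2 \<in> {0..T}" "tm \<in> {0..T}"
  using assms by (auto simp: step_times_def)

text \<open>The estimates are bundled because all of them, with one constant, are needed for the
  solution and for its first and second space derivatives. The last two are the defects of averaging
  and of extrapolation at the midpoint; only the extrapolation depends on
  \<open>\<rho>\<close>.\<close>

definition time_bounded :: "real \<Rightarrow> real \<Rightarrow> (real \<times> real \<Rightarrow> real \<Rightarrow> real) \<Rightarrow> bool" where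
  "time_bounded T M f \<longleftrightarrow> 0 \<le> M \<and> (\<forall>t s tm \<rho> p. step_times T t s tm \<rho> \<longrightarrow>
     \<bar>f p t\<bar> \<le> M \<and> \<bar>f p (t + s)\<bar> \<le> M \<and> \<bar>f p (t + s / 2)\<bar> \<le> M \<and> \<bar>f p (t + s) - f p t\<bar> \<le> M * s \<and>
     \<bar>f p t + f p (t + s) - 2 * f p (t + s / 2)\<bar> \<le> M * s\<^sup>2 \<and>
     \<bar>3 / 2 * f p t - 1 / 2 * f p tm - f p (t + s / 2)\<bar> \<le> M * \<rho>)"

lemma time_boundedD:
  assumes "time_bounded T M f" "step_times T t s tm \<rho>"
  shows "\<bar>f p t\<bar> \<le> M" "\<bar>f p (t + s)\<bar> \<le> M" "\<bar>f p (t + s / 2)\<bar> \<le> M" "\<bar>f p (t + s) - f p t\<bar> \<le> M * s"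
    "\<bar>f p t + f p (t + s) - 2 * f p (t + s / 2)\<bar> \<le> M * s\<^sup>2"
    "\<bar>3 / 2 * f p t - 1 / 2 * f p tm - f p (t + s / 2)\<bar> \<le> M * \<rho>"
  using assms(1)[unfolded time_bounded_def, THEN conjunct2, rule_format, OF assms(2), of p] by blast+

lemma time_bounded_mono:
  assumes f: "time_bounded T M f" and MN: "M \<le> N"
  shows "time_bounded T N f"
  unfolding time_bounded_def
proof (intro conjI allI impI)
  show "0 \<le> N" using f MN by (simp add: time_bounded_def)
  fix t s tm \<rho> p assume st: "step_times T t s tm \<rho>"
  then have "0 \<le> s" "0 \<le> \<rho>" by (auto simp: step_times_def)
  then have le: "M * s \<le> N * s" "M * s\<^sup>2 \<le> N * s\<^sup>2" "M * \<rho> \<le> N * \<rho>"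
    using MN by (auto intro!: mult_right_mono)
  note B = time_boundedD[OF f st, of p]
  show "\<bar>f p t\<bar> \<le> N" "\<bar>f p (t + s)\<bar> \<le> N" "\<bar>f p (t + s / 2)\<bar> \<le> N" "\<bar>f p (t + s) - f p t\<bar> \<le> N * s"
    "\<bar>f p t + f p (t + s) - 2 * f p (t + s / 2)\<bar> \<le> N * s\<^sup>2"
    "\<bar>3 / 2 * f p t - 1 / 2 * f p tm - f p (t + s / 2)\<bar> \<le> N * \<rho>"
    by (rule order_trans[OF B(1) MN] order_trans[OF B(2) MN] order_trans[OF B(3) MN]
        order_trans[OF B(4) le(1)] order_trans[OF B(5) le(2)] order_trans[OF B(6) le(3)])+
qed

text \<open>All second-order expansions are about \<open>t + s / 2\<close>. Slopes cancel in the
  average by symmetry, and in the extrapolation because the distances \<open>s / 2\<close> and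
  \<open>3 * s / 2\<close> meet the weights 3/2 and 1/2. When \<open>tm = t\<close> the
  extrapolation is just the value at \<open>t\<close>, and the Lipschitz bound gives first
  order.\<close>

lemma st_smooth_time_bounds:
  assumes f: "st_smooth L1 L2 T (Suc (Suc k)) f" and L: "0 < L1" "0 < L2" and T: "0 < T"
  shows "\<exists>M. time_bounded T M f"
proof -
  obtain g where g: "st_smooth L1 L2 T (Suc k) g"
    "\<And>t p. t \<in> {0..T} \<Longrightarrow> (f p has_real_derivative g p t) (at t within {0..T})"
    using st_smooth_partials[OF f T] by blast
  obtain g' where g': "st_smooth L1 L2 T k g'"
    "\<And>t p. t \<in> {0..T} \<Longrightarrow> (g p has_real_derivative g' p t) (at t within {0..T})"
    using st_smooth_partials[OF g(1) T] by blast
  obtain M0 where M0: "0 \<le> M0" "\<And>t p. t \<in> {0..T} \<Longrightarrow> \<bar>f p t\<bar> \<le> M0"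
    using st_smooth_bounded[OF f L] by blast
  obtain M1 where M1: "0 \<le> M1" "\<And>t p. t \<in> {0..T} \<Longrightarrow> \<bar>g p t\<bar> \<le> M1"
    using st_smooth_bounded[OF g(1) L] by blast
  obtain M2 where M2: "0 \<le> M2" "\<And>t p. t \<in> {0..T} \<Longrightarrow> \<bar>g' p t\<bar> \<le> M2"
    using st_smooth_bounded[OF g'(1) L] by blast
  have T1: "\<bar>f p z - f p w\<bar> \<le> M1 * \<bar>z - w\<bar>" if "w \<in> {0..T}" "z \<in> {0..T}" for p z w
    by (rule taylor_1[OF convex_closed_interval that g(2) M1(2)])
  have T2: "\<bar>f p z - f p w - g p w * (z - w)\<bar> \<le> M2 * \<bar>z - w\<bar>\<^sup>2" if "w \<in> {0..T}" "z \<in> {0..T}" for p z w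
    by (rule taylor_2[OF convex_closed_interval that g(2) g'(2) M2(2)])
  define M where "M = M0 + M1 + 2 * M2"
  have M: "M0 \<le> M" "M1 \<le> M" "2 * M2 \<le> M" "0 \<le> M" using M0 M1 M2 by (auto simp: M_def)
  have "\<bar>f p t\<bar> \<le> M \<and> \<bar>f p (t + s)\<bar> \<le> M \<and> \<bar>f p (t + s / 2)\<bar> \<le> M \<and> \<bar>f p (t + s) - f p t\<bar> \<le> M * s \<and>
     \<bar>f p t + f p (t + s) - 2 * f p (t + s / 2)\<bar> \<le> M * s\<^sup>2 \<and>
     \<bar>3 / 2 * f p t - 1 / 2 * f p tm - f p (t + s / 2)\<bar> \<le> M * \<rho>"
    if st: "step_times T t s tm \<rho>" for t s tm \<rho> p
  proof -
    note mem = step_times_mem[OF st]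
    have s: "0 < s" using st by (simp add: step_times_def)
    have 1: "\<bar>f p t\<bar> \<le> M" "\<bar>f p (t + s)\<bar> \<le> M" "\<bar>f p (t + s / 2)\<bar> \<le> M"
      using mem M0(2)[of _ p] M(1) order_trans by blast+
    have "M1 * s \<le> M * s" using M s by (intro mult_right_mono) auto
    moreover have "\<bar>f p (t + s) - f p t\<bar> \<le> M1 * s" using T1[OF mem(1,2), of p] s by simp
    ultimately have 2: "\<bar>f p (t + s) - f p t\<bar> \<le> M * s" by (rule order_trans[rotated])
    have R1: "\<bar>f p t - f p (t + s / 2) + g p (t + s / 2) * s / 2\<bar> \<le> M2 * s\<^sup>2 / 4"
      using T2[OF mem(3,1), of p] by (simp add: power2_eq_square)
    have R2: "\<bar>f p (t + s) - f p (t + s / 2) - g p (t + s / 2) * s / 2\<bar> \<le> M2 * s\<^sup>2 / 4"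
      using T2[OF mem(3,2), of p] by (simp add: power2_eq_square)
    have M2s: "0 \<le> M2 * s\<^sup>2" "2 * (M2 * s\<^sup>2) \<le> M * s\<^sup>2"
      using M2 M mult_right_mono[of "2 * M2" M "s\<^sup>2"] by auto
    have 3: "\<bar>f p t + f p (t + s) - 2 * f p (t + s / 2)\<bar> \<le> M * s\<^sup>2"
      using R1 R2 M2s by linarith
    have 4: "\<bar>3 / 2 * f p t - 1 / 2 * f p tm - f p (t + s / 2)\<bar> \<le> M * \<rho>"
    proof (cases "tm = t \<and> \<rho> = s")
      case True
      have "M1 * (s / 2) \<le> M * s" using M s M1 by (intro mult_mono) auto
      moreover have "\<bar>f p t - f p (t + s / 2)\<bar> \<le> M1 * (s / 2)" using T1[OF mem(3,1), of p] s by simp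
      ultimately have "\<bar>f p t - f p (t + s / 2)\<bar> \<le> M * s" by linarith
      moreover have "3 / 2 * f p t - 1 / 2 * f p tm = f p t" using True by simp
      ultimately show ?thesis using True by (simp only:)
    next
      case False
      then have F: "tm = t - s" "\<rho> = s\<^sup>2" using st by (auto simp: step_times_def)
      have "\<bar>f p (t - s) - f p (t + s / 2) + g p (t + s / 2) * s / 2 * 3\<bar> \<le> 9 * (M2 * s\<^sup>2 / 4)"
        using T2[OF mem(3,4), of p] s by (simp add: F power2_eq_square field_simps)
      then show ?thesis using R1 M2s unfolding F by linarith
    qed
    show ?thesis using 1 2 3 4 by blast
  qed
  then show ?thesis using M(4) unfolding time_bounded_def by blast
qed

text \<open>In the difference of the two expansions about the midpoint the quadratic terms cancel.
  \<open>ft\<close> is supplied from outside, since it will be the right-hand side of the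
  differential equation; uniqueness of the derivative identifies it with the smooth time
  derivative.\<close>

lemma time_derivative_midpoint:
  assumes f: "st_smooth L1 L2 T (Suc (Suc (Suc k))) f" and L: "0 < L1" "0 < L2" and T: "0 < T"
    and ft: "\<And>t p. t \<in> {0..T} \<Longrightarrow> (f p has_real_derivative ft p t) (at t within {0..T})"
  shows "\<exists>M\<ge>0. \<forall>t s tm \<rho> p. step_times T t s tm \<rho> \<longrightarrow>
     \<bar>(f p (t + s) - f p t) / s - ft p (t + s / 2)\<bar> \<le> M * s\<^sup>2"
proof -
  obtain g where g: "st_smooth L1 L2 T (Suc (Suc k)) g"
    "\<And>t p. t \<in> {0..T} \<Longrightarrow> (f p has_real_derivative g p t) (at t within {0..T})"
    using st_smooth_partials[OF f T] by blast
  obtain g' where g': "st_smooth L1 L2 T (Suc k) g'"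
    "\<And>t p. t \<in> {0..T} \<Longrightarrow> (g p has_real_derivative g' p t) (at t within {0..T})"
    using st_smooth_partials[OF g(1) T] by blast
  obtain g'' where g'': "st_smooth L1 L2 T k g''"
    "\<And>t p. t \<in> {0..T} \<Longrightarrow> (g' p has_real_derivative g'' p t) (at t within {0..T})"
    using st_smooth_partials[OF g'(1) T] by blast
  obtain M where M: "0 \<le> M" "\<And>t p. t \<in> {0..T} \<Longrightarrow> \<bar>g'' p t\<bar> \<le> M"
    using st_smooth_bounded[OF g''(1) L] by blast
  have gft: "g p t = ft p t" if "t \<in> {0..T}" for p t
    using vector_derivative_unique_within_closed_interval[of 0 T t "f p" "g p t" "ft p t"] g(2)[OF that, of p] ft[OF that, of p] T that
    by (simp add: has_real_derivative_iff_has_vector_derivative cbox_interval)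
  have T3: "\<bar>f p z - f p w - g p w * (z - w) - g' p w * (z - w)\<^sup>2 / 2\<bar> \<le> M * \<bar>z - w\<bar> ^ 3 / 2"
    if "w \<in> {0..T}" "z \<in> {0..T}" for p z w
    by (rule taylor_3[OF convex_closed_interval that g(2) g'(2) g''(2) M(2)])
  have "\<bar>(f p (t + s) - f p t) / s - ft p (t + s / 2)\<bar> \<le> M * s\<^sup>2"
    if st: "step_times T t s tm \<rho>" for t s tm \<rho> p
  proof -
    note mem = step_times_mem[OF st]
    have s: "0 < s" using st by (simp add: step_times_def)
    let ?q = "g' p (t + s / 2) * (s / 2)\<^sup>2 / 2" and ?B = "M * (s / 2) ^ 3 / 2"
    have R1: "\<bar>f p t - f p (t + s / 2) + g p (t + s / 2) * (s / 2) - ?q\<bar> \<le> ?B"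
      using T3[OF mem(3,1), of p] s by simp
    have R2: "\<bar>f p (t + s) - f p (t + s / 2) - g p (t + s / 2) * (s / 2) - ?q\<bar> \<le> ?B"
      using T3[OF mem(3,2), of p] s by simp
    have "\<bar>(f p (t + s) - f p (t + s / 2) - g p (t + s / 2) * (s / 2) - ?q)
       - (f p t - f p (t + s / 2) + g p (t + s / 2) * (s / 2) - ?q)\<bar> \<le> ?B + ?B"
      by (rule order_trans[OF abs_triangle_ineq4 add_mono[OF R2 R1]])
    then have "\<bar>f p (t + s) - f p t - g p (t + s / 2) * s\<bar> \<le> ?B + ?B" by (simp add: algebra_simps)
    also have "\<dots> \<le> M * s ^ 3" using M s by (simp add: power3_eq_cube)
    finally have "\<bar>f p (t + s) - f p t - g p (t + s / 2) * s\<bar> / s \<le> M * s ^ 3 / s"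
      using s by (intro divide_right_mono) auto
    moreover have "(f p (t + s) - f p t) / s - ft p (t + s / 2) = (f p (t + s) - f p t - g p (t + s / 2) * s) / s"
      using s gft[OF mem(3), of p] by (simp add: diff_divide_distrib)
    ultimately show ?thesis using s by (simp add: abs_divide power2_eq_square power3_eq_cube)
  qed
  then show ?thesis using M(1) by blast
qed

section \<open>Discrete Laplacian of the time defects\<close>

lemma dlap_combination:
  assumes dx: "\<And>t x y. t \<in> I \<Longrightarrow> ((\<lambda>r. f (r, y) t) has_real_derivative fx (x, y) t) (at x)"
      "\<And>t x y. t \<in> I \<Longrightarrow> ((\<lambda>r. fx (r, y) t) has_real_derivative fxx (x, y) t) (at x)"
    and dy: "\<And>t x y. t \<in> I \<Longrightarrow> ((\<lambda>r. f (x, r) t) has_real_derivative fy (x, y) t) (at y)"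
      "\<And>t x y. t \<in> I \<Longrightarrow> ((\<lambda>r. fy (x, r) t) has_real_derivative fyy (x, y) t) (at y)"
    and I: "t1 \<in> I" "t2 \<in> I" "t3 \<in> I" and h: "0 < h"
    and N: "\<And>p. \<bar>\<alpha> * fxx p t1 + \<beta> * fxx p t2 + \<delta> * fxx p t3\<bar> \<le> N"
      "\<And>p. \<bar>\<alpha> * fyy p t1 + \<beta> * fyy p t2 + \<delta> * fyy p t3\<bar> \<le> N"
  shows "\<bar>dlap h (\<lambda>z. \<alpha> * f z t1 + \<beta> * f z t2 + \<delta> * f z t3) p\<bar> \<le> 4 * N"
  by (rule dlap_le[where
        qx = "\<lambda>z. \<alpha> * fx z t1 + \<beta> * fx z t2 + \<delta> * fx z t3" and
        qxx = "\<lambda>z. \<alpha> * fxx z t1 + \<beta> * fxx z t2 + \<delta> * fxx z t3" and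
        qy = "\<lambda>z. \<alpha> * fy z t1 + \<beta> * fy z t2 + \<delta> * fy z t3" and
        qyy = "\<lambda>z. \<alpha> * fyy z t1 + \<beta> * fyy z t2 + \<delta> * fyy z t3", OF _ _ N(1) _ _ N(2) h])
    (intro DERIV_add DERIV_cmult dx dy I)+

text \<open>Splits \<open>eta\<close> into the cube of the mean and a correction quadratic in the
  increment, so that both the correction and the defect of the mean are of order s^2.\<close>

lemma eta_eq_midpoint: "eta a b = ((a + b) / 2) ^ 3 + ((b - a) / 2)\<^sup>2 * ((a + b) / 2)"
  unfolding eta_def by (simp add: field_simps power2_eq_square power3_eq_cube)

lemma eta_defect_derivative1:
  assumes "(u has_real_derivative u1) (at x)" "(d has_real_derivative d1) (at x)" "(v has_real_derivative v1) (at x)"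
  shows "((\<lambda>r. u r ^ 3 + (d r)\<^sup>2 * u r - v r ^ 3) has_real_derivative
     3 * (u x)\<^sup>2 * u1 + (2 * d x * d1 * u x + (d x)\<^sup>2 * u1) - 3 * (v x)\<^sup>2 * v1) (at x)"
  by (rule derivative_eq_intros assms refl)+ (simp add: power2_eq_square algebra_simps)

text \<open>The result is grouped so that smallness is visible: the terms in \<open>u\<close> and
  \<open>v\<close> pair up as differences of nearby quantities, and every other term contains two
  factors from \<open>d\<close> and its derivatives.\<close>

lemma eta_defect_derivative2:
  assumes "(u has_real_derivative u1 x) (at x)" "(d has_real_derivative d1 x) (at x)" "(v has_real_derivative v1 x) (at x)"
    and "(u1 has_real_derivative u2) (at x)" "(d1 has_real_derivative d2) (at x)" "(v1 has_real_derivative v2) (at x)"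
  shows "((\<lambda>r. 3 * (u r)\<^sup>2 * u1 r + (2 * d r * d1 r * u r + (d r)\<^sup>2 * u1 r) - 3 * (v r)\<^sup>2 * v1 r) has_real_derivative
     3 * ((u x)\<^sup>2 * u2 - (v x)\<^sup>2 * v2) + 6 * (u x * (u1 x)\<^sup>2 - v x * (v1 x)\<^sup>2)
      + (2 * (d1 x)\<^sup>2 * u x + 2 * d x * d2 * u x + 4 * d x * d1 x * u1 x + (d x)\<^sup>2 * u2)) (at x)"
  by (rule derivative_eq_intros assms refl)+ (simp add: power2_eq_square algebra_simps)

lemma abs_mult3_le:
  fixes x y z :: real
  assumes "\<bar>x\<bar> \<le> a" "\<bar>y\<bar> \<le> b" "\<bar>z\<bar> \<le> c"
  shows "\<bar>x * y * z\<bar> \<le> a * b * c"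
proof -
  have "0 \<le> a" "0 \<le> b" "0 \<le> c" using assms by linarith+
  then show ?thesis unfolding abs_mult using assms by (intro mult_mono) auto
qed

text \<open>Differences of products are telescoped, so that each summand has one factor of size
  \<open>M * s\<^sup>2\<close>, or two of size \<open>M * s\<close>, and is at most
  \<open>M ^ 3 * s\<^sup>2\<close>. Counting them with their coefficients gives 3 * 3 + 6 * 3 + 9 =
  36.\<close>

lemma eta_defect_bound:
  fixes u0 u1 u2 v0 v1 v2 d0 d1 d2 M s :: real
  assumes u: "\<bar>u0\<bar> \<le> M" "\<bar>u1\<bar> \<le> M" "\<bar>u2\<bar> \<le> M" and v: "\<bar>v0\<bar> \<le> M" "\<bar>v1\<bar> \<le> M" "\<bar>v2\<bar> \<le> M"
    and w: "\<bar>u0 - v0\<bar> \<le> M * s\<^sup>2" "\<bar>u1 - v1\<bar> \<le> M * s\<^sup>2" "\<bar>u2 - v2\<bar> \<le> M * s\<^sup>2"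
    and d: "\<bar>d0\<bar> \<le> M * s" "\<bar>d1\<bar> \<le> M * s" "\<bar>d2\<bar> \<le> M * s"
  shows "\<bar>3 * (u0\<^sup>2 * u2 - v0\<^sup>2 * v2) + 6 * (u0 * u1\<^sup>2 - v0 * v1\<^sup>2)
      + (2 * d1\<^sup>2 * u0 + 2 * d0 * d2 * u0 + 4 * d0 * d1 * u1 + d0\<^sup>2 * u2)\<bar> \<le> 36 * M ^ 3 * s\<^sup>2"
proof -
  define B where "B = M ^ 3 * s\<^sup>2"
  have B: "M * s\<^sup>2 * M * M = B" "M * M * (M * s\<^sup>2) = B" "M * s * (M * s) * M = B" "M * (M * s\<^sup>2) * M = B"
    by (simp_all add: B_def power2_eq_square power3_eq_cube)
  have t: "\<bar>(u0 - v0) * u0 * u2\<bar> \<le> B" "\<bar>(u0 - v0) * v0 * u2\<bar> \<le> B" "\<bar>v0 * v0 * (u2 - v2)\<bar> \<le> B"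
    "\<bar>(u0 - v0) * u1 * u1\<bar> \<le> B" "\<bar>v0 * (u1 - v1) * u1\<bar> \<le> B" "\<bar>v0 * (u1 - v1) * v1\<bar> \<le> B"
    "\<bar>d1 * d1 * u0\<bar> \<le> B" "\<bar>d0 * d2 * u0\<bar> \<le> B" "\<bar>d0 * d1 * u1\<bar> \<le> B" "\<bar>d0 * d0 * u2\<bar> \<le> B"
    using abs_mult3_le[OF w(1) u(1) u(3)] abs_mult3_le[OF w(1) v(1) u(3)] abs_mult3_le[OF v(1) v(1) w(3)]
      abs_mult3_le[OF w(1) u(2) u(2)] abs_mult3_le[OF v(1) w(2) u(2)] abs_mult3_le[OF v(1) w(2) v(2)]
      abs_mult3_le[OF d(2) d(2) u(1)] abs_mult3_le[OF d(1) d(3) u(1)] abs_mult3_le[OF d(1) d(2) u(2)]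
      abs_mult3_le[OF d(1) d(1) u(3)] unfolding B .
  have gen: "\<bar>3 * (a + b + c) + 6 * (e + f + g) + (2 * k + 2 * l + 4 * m + n)\<bar> \<le> 36 * B"
    if "\<bar>a\<bar> \<le> B" "\<bar>b\<bar> \<le> B" "\<bar>c\<bar> \<le> B" "\<bar>e\<bar> \<le> B" "\<bar>f\<bar> \<le> B" "\<bar>g\<bar> \<le> B"
      "\<bar>k\<bar> \<le> B" "\<bar>l\<bar> \<le> B" "\<bar>m\<bar> \<le> B" "\<bar>n\<bar> \<le> B" for a b c e f g k l m n
  proof -
    have 1: "\<bar>x + y + z\<bar> \<le> 3 * B" if "\<bar>x\<bar> \<le> B" "\<bar>y\<bar> \<le> B" "\<bar>z\<bar> \<le> B" for x y z
      using that by linarith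
    have 2: "\<bar>2 * k + 2 * l + 4 * m + n\<bar> \<le> 9 * B" using that(7-10) by linarith
    have "\<bar>3 * x + 6 * y + z\<bar> \<le> 36 * B" if "\<bar>x\<bar> \<le> 3 * B" "\<bar>y\<bar> \<le> 3 * B" "\<bar>z\<bar> \<le> 9 * B" for x y z
      using that by linarith
    from this[OF 1[OF that(1-3)] 1[OF that(4-6)] 2] show ?thesis .
  qed
  have "3 * (u0\<^sup>2 * u2 - v0\<^sup>2 * v2) + 6 * (u0 * u1\<^sup>2 - v0 * v1\<^sup>2)
      + (2 * d1\<^sup>2 * u0 + 2 * d0 * d2 * u0 + 4 * d0 * d1 * u1 + d0\<^sup>2 * u2)
    = 3 * ((u0 - v0) * u0 * u2 + (u0 - v0) * v0 * u2 + v0 * v0 * (u2 - v2))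
      + 6 * ((u0 - v0) * u1 * u1 + v0 * (u1 - v1) * u1 + v0 * (u1 - v1) * v1)
      + (2 * (d1 * d1 * u0) + 2 * (d0 * d2 * u0) + 4 * (d0 * d1 * u1) + d0 * d0 * u2)"
    by (simp add: power2_eq_square algebra_simps)
  also have "\<bar>\<dots>\<bar> \<le> 36 * B" by (rule gen[OF t])
  finally show ?thesis by (simp add: B_def)
qed

lemma dlap_eta_defect_aux:
  fixes u d v :: "real \<times> real \<Rightarrow> real"
  assumes u: "\<And>x y. ((\<lambda>r. u (r, y)) has_real_derivative ux (x, y)) (at x)"
      "\<And>x y. ((\<lambda>r. ux (r, y)) has_real_derivative uxx (x, y)) (at x)"
      "\<And>x y. ((\<lambda>r. u (x, r)) has_real_derivative uy (x, y)) (at y)"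
      "\<And>x y. ((\<lambda>r. uy (x, r)) has_real_derivative uyy (x, y)) (at y)"
    and d: "\<And>x y. ((\<lambda>r. d (r, y)) has_real_derivative dx (x, y)) (at x)"
      "\<And>x y. ((\<lambda>r. dx (r, y)) has_real_derivative dxx (x, y)) (at x)"
      "\<And>x y. ((\<lambda>r. d (x, r)) has_real_derivative dy (x, y)) (at y)"
      "\<And>x y. ((\<lambda>r. dy (x, r)) has_real_derivative dyy (x, y)) (at y)"
    and v: "\<And>x y. ((\<lambda>r. v (r, y)) has_real_derivative vx (x, y)) (at x)"
      "\<And>x y. ((\<lambda>r. vx (r, y)) has_real_derivative vxx (x, y)) (at x)"
      "\<And>x y. ((\<lambda>r. v (x, r)) has_real_derivative vy (x, y)) (at y)"
      "\<And>x y. ((\<lambda>r. vy (x, r)) has_real_derivative vyy (x, y)) (at y)"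
    and h: "0 < h"
    and B: "\<And>z. \<bar>u z\<bar> \<le> M" "\<And>z. \<bar>ux z\<bar> \<le> M" "\<And>z. \<bar>uxx z\<bar> \<le> M" "\<And>z. \<bar>uy z\<bar> \<le> M" "\<And>z. \<bar>uyy z\<bar> \<le> M"
      "\<And>z. \<bar>v z\<bar> \<le> M" "\<And>z. \<bar>vx z\<bar> \<le> M" "\<And>z. \<bar>vxx z\<bar> \<le> M" "\<And>z. \<bar>vy z\<bar> \<le> M" "\<And>z. \<bar>vyy z\<bar> \<le> M"
      "\<And>z. \<bar>u z - v z\<bar> \<le> M * s\<^sup>2" "\<And>z. \<bar>ux z - vx z\<bar> \<le> M * s\<^sup>2" "\<And>z. \<bar>uxx z - vxx z\<bar> \<le> M * s\<^sup>2"
      "\<And>z. \<bar>uy z - vy z\<bar> \<le> M * s\<^sup>2" "\<And>z. \<bar>uyy z - vyy z\<bar> \<le> M * s\<^sup>2"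
      "\<And>z. \<bar>d z\<bar> \<le> M * s" "\<And>z. \<bar>dx z\<bar> \<le> M * s" "\<And>z. \<bar>dxx z\<bar> \<le> M * s" "\<And>z. \<bar>dy z\<bar> \<le> M * s" "\<And>z. \<bar>dyy z\<bar> \<le> M * s"
  shows "\<bar>dlap h (\<lambda>z. u z ^ 3 + (d z)\<^sup>2 * u z - v z ^ 3) p\<bar> \<le> 4 * (36 * M ^ 3 * s\<^sup>2)"
proof -
  let ?q = "\<lambda>z. u z ^ 3 + (d z)\<^sup>2 * u z - v z ^ 3"
  let ?q1 = "\<lambda>u1 d1 v1 z. 3 * (u z)\<^sup>2 * u1 z + (2 * d z * d1 z * u z + (d z)\<^sup>2 * u1 z) - 3 * (v z)\<^sup>2 * v1 z"
  let ?q2 = "\<lambda>u1 u2 d1 d2 v1 v2 z. 3 * ((u z)\<^sup>2 * u2 z - (v z)\<^sup>2 * v2 z) + 6 * (u z * (u1 z)\<^sup>2 - v z * (v1 z)\<^sup>2)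
        + (2 * (d1 z)\<^sup>2 * u z + 2 * d z * d2 z * u z + 4 * d z * d1 z * u1 z + (d z)\<^sup>2 * u2 z)"
  have x1: "((\<lambda>r. ?q (r, y)) has_real_derivative ?q1 ux dx vx (x, y)) (at x)" for x y
    by (rule eta_defect_derivative1[OF u(1) d(1) v(1)])
  have y1: "((\<lambda>r. ?q (x, r)) has_real_derivative ?q1 uy dy vy (x, y)) (at y)" for x y
    by (rule eta_defect_derivative1[OF u(3) d(3) v(3)])
  have x2: "((\<lambda>r. ?q1 ux dx vx (r, y)) has_real_derivative ?q2 ux uxx dx dxx vx vxx (x, y)) (at x)" for x y
    by (rule eta_defect_derivative2[where u = "\<lambda>r. u (r, y)" and d = "\<lambda>r. d (r, y)" and v = "\<lambda>r. v (r, y)"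
          and ?u1.0 = "\<lambda>r. ux (r, y)" and ?d1.0 = "\<lambda>r. dx (r, y)" and ?v1.0 = "\<lambda>r. vx (r, y)",
          OF u(1) d(1) v(1) u(2) d(2) v(2)])
  have y2: "((\<lambda>r. ?q1 uy dy vy (x, r)) has_real_derivative ?q2 uy uyy dy dyy vy vyy (x, y)) (at y)" for x y
    by (rule eta_defect_derivative2[where u = "\<lambda>r. u (x, r)" and d = "\<lambda>r. d (x, r)" and v = "\<lambda>r. v (x, r)"
          and ?u1.0 = "\<lambda>r. uy (x, r)" and ?d1.0 = "\<lambda>r. dy (x, r)" and ?v1.0 = "\<lambda>r. vy (x, r)",
          OF u(3) d(3) v(3) u(4) d(4) v(4)])
  have bx: "\<bar>?q2 ux uxx dx dxx vx vxx z\<bar> \<le> 36 * M ^ 3 * s\<^sup>2" for z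
    by (rule eta_defect_bound[OF B(1,2,3,6,7,8,11,12,13,16,17,18)[of z]])
  have by': "\<bar>?q2 uy uyy dy dyy vy vyy z\<bar> \<le> 36 * M ^ 3 * s\<^sup>2" for z
    by (rule eta_defect_bound[OF B(1,4,5,6,9,10,11,14,15,16,19,20)[of z]])
  show ?thesis
    by (rule dlap_le[where qx = "?q1 ux dx vx" and qy = "?q1 uy dy vy" and
      qxx = "?q2 ux uxx dx dxx vx vxx" and qyy = "?q2 uy uyy dy dyy vy vyy", OF x1 x2 bx y1 y2 by' h])
qed

lemma dlap_eta_defect:
  fixes f :: "real \<times> real \<Rightarrow> real \<Rightarrow> real"
  assumes dx: "\<And>t x y. t \<in> I \<Longrightarrow> ((\<lambda>r. f (r, y) t) has_real_derivative fx (x, y) t) (at x)"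
      "\<And>t x y. t \<in> I \<Longrightarrow> ((\<lambda>r. fx (r, y) t) has_real_derivative fxx (x, y) t) (at x)"
    and dy: "\<And>t x y. t \<in> I \<Longrightarrow> ((\<lambda>r. f (x, r) t) has_real_derivative fy (x, y) t) (at y)"
      "\<And>t x y. t \<in> I \<Longrightarrow> ((\<lambda>r. fy (x, r) t) has_real_derivative fyy (x, y) t) (at y)"
    and I: "a \<in> I" "b \<in> I" "c \<in> I" and h: "0 < h" and s: "0 < s"
    and M: "\<And>g p. g \<in> {f, fx, fxx, fy, fyy} \<Longrightarrow> \<bar>g p a\<bar> \<le> M \<and> \<bar>g p b\<bar> \<le> M \<and> \<bar>g p c\<bar> \<le> M \<and>
      \<bar>g p b - g p a\<bar> \<le> M * s \<and> \<bar>g p a + g p b - 2 * g p c\<bar> \<le> M * s\<^sup>2"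
  shows "\<bar>dlap h (\<lambda>z. eta (f z a) (f z b) - f z c ^ 3) p\<bar> \<le> 144 * M ^ 3 * s\<^sup>2"
proof -
  \<comment> \<open>Mean, half increment and midpoint value in time. These operations commute with
    space derivatives, so applying them to \<open>fx\<close>, \<open>fxx\<close>, \<open>fy\<close>,
    \<open>fyy\<close> gives the derivatives required below.\<close>
  define u where "u = (\<lambda>g z. ((g :: real \<times> real \<Rightarrow> real \<Rightarrow> real) z a + g z b) / 2)"
  define d where "d = (\<lambda>g z. ((g :: real \<times> real \<Rightarrow> real \<Rightarrow> real) z b - g z a) / 2)"
  define v where "v = (\<lambda>g z. (g :: real \<times> real \<Rightarrow> real \<Rightarrow> real) z c)"
  have bounds: "\<bar>u g z\<bar> \<le> M" "\<bar>v g z\<bar> \<le> M" "\<bar>u g z - v g z\<bar> \<le> M * s\<^sup>2" "\<bar>d g z\<bar> \<le> M * s"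
    if g: "g \<in> {f, fx, fxx, fy, fyy}" for g z
  proof -
    have B: "\<bar>g z a\<bar> \<le> M" "\<bar>g z b\<bar> \<le> M" "\<bar>g z c\<bar> \<le> M" "\<bar>g z b - g z a\<bar> \<le> M * s"
      "\<bar>g z a + g z b - 2 * g z c\<bar> \<le> M * s\<^sup>2" using M[OF g, of z] by blast+
    have half: "\<bar>x\<bar> / 2 \<le> \<bar>x\<bar>" for x :: real by simp
    have "\<bar>g z a + g z b\<bar> \<le> M + M" by (rule order_trans[OF abs_triangle_ineq add_mono[OF B(1,2)]])
    then show "\<bar>u g z\<bar> \<le> M" by (simp add: u_def)
    show "\<bar>v g z\<bar> \<le> M" unfolding v_def by (rule B)
    have "u g z - v g z = (g z a + g z b - 2 * g z c) / 2" by (simp add: u_def v_def field_simps)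
    then have "\<bar>u g z - v g z\<bar> = \<bar>g z a + g z b - 2 * g z c\<bar> / 2" by (simp only: abs_divide abs_numeral)
    then show "\<bar>u g z - v g z\<bar> \<le> M * s\<^sup>2" using order_trans[OF half B(5)] by (simp only:)
    have "\<bar>d g z\<bar> = \<bar>g z b - g z a\<bar> / 2" by (simp add: d_def)
    then show "\<bar>d g z\<bar> \<le> M * s" using order_trans[OF half B(4)] by (simp only:)
  qed
  have mem: "f \<in> {f, fx, fxx, fy, fyy}" "fx \<in> {f, fx, fxx, fy, fyy}" "fxx \<in> {f, fx, fxx, fy, fyy}"
    "fy \<in> {f, fx, fxx, fy, fyy}" "fyy \<in> {f, fx, fxx, fy, fyy}" by simp_all
  have "\<bar>dlap h (\<lambda>z. u f z ^ 3 + (d f z)\<^sup>2 * u f z - v f z ^ 3) p\<bar> \<le> 4 * (36 * M ^ 3 * s\<^sup>2)"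
    by (rule dlap_eta_defect_aux[where ux = "u fx" and uxx = "u fxx" and uy = "u fy" and uyy = "u fyy"
        and dx = "d fx" and dxx = "d fxx" and dy = "d fy" and dyy = "d fyy"
        and vx = "v fx" and vxx = "v fxx" and vy = "v fy" and vyy = "v fyy",
        OF _ _ _ _ _ _ _ _ _ _ _ _ h bounds(1)[OF mem(1)] bounds(1)[OF mem(2)] bounds(1)[OF mem(3)] bounds(1)[OF mem(4)] bounds(1)[OF mem(5)]
        bounds(2)[OF mem(1)] bounds(2)[OF mem(2)] bounds(2)[OF mem(3)] bounds(2)[OF mem(4)] bounds(2)[OF mem(5)]
        bounds(3)[OF mem(1)] bounds(3)[OF mem(2)] bounds(3)[OF mem(3)] bounds(3)[OF mem(4)] bounds(3)[OF mem(5)]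
        bounds(4)[OF mem(1)] bounds(4)[OF mem(2)] bounds(4)[OF mem(3)] bounds(4)[OF mem(4)] bounds(4)[OF mem(5)]])
      (unfold u_def d_def v_def, (intro DERIV_cdivide DERIV_add DERIV_diff dx dy I)+)
  moreover have "(\<lambda>z. eta (f z a) (f z b) - f z c ^ 3) = (\<lambda>z. u f z ^ 3 + (d f z)\<^sup>2 * u f z - v f z ^ 3)"
    unfolding eta_eq_midpoint u_def d_def v_def ..
  ultimately show ?thesis by simp
qed

text \<open>Space derivatives of a defect of \<open>f\<close> are again defects, now of
  \<open>fx\<close>, \<open>fxx\<close>, \<open>fy\<close>, \<open>fyy\<close>; hence the time
  estimates for these functions transfer to the discrete Laplacian uniformly in
  \<open>h\<close>.\<close>

lemma st_smooth_dlap_bounds: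
  assumes f: "st_smooth L1 L2 T (Suc (Suc (Suc (Suc k)))) f" and L: "0 < L1" "0 < L2" and T: "0 < T"
  shows "\<exists>M\<ge>0. \<forall>t s tm \<rho> h p. step_times T t s tm \<rho> \<longrightarrow> 0 < h \<longrightarrow>
     \<bar>dlap h (\<lambda>z. f z (t + s / 2)) p\<bar> \<le> M \<and>
     \<bar>dlap h (\<lambda>z. f z t + f z (t + s) - 2 * f z (t + s / 2)) p\<bar> \<le> M * s\<^sup>2 \<and>
     \<bar>dlap h (\<lambda>z. 3 / 2 * f z t - 1 / 2 * f z tm - f z (t + s / 2)) p\<bar> \<le> M * \<rho> \<and>
     \<bar>dlap h (\<lambda>z. eta (f z t) (f z (t + s)) - f z (t + s / 2) ^ 3) p\<bar> \<le> M * s\<^sup>2"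
    (is "\<exists>M\<ge>0. \<forall>t s tm \<rho> h p. _ \<longrightarrow> _ \<longrightarrow> ?P M t s tm \<rho> h p")
proof -
  obtain fx fy where fx: "st_smooth L1 L2 T (Suc (Suc (Suc k))) fx"
      "\<And>t x y. t \<in> {0..T} \<Longrightarrow> ((\<lambda>r. f (r, y) t) has_real_derivative fx (x, y) t) (at x)"
    and fy: "st_smooth L1 L2 T (Suc (Suc (Suc k))) fy"
      "\<And>t x y. t \<in> {0..T} \<Longrightarrow> ((\<lambda>r. f (x, r) t) has_real_derivative fy (x, y) t) (at y)"
    using st_smooth_partials[OF f T] by blast
  obtain fxx where fxx: "st_smooth L1 L2 T (Suc (Suc k)) fxx"
      "\<And>t x y. t \<in> {0..T} \<Longrightarrow> ((\<lambda>r. fx (r, y) t) has_real_derivative fxx (x, y) t) (at x)"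
    using st_smooth_partials[OF fx(1) T] by blast
  obtain fyy where fyy: "st_smooth L1 L2 T (Suc (Suc k)) fyy"
      "\<And>t x y. t \<in> {0..T} \<Longrightarrow> ((\<lambda>r. fy (x, r) t) has_real_derivative fyy (x, y) t) (at y)"
    using st_smooth_partials[OF fy(1) T] by blast
  have f2: "st_smooth L1 L2 T (Suc (Suc k)) f" "st_smooth L1 L2 T (Suc (Suc k)) fx" "st_smooth L1 L2 T (Suc (Suc k)) fy"
    using f fx(1) fy(1) Ck_on_Suc_imp unfolding st_smooth_def by blast+
  obtain M1 where M1: "time_bounded T M1 f" using st_smooth_time_bounds[OF f2(1) L T] by blast
  obtain M2 where M2: "time_bounded T M2 fx" using st_smooth_time_bounds[OF f2(2) L T] by blast
  obtain M3 where M3: "time_bounded T M3 fxx" using st_smooth_time_bounds[OF fxx(1) L T] by blast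
  obtain M4 where M4: "time_bounded T M4 fy" using st_smooth_time_bounds[OF f2(3) L T] by blast
  obtain M5 where M5: "time_bounded T M5 fyy" using st_smooth_time_bounds[OF fyy(1) L T] by blast
  define M where "M = M1 + M2 + M3 + M4 + M5"
  have M0: "0 \<le> M1" "0 \<le> M2" "0 \<le> M3" "0 \<le> M4" "0 \<le> M5"
    using M1 M2 M3 M4 M5 by (simp_all add: time_bounded_def)
  then have M: "0 \<le> M" "M1 \<le> M" "M2 \<le> M" "M3 \<le> M" "M4 \<le> M" "M5 \<le> M" by (simp_all add: M_def)
  have MP: "time_bounded T M g" if "g \<in> {f, fx, fxx, fy, fyy}" for g
    using that time_bounded_mono[OF M1 M(2)] time_bounded_mono[OF M2 M(3)] time_bounded_mono[OF M3 M(4)]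
      time_bounded_mono[OF M4 M(5)] time_bounded_mono[OF M5 M(6)] by blast
  define N where "N = 4 * M + 144 * M ^ 3"
  have N: "4 * M \<le> N" "144 * M ^ 3 \<le> N" "0 \<le> N" using M(1) by (auto simp: N_def)
  have "?P N t s tm \<rho> h p"
    if st: "step_times T t s tm \<rho>" and h: "0 < h" for t s tm \<rho> h p
  proof -
    note mem = step_times_mem[OF st]
    have s: "0 < s" "0 \<le> \<rho>" using st by (auto simp: step_times_def)
    have B: "\<bar>g z t\<bar> \<le> M" "\<bar>g z (t + s)\<bar> \<le> M" "\<bar>g z (t + s / 2)\<bar> \<le> M" "\<bar>g z (t + s) - g z t\<bar> \<le> M * s"
      "\<bar>g z t + g z (t + s) - 2 * g z (t + s / 2)\<bar> \<le> M * s\<^sup>2"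
      "\<bar>3 / 2 * g z t - 1 / 2 * g z tm - g z (t + s / 2)\<bar> \<le> M * \<rho>" if "g \<in> {f, fx, fxx, fy, fyy}" for g z
      by (rule time_boundedD[OF MP[OF that] st])+
    have in_xx: "fxx \<in> {f, fx, fxx, fy, fyy}" "fyy \<in> {f, fx, fxx, fy, fyy}" by simp_all
    \<comment> \<open>The three uses choose the coefficients of the midpoint value, of the averaging
      defect and of the extrapolation defect.\<close>
    note C = dlap_combination[where I = "{0..T}", OF fx(2) fxx(2) fy(2) fyy(2) _ _ _ h]
    have "\<bar>dlap h (\<lambda>z. 0 * f z t + 0 * f z t + 1 * f z (t + s / 2)) p\<bar> \<le> 4 * M"
      by (rule C) (use mem B(3)[OF in_xx(1)] B(3)[OF in_xx(2)] in simp_all)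
    then have 1: "\<bar>dlap h (\<lambda>z. f z (t + s / 2)) p\<bar> \<le> N" using N by simp
    have "\<bar>dlap h (\<lambda>z. 1 * f z t + 1 * f z (t + s) + (-2) * f z (t + s / 2)) p\<bar> \<le> 4 * (M * s\<^sup>2)"
      by (rule C) (use mem B(5)[OF in_xx(1)] B(5)[OF in_xx(2)] in simp_all)
    then have "\<bar>dlap h (\<lambda>z. f z t + f z (t + s) - 2 * f z (t + s / 2)) p\<bar> \<le> (4 * M) * s\<^sup>2" by simp
    also have "\<dots> \<le> N * s\<^sup>2" using N by (intro mult_right_mono) auto
    finally have 2: "\<bar>dlap h (\<lambda>z. f z t + f z (t + s) - 2 * f z (t + s / 2)) p\<bar> \<le> N * s\<^sup>2" .
    have "\<bar>dlap h (\<lambda>z. 3 / 2 * f z t + (- 1 / 2) * f z tm + (-1) * f z (t + s / 2)) p\<bar> \<le> 4 * (M * \<rho>)"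
      by (rule C) (use mem B(6)[OF in_xx(1)] B(6)[OF in_xx(2)] in simp_all)
    then have "\<bar>dlap h (\<lambda>z. 3 / 2 * f z t - 1 / 2 * f z tm - f z (t + s / 2)) p\<bar> \<le> (4 * M) * \<rho>" by simp
    also have "\<dots> \<le> N * \<rho>" using N s by (intro mult_right_mono) auto
    finally have 3: "\<bar>dlap h (\<lambda>z. 3 / 2 * f z t - 1 / 2 * f z tm - f z (t + s / 2)) p\<bar> \<le> N * \<rho>" .
    have "\<bar>dlap h (\<lambda>z. eta (f z t) (f z (t + s)) - f z (t + s / 2) ^ 3) p\<bar> \<le> 144 * M ^ 3 * s\<^sup>2"
    proof (rule dlap_eta_defect[where I = "{0..T}", OF fx(2) fxx(2) fy(2) fyy(2) _ _ _ h s(1)])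
      show "\<bar>g z t\<bar> \<le> M \<and> \<bar>g z (t + s)\<bar> \<le> M \<and> \<bar>g z (t + s / 2)\<bar> \<le> M \<and>
        \<bar>g z (t + s) - g z t\<bar> \<le> M * s \<and> \<bar>g z t + g z (t + s) - 2 * g z (t + s / 2)\<bar> \<le> M * s\<^sup>2"
        if "g \<in> {f, fx, fxx, fy, fyy}" for g z using B(1-5)[OF that, of z] by blast
    qed (rule mem | assumption)+
    also have "\<dots> \<le> N * s\<^sup>2" using N by (intro mult_right_mono) auto
    finally show ?thesis using 1 2 3 by blast
  qed
  then show ?thesis using N(3) by blast
qed

section \<open>Second space derivatives and the discrete Laplacian\<close>

lemma laplacian_eqI:
  assumes "\<And>x y. ((\<lambda>r. q (r, y)) has_real_derivative qx (x, y)) (at x)"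
    and "\<And>x y. ((\<lambda>r. qx (r, y)) has_real_derivative qxx (x, y)) (at x)"
    and "\<And>x y. ((\<lambda>r. q (x, r)) has_real_derivative qy (x, y)) (at y)"
    and "\<And>x y. ((\<lambda>r. qy (x, r)) has_real_derivative qyy (x, y)) (at y)"
  shows "laplacian q p = qxx p + qyy p"
proof -
  obtain x y where p: "p = (x, y)" by (cases p)
  have "deriv (\<lambda>r. q (r, y)) = (\<lambda>r. qx (r, y))" "deriv (\<lambda>r. q (x, r)) = (\<lambda>r. qy (x, r))"
    by (rule ext, rule DERIV_imp_deriv, rule assms)+
  then show ?thesis
    using DERIV_imp_deriv[OF assms(2)] DERIV_imp_deriv[OF assms(4)] by (simp add: laplacian_def p)
qed

text \<open>The derivatives are carried as explicit functions because bounds, and in turn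
  derivatives, of them are needed; mixed derivatives do not enter the Laplacian.\<close>

definition second_partials :: "real \<Rightarrow> (real \<times> real \<Rightarrow> real \<Rightarrow> real) \<Rightarrow> (real \<times> real \<Rightarrow> real \<Rightarrow> real) \<Rightarrow>
    (real \<times> real \<Rightarrow> real \<Rightarrow> real) \<Rightarrow> (real \<times> real \<Rightarrow> real \<Rightarrow> real) \<Rightarrow> (real \<times> real \<Rightarrow> real \<Rightarrow> real) \<Rightarrow> bool" where
  "second_partials T f fx fxx fy fyy \<longleftrightarrow>
     (\<forall>t\<in>{0..T}. \<forall>x y. ((\<lambda>r. f (r, y) t) has_real_derivative fx (x, y) t) (at x)) \<and>
     (\<forall>t\<in>{0..T}. \<forall>x y. ((\<lambda>r. fx (r, y) t) has_real_derivative fxx (x, y) t) (at x)) \<and>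
     (\<forall>t\<in>{0..T}. \<forall>x y. ((\<lambda>r. f (x, r) t) has_real_derivative fy (x, y) t) (at y)) \<and>
     (\<forall>t\<in>{0..T}. \<forall>x y. ((\<lambda>r. fy (x, r) t) has_real_derivative fyy (x, y) t) (at y))"

lemma second_partialsD:
  assumes "second_partials T f fx fxx fy fyy" "t \<in> {0..T}"
  shows "((\<lambda>r. f (r, y) t) has_real_derivative fx (x, y) t) (at x)"
    "((\<lambda>r. fx (r, y) t) has_real_derivative fxx (x, y) t) (at x)"
    "((\<lambda>r. f (x, r) t) has_real_derivative fy (x, y) t) (at y)"
    "((\<lambda>r. fy (x, r) t) has_real_derivative fyy (x, y) t) (at y)"
  using assms unfolding second_partials_def by blast+

lemma st_smooth_second_partials:
  assumes f: "st_smooth L1 L2 T (Suc (Suc k)) f" and T: "0 < T"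
  shows "\<exists>fx fxx fy fyy. second_partials T f fx fxx fy fyy \<and> st_smooth L1 L2 T (Suc k) fx \<and>
    st_smooth L1 L2 T k fxx \<and> st_smooth L1 L2 T (Suc k) fy \<and> st_smooth L1 L2 T k fyy"
proof -
  obtain fx fy where fx: "st_smooth L1 L2 T (Suc k) fx"
      "\<And>t x y. t \<in> {0..T} \<Longrightarrow> ((\<lambda>r. f (r, y) t) has_real_derivative fx (x, y) t) (at x)"
    and fy: "st_smooth L1 L2 T (Suc k) fy"
      "\<And>t x y. t \<in> {0..T} \<Longrightarrow> ((\<lambda>r. f (x, r) t) has_real_derivative fy (x, y) t) (at y)"
    using st_smooth_partials[OF f T] by blast
  obtain fxx where fxx: "st_smooth L1 L2 T k fxx"
      "\<And>t x y. t \<in> {0..T} \<Longrightarrow> ((\<lambda>r. fx (r, y) t) has_real_derivative fxx (x, y) t) (at x)"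
    using st_smooth_partials[OF fx(1) T] by blast
  obtain fyy where fyy: "st_smooth L1 L2 T k fyy"
      "\<And>t x y. t \<in> {0..T} \<Longrightarrow> ((\<lambda>r. fy (x, r) t) has_real_derivative fyy (x, y) t) (at y)"
    using st_smooth_partials[OF fy(1) T] by blast
  have "second_partials T f fx fxx fy fyy"
    unfolding second_partials_def by (intro conjI ballI allI fx(2) fxx(2) fy(2) fyy(2))
  then show ?thesis using fx(1) fxx(1) fy(1) fyy(1) by (intro exI conjI)
qed

lemma st_smooth_continuous:
  assumes "st_smooth L1 L2 T k f" "t \<in> {0..T}"
  shows "continuous_on UNIV (\<lambda>z. f z t)"
proof -
  have "continuous_on (UNIV \<times> {0..T}) (\<lambda>(x, t). f x t)"
    using assms(1) Ck_on_imp_continuous_on unfolding st_smooth_def by blast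
  then have "continuous_on UNIV (\<lambda>z. (\<lambda>(x, t). f x t) (z, t))"
    using assms(2) by (intro continuous_on_compose2[where g = "\<lambda>(x, t). f x t" and f = "\<lambda>z. (z, t)" and s = UNIV])
      (auto intro: continuous_on_Pair continuous_on_id continuous_on_const)
  then show ?thesis by simp
qed

lemma st_smooth_periodic: "st_smooth L1 L2 T k f \<Longrightarrow> t \<in> {0..T} \<Longrightarrow> periodic_fun L1 L2 (\<lambda>z. f z t)"
  by (simp add: st_smooth_def)

lemma dlap_consistency:
  assumes f: "second_partials T f fx fxx fy fyy" and xx: "st_smooth L1 L2 T (Suc (Suc k)) fxx"
    and yy: "st_smooth L1 L2 T (Suc (Suc k)) fyy" and L: "0 < L1" "0 < L2" and T: "0 < T"
  shows "\<exists>M\<ge>0. \<forall>t\<in>{0..T}. \<forall>h>0. \<forall>p. \<bar>dlap h (\<lambda>z. f z t) p - (fxx p t + fyy p t)\<bar> \<le> M * h\<^sup>2"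
proof -
  obtain f3 f4 g g' where f4: "second_partials T fxx f3 f4 g g'" "st_smooth L1 L2 T k f4"
    using st_smooth_second_partials[OF xx T] by blast
  obtain g3 g4 e e' where g4: "second_partials T fyy e e' g3 g4" "st_smooth L1 L2 T k g4"
    using st_smooth_second_partials[OF yy T] by blast
  obtain M1 where M1: "0 \<le> M1" "\<And>t p. t \<in> {0..T} \<Longrightarrow> \<bar>f4 p t\<bar> \<le> M1"
    using st_smooth_bounded[OF f4(2) L] by blast
  obtain M2 where M2: "0 \<le> M2" "\<And>t p. t \<in> {0..T} \<Longrightarrow> \<bar>g4 p t\<bar> \<le> M2"
    using st_smooth_bounded[OF g4(2) L] by blast
  have "\<bar>dlap h (\<lambda>z. f z t) p - (fxx p t + fyy p t)\<bar> \<le> 2 * (M1 + M2) * h\<^sup>2"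
    if t: "t \<in> {0..T}" and h: "0 < h" for t h p
  proof -
    have b: "\<bar>f4 p t\<bar> \<le> M1 + M2" "\<bar>g4 p t\<bar> \<le> M1 + M2" for p
      using M1(1) M2(1) M1(2)[OF t, of p] M2(2)[OF t, of p] by linarith+
    show ?thesis
      by (rule dlap_derivative[where q = "\<lambda>z. f z t" and qx = "\<lambda>z. fx z t" and qxx = "\<lambda>z. fxx z t"
          and ?qx3.0 = "\<lambda>z. f3 z t" and ?qx4.0 = "\<lambda>z. f4 z t" and qy = "\<lambda>z. fy z t" and qyy = "\<lambda>z. fyy z t"
          and ?qy3.0 = "\<lambda>z. g3 z t" and ?qy4.0 = "\<lambda>z. g4 z t",
          OF second_partialsD(1,2)[OF f t] second_partialsD(1,2)[OF f4(1) t] b(1)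
             second_partialsD(3,4)[OF f t] second_partialsD(3,4)[OF g4(1) t] b(2) h])
  qed
  then show ?thesis using M1(1) M2(1) by (intro exI[of _ "2 * (M1 + M2)"]) auto
qed

section \<open>Quadrature of the convolution\<close>

lemma derivative_reflect:
  fixes g :: "real \<Rightarrow> real"
  assumes "(g has_real_derivative D) (at (a - x))"
  shows "((\<lambda>r. g (a - r)) has_real_derivative - D) (at x)"
proof -
  have "((\<lambda>r. a - r) has_real_derivative - 1) (at x)" by (auto intro!: derivative_eq_intros)
  from DERIV_chain2[OF assms this] show ?thesis by simp
qed

text \<open>The vertices sit at the multiples of \<open>h\<close>, and subtracting
  \<open>k * h\<close> from a cell centre gives a cell centre. The grid convolution is therefore
  exactly the periodic quadrature sum of the product \<open>q\<close>, and the bound on second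
  derivatives of \<open>q\<close> follows from the product rule.\<close>

lemma conv_quadrature:
  assumes J: "st_smooth L1 L2 T (Suc (Suc k)) (\<lambda>x t. J x)" and w: "st_smooth L1 L2 T (Suc (Suc l)) w"
    and L: "0 < L1" "0 < L2" and T: "0 < T"
  shows "\<exists>M\<ge>0. \<forall>t\<in>{0..T}. \<forall>h m n i j. 0 < h \<longrightarrow> L1 = real m * h \<longrightarrow> L2 = real n * h \<longrightarrow>
     \<bar>discrete_conv h m n (vertex_restrict h J) (cell_restrict h (\<lambda>z. w z t)) i j
        - periodic_conv L1 L2 J (\<lambda>z. w z t) (grid_pt h (of_int i), grid_pt h (of_int j))\<bar> \<le> M * h\<^sup>2"
    (is "\<exists>M\<ge>0. \<forall>t\<in>_. \<forall>h m n i j. _ \<longrightarrow> _ \<longrightarrow> _ \<longrightarrow> ?E t h m n i j \<le> M * _")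
proof -
  obtain Jx Jxx Jy Jyy where Js: "second_partials T (\<lambda>x t. J x) Jx Jxx Jy Jyy" "st_smooth L1 L2 T (Suc k) Jx"
    "st_smooth L1 L2 T k Jxx" "st_smooth L1 L2 T (Suc k) Jy" "st_smooth L1 L2 T k Jyy"
    using st_smooth_second_partials[OF J T] by blast
  obtain wx wxx wy wyy where ws: "second_partials T w wx wxx wy wyy" "st_smooth L1 L2 T (Suc l) wx"
    "st_smooth L1 L2 T l wxx" "st_smooth L1 L2 T (Suc l) wy" "st_smooth L1 L2 T l wyy"
    using st_smooth_second_partials[OF w T] by blast
  have ex: "\<exists>N\<ge>0. \<forall>g\<in>G. \<forall>t\<in>{0..T}. \<forall>p. \<bar>g p t\<bar> \<le> N"
    if "finite G" "\<forall>g\<in>G. \<exists>k. st_smooth L1 L2 T k g" for G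
    using that
  proof (induction G rule: finite_induct)
    case (insert g G)
    then obtain N k where N: "0 \<le> N" "\<forall>g\<in>G. \<forall>t\<in>{0..T}. \<forall>p. \<bar>g p t\<bar> \<le> N" "st_smooth L1 L2 T k g" by auto
    obtain M where M: "0 \<le> M" "\<forall>t\<in>{0..T}. \<forall>p. \<bar>g p t\<bar> \<le> M" using st_smooth_bounded[OF N(3) L] by blast
    show ?case using N M by (intro exI[of _ "max M N"]) (auto simp: le_max_iff_disj)
  qed auto
  obtain N where N: "0 \<le> N" "\<forall>g\<in>{\<lambda>x t. J x, Jx, Jxx, Jy, Jyy}. \<forall>t\<in>{0..T}. \<forall>p. \<bar>g p t\<bar> \<le> N"
    using ex[of "{\<lambda>x t. J x, Jx, Jxx, Jy, Jyy}"] J Js by blast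
  obtain R where R: "0 \<le> R" "\<forall>g\<in>{w, wx, wxx, wy, wyy}. \<forall>t\<in>{0..T}. \<forall>p. \<bar>g p t\<bar> \<le> R"
    using ex[of "{w, wx, wxx, wy, wyy}"] w ws by blast
  have "?E t h m n i j \<le> 4 * (4 * (N * R)) * L1 * L2 * h\<^sup>2"
    if t: "t \<in> {0..T}" and h: "0 < h" and mn: "L1 = real m * h" "L2 = real n * h" for t h m n i j
  proof -
    define a where "a = grid_pt h (of_int i)"
    define b where "b = grid_pt h (of_int j)"
    have NB': "\<bar>g p t\<bar> \<le> N" if "g \<in> {\<lambda>x t. J x, Jx, Jxx, Jy, Jyy}" for g p by (rule N(2)[rule_format, OF that t])
    have NB: "\<bar>J p\<bar> \<le> N" "\<bar>Jx p t\<bar> \<le> N" "\<bar>Jxx p t\<bar> \<le> N" "\<bar>Jy p t\<bar> \<le> N" "\<bar>Jyy p t\<bar> \<le> N" for p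
      using NB'[of "\<lambda>x t. J x" p] NB'[of Jx p] NB'[of Jxx p] NB'[of Jy p] NB'[of Jyy p] by simp_all
    have RB': "\<bar>g p t\<bar> \<le> R" if "g \<in> {w, wx, wxx, wy, wyy}" for g p by (rule R(2)[rule_format, OF that t])
    have RB: "\<bar>w p t\<bar> \<le> R" "\<bar>wx p t\<bar> \<le> R" "\<bar>wxx p t\<bar> \<le> R" "\<bar>wy p t\<bar> \<le> R" "\<bar>wyy p t\<bar> \<le> R" for p
      using RB'[of w p] RB'[of wx p] RB'[of wxx p] RB'[of wy p] RB'[of wyy p] by simp_all
    have prod: "\<bar>x * y\<bar> \<le> N * R" if "\<bar>x\<bar> \<le> N" "\<bar>y\<bar> \<le> R" for x y
      unfolding abs_mult using that N(1) by (intro mult_mono) auto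
    have sum4: "\<bar>x - 2 * y + z\<bar> \<le> 4 * B" if "\<bar>x\<bar> \<le> B" "\<bar>y\<bar> \<le> B" "\<bar>z\<bar> \<le> B" for x y z B :: real
      using that by linarith
    define q where "q = (\<lambda>p. J p * w ((a, b) - p) t)"
    define qx where "qx = (\<lambda>p. Jx p t * w ((a, b) - p) t - J p * wx ((a, b) - p) t)"
    define qy where "qy = (\<lambda>p. Jy p t * w ((a, b) - p) t - J p * wy ((a, b) - p) t)"
    define qxx where "qxx = (\<lambda>p. Jxx p t * w ((a, b) - p) t - 2 * (Jx p t * wx ((a, b) - p) t) + J p * wxx ((a, b) - p) t)"
    define qyy where "qyy = (\<lambda>p. Jyy p t * w ((a, b) - p) t - 2 * (Jy p t * wy ((a, b) - p) t) + J p * wyy ((a, b) - p) t)"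
    note JD = second_partialsD[OF Js(1) t]
    note WX = derivative_reflect[OF second_partialsD(1)[OF ws(1) t]] derivative_reflect[OF second_partialsD(2)[OF ws(1) t]]
    note WY = derivative_reflect[OF second_partialsD(3)[OF ws(1) t]] derivative_reflect[OF second_partialsD(4)[OF ws(1) t]]
    have dx: "((\<lambda>r. q (r, y)) has_real_derivative qx (x, y)) (at x)" for x y
      using DERIV_mult[OF JD(1)[of y x] WX(1)[of a "b - y" x]] by (simp add: q_def qx_def mult_ac)
    have dxx: "((\<lambda>r. qx (r, y)) has_real_derivative qxx (x, y)) (at x)" for x y
      using DERIV_diff[OF DERIV_mult[OF JD(2)[of y x] WX(1)[of a "b - y" x]] DERIV_mult[OF JD(1)[of y x] WX(2)[of a "b - y" x]]]
      by (simp add: qx_def qxx_def algebra_simps)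
    have dy: "((\<lambda>r. q (x, r)) has_real_derivative qy (x, y)) (at y)" for x y
      using DERIV_mult[OF JD(3)[of x y] WY(1)[of "a - x" b y]] by (simp add: q_def qy_def mult_ac)
    have dyy: "((\<lambda>r. qy (x, r)) has_real_derivative qyy (x, y)) (at y)" for x y
      using DERIV_diff[OF DERIV_mult[OF JD(4)[of x y] WY(1)[of "a - x" b y]] DERIV_mult[OF JD(3)[of x y] WY(2)[of "a - x" b y]]]
      by (simp add: qy_def qyy_def algebra_simps)
    have bx: "\<bar>qxx p\<bar> \<le> 4 * (N * R)" "\<bar>qyy p\<bar> \<le> 4 * (N * R)" for p
      unfolding qxx_def qyy_def by (intro sum4 prod NB RB)+
    have cont: "continuous_on UNIV q"
      unfolding q_def
      by (intro continuous_on_mult st_smooth_continuous[OF J t] continuous_on_compose2[OF st_smooth_continuous[OF w t]]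
          continuous_on_diff continuous_on_id continuous_on_const) simp
    have per: "periodic_fun L1 L2 q"
    proof -
      have "J (x + L1, y) = J (x, y)" "J (x, y + L2) = J (x, y)" for x y
        using st_smooth_periodic[OF J t] by (auto simp: periodic_fun_def)
      moreover have "w (x - L1, y) t = w (x, y) t" "w (x, y - L2) t = w (x, y) t" for x y
        using periodic_fun_of_int[OF st_smooth_periodic[OF w t], of x "-1" y 0]
          periodic_fun_of_int[OF st_smooth_periodic[OF w t], of x 0 y "-1"] by simp_all
      ultimately show ?thesis by (simp add: periodic_fun_def q_def flip: diff_diff_eq)
    qed
    have "\<bar>h\<^sup>2 * (\<Sum>k=1..int m. \<Sum>l=1..int n. q (of_int k * h, of_int l * h)) - integral (Omega L1 L2) q\<bar>
      \<le> 4 * (4 * (N * R)) * L1 * L2 * h\<^sup>2"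
      by (rule trapezoid_periodic_2d[OF cont per dx dxx bx(1) dy dyy bx(2) h mn])
    moreover have "discrete_conv h m n (vertex_restrict h J) (cell_restrict h (\<lambda>z. w z t)) i j =
       h\<^sup>2 * (\<Sum>k=1..int m. \<Sum>l=1..int n. q (of_int k * h, of_int l * h))"
      by (simp add: discrete_conv_def vertex_restrict_def cell_restrict_def grid_pt_def q_def a_def b_def algebra_simps)
    moreover have "periodic_conv L1 L2 J (\<lambda>z. w z t) (a, b) = integral (Omega L1 L2) q"
      by (simp add: periodic_conv_def q_def)
    ultimately show ?thesis by (simp only: a_def b_def)
  qed
  moreover have "0 \<le> 4 * (4 * (N * R)) * L1 * L2" using N(1) R(1) L by simp
  ultimately show ?thesis by blast
qed

section \<open>Derivatives of convolutions and the differential equation\<close>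

lemma continuous_on_conv_integrand:
  fixes J w :: "real \<times> real \<Rightarrow> real"
  assumes "continuous_on UNIV J" "continuous_on UNIV w"
  shows "continuous_on A (\<lambda>p. J p * w (z - p))"
  by (intro continuous_on_mult continuous_on_subset[OF assms(1)] continuous_on_compose2[OF assms(2)]
      continuous_on_diff continuous_on_id continuous_on_const) simp_all

lemma periodic_conv_add:
  assumes "continuous_on UNIV J" "continuous_on UNIV w" "continuous_on UNIV w'"
  shows "periodic_conv L1 L2 J (\<lambda>z. w z + w' z) p = periodic_conv L1 L2 J w p + periodic_conv L1 L2 J w' p"
  unfolding periodic_conv_def Omega_eq_box integral_open_interval distrib_left
  by (intro integral_add integrable_continuous continuous_on_conv_integrand assms)

text \<open>Moving along a general line \<open>\<gamma>\<close> covers both coordinate directions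
  with a single use of the Leibniz rule. The derivative falls on \<open>w\<close>, not on the
  kernel.\<close>

lemma periodic_conv_derivative:
  fixes J w :: "real \<times> real \<Rightarrow> real"
  assumes J: "continuous_on UNIV J" and w: "continuous_on UNIV w" "continuous_on UNIV w'"
    and line: "\<And>r. \<gamma> r = \<gamma> 0 + r *\<^sub>R v"
    and d: "\<And>p r. ((\<lambda>r. w (\<gamma> r - p)) has_real_derivative w' (\<gamma> r - p)) (at r)"
  shows "((\<lambda>r. periodic_conv L1 L2 J w (\<gamma> r)) has_real_derivative periodic_conv L1 L2 J w' (\<gamma> x)) (at x)"
proof -
  have c: "continuous_on A \<gamma>" for A :: "real set"
  proof -
    have "\<gamma> = (\<lambda>r. \<gamma> 0 + r *\<^sub>R v)" by (rule ext, rule line)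
    moreover have "continuous_on A (\<lambda>r. \<gamma> 0 + r *\<^sub>R v)"
      by (intro continuous_on_add continuous_on_const continuous_on_id continuous_on_scaleR)
    ultimately show ?thesis by (simp only:)
  qed
  have "((\<lambda>r. integral (cbox (0, 0) (L1, L2)) (\<lambda>p. J p * w (\<gamma> r - p))) has_real_derivative
      integral (cbox (0, 0) (L1, L2)) (\<lambda>p. J p * w' (\<gamma> x - p))) (at x within UNIV)"
  proof (rule leibniz_rule_field_derivative[where fx = "\<lambda>r p. J p * w' (\<gamma> r - p)"])
    show "((\<lambda>r. J p * w (\<gamma> r - p)) has_real_derivative J p * w' (\<gamma> r - p)) (at r within UNIV)" for r p
      by (intro DERIV_cmult d)
    show "(\<lambda>p. J p * w (\<gamma> r - p)) integrable_on cbox (0, 0) (L1, L2)" for r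
      by (intro integrable_continuous continuous_on_conv_integrand J w)
    have "continuous_on (UNIV \<times> cbox (0, 0) (L1, L2)) (\<lambda>z. J (snd z) * w' (\<gamma> (fst z) - snd z))"
      by (intro continuous_on_mult continuous_on_compose2[OF J] continuous_on_compose2[OF w(2)]
          continuous_on_diff continuous_on_compose2[OF c[of UNIV]] continuous_on_fst continuous_on_snd continuous_on_id) simp_all
    then show "continuous_on (UNIV \<times> cbox (0, 0) (L1, L2)) (\<lambda>(r, p). J p * w' (\<gamma> r - p))"
      by (simp only: case_prod_beta')
  qed simp_all
  then show ?thesis by (simp add: periodic_conv_def Omega_eq_box integral_open_interval)
qed

lemma derivative_shift:
  fixes g :: "real \<Rightarrow> real"
  shows "(g has_real_derivative D) (at (x - a)) \<Longrightarrow> ((\<lambda>r. g (r - a)) has_real_derivative D) (at x)"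
  using DERIV_shift[of g D x "- a"] by simp

text \<open>Convolution with 1 is a constant and merges into \<open>c0\<close>. Differentiation
  under the integral puts the Laplacian on the solution inside the convolution, which is the form
  that \<open>discrete_laplacian_conv\<close> produces on the grid.\<close>

lemma nCH_solution_time_derivative:
  assumes sol: "nCH_solution L1 L2 T \<gamma>c \<gamma>e J \<Phi>0 \<Phi>"
    and c0: "c0 = \<gamma>c - \<gamma>e + integral (Omega L1 L2) J"
    and J: "continuous_on UNIV J"
    and f: "second_partials T \<Phi> fx fxx fy fyy" "st_smooth L1 L2 T k0 \<Phi>" "st_smooth L1 L2 T k1 fx" "st_smooth L1 L2 T k2 fxx"
      "st_smooth L1 L2 T k3 fy" "st_smooth L1 L2 T k4 fyy"
    and F: "second_partials T (\<lambda>z t. \<Phi> z t ^ 3 + c0 * \<Phi> z t) Fx Fxx Fy Fyy" and t: "t \<in> {0..T}"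
  shows "(\<Phi> p has_real_derivative (Fxx p t + Fyy p t) - periodic_conv L1 L2 J (\<lambda>z. fxx z t + fyy z t) p) (at t within {0..T})"
proof -
  let ?C = "periodic_conv L1 L2 J"
  note cf = st_smooth_continuous[OF f(2) t] st_smooth_continuous[OF f(3) t] st_smooth_continuous[OF f(4) t]
    st_smooth_continuous[OF f(5) t] st_smooth_continuous[OF f(6) t]
  note fD = second_partialsD[OF f(1) t] and FD = second_partialsD[OF F t]
  have lx: "(r, y) = (0, y) + r *\<^sub>R (1, 0)" and ly: "(x, r) = (x, 0) + r *\<^sub>R (0, 1)" for x y r :: real by simp_all
  have Cx: "((\<lambda>r. ?C w (r, y)) has_real_derivative ?C w' (x, y)) (at x)"
    if "continuous_on UNIV w" "continuous_on UNIV w'" "\<And>x y. ((\<lambda>r. w (r, y)) has_real_derivative w' (x, y)) (at x)" for w w' x y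
  proof (rule periodic_conv_derivative[OF J that(1,2) lx])
    fix p r
    show "((\<lambda>r. w ((r, y) - p)) has_real_derivative w' ((r, y) - p)) (at r)"
      using derivative_shift[OF that(3)[of "y - snd p" "r - fst p"]] by (cases p) simp
  qed
  have Cy: "((\<lambda>r. ?C w (x, r)) has_real_derivative ?C w' (x, y)) (at y)"
    if "continuous_on UNIV w" "continuous_on UNIV w'" "\<And>x y. ((\<lambda>r. w (x, r)) has_real_derivative w' (x, y)) (at y)" for w w' x y
  proof (rule periodic_conv_derivative[OF J that(1,2) ly])
    fix p r
    show "((\<lambda>r. w ((x, r) - p)) has_real_derivative w' ((x, r) - p)) (at r)"
      using derivative_shift[OF that(3)[of "x - fst p" "r - snd p"]] by (cases p) simp
  qed
  have const: "?C (\<lambda>_. 1) z = integral (Omega L1 L2) J" for z by (simp add: periodic_conv_def)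
  have lap: "((\<lambda>\<tau>. \<Phi> p \<tau>) has_real_derivative laplacian (\<lambda>z. \<Phi> z t ^ 3 + \<gamma>c * \<Phi> z t - \<gamma>e * \<Phi> z t
      + ?C (\<lambda>_. 1) z * \<Phi> z t - ?C (\<lambda>y. \<Phi> y t) z) p) (at t within {0..T})"
    using sol t unfolding nCH_solution_def by blast
  have "laplacian (\<lambda>z. \<Phi> z t ^ 3 + \<gamma>c * \<Phi> z t - \<gamma>e * \<Phi> z t + ?C (\<lambda>_. 1) z * \<Phi> z t - ?C (\<lambda>y. \<Phi> y t) z) p
     = laplacian (\<lambda>z. (\<Phi> z t ^ 3 + c0 * \<Phi> z t) - ?C (\<lambda>y. \<Phi> y t) z) p"
    unfolding const c0 by (rule arg_cong[where f = "\<lambda>q. laplacian q p"]) (simp add: fun_eq_iff algebra_simps)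
  also have "\<dots> = (Fxx p t - ?C (\<lambda>z. fxx z t) p) + (Fyy p t - ?C (\<lambda>z. fyy z t) p)"
    by (rule laplacian_eqI[where qx = "\<lambda>z. Fx z t - ?C (\<lambda>z. fx z t) z" and qxx = "\<lambda>z. Fxx z t - ?C (\<lambda>z. fxx z t) z"
          and qy = "\<lambda>z. Fy z t - ?C (\<lambda>z. fy z t) z" and qyy = "\<lambda>z. Fyy z t - ?C (\<lambda>z. fyy z t) z",
          OF DERIV_diff[OF FD(1) Cx[OF cf(1,2) fD(1)]] DERIV_diff[OF FD(2) Cx[OF cf(2,3) fD(2)]]
            DERIV_diff[OF FD(3) Cy[OF cf(1,4) fD(3)]] DERIV_diff[OF FD(4) Cy[OF cf(4,5) fD(4)]]])
  also have "\<dots> = (Fxx p t + Fyy p t) - ?C (\<lambda>z. fxx z t + fyy z t) p"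
    unfolding periodic_conv_add[OF J cf(3,5)] by simp
  finally show ?thesis using lap by (simp only:)
qed

text \<open>Only linearity and translation of the argument are involved. The identity must precede
  quadrature: the discrete Laplacian of a quadrature error of size h^2 would be bounded only by a
  constant.\<close>

lemma discrete_laplacian_conv:
  "discrete_laplacian h (discrete_conv h m n f g) i j = discrete_conv h m n f (discrete_laplacian h g) i j"
proof -
  let ?S = "\<lambda>a b. grid_sum m n (\<lambda>k l. f k l * g (i + a - k) (j + b - l))"
  have "discrete_conv h m n f (discrete_laplacian h g) i j =
      h\<^sup>2 * grid_sum m n (\<lambda>k l. (1 / h\<^sup>2) * (f k l * g (i + 1 - k) (j + 0 - l) + f k l * g (i + (-1) - k) (j + 0 - l)
        + f k l * g (i + 0 - k) (j + 1 - l) + f k l * g (i + 0 - k) (j + (-1) - l) - 4 * (f k l * g (i + 0 - k) (j + 0 - l))))"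
    unfolding discrete_conv_eq discrete_laplacian_def by (simp add: algebra_simps add_divide_distrib diff_divide_distrib)
  also have "\<dots> = h\<^sup>2 * ((1 / h\<^sup>2) * (?S 1 0 + ?S (-1) 0 + ?S 0 1 + ?S 0 (-1) - 4 * ?S 0 0))"
    by (simp only: grid_sum_cmult grid_sum_add grid_sum_diff)
  also have "\<dots> = discrete_laplacian h (discrete_conv h m n f g) i j"
    unfolding discrete_laplacian_def discrete_conv_eq by (simp add: field_simps)
  finally show ?thesis by simp
qed

lemma discrete_conv_sup:
  assumes f: "\<And>k l. \<bar>f k l\<bar> \<le> M" and g: "\<And>k l. \<bar>g k l\<bar> \<le> G" and L: "L1 = real m * h" "L2 = real n * h"
  shows "\<bar>discrete_conv h m n f g i j\<bar> \<le> M * G * (L1 * L2)"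
proof -
  have "0 \<le> M" "0 \<le> G" using order_trans[OF abs_ge_zero f] order_trans[OF abs_ge_zero g] by auto
  then have fg: "\<bar>f k l * g (i - k) (j - l)\<bar> \<le> M * G" for k l
    unfolding abs_mult by (intro mult_mono f g) auto
  have "\<bar>grid_sum m n (\<lambda>k l. f k l * g (i - k) (j - l))\<bar> \<le> grid_sum m n (\<lambda>k l. \<bar>f k l * g (i - k) (j - l)\<bar>)"
    unfolding grid_sum_def by (intro order_trans[OF sum_abs] sum_mono order_refl)
  also have "\<dots> \<le> grid_sum m n (\<lambda>k l. M * G)" by (intro grid_sum_mono fg)
  finally have "h\<^sup>2 * \<bar>grid_sum m n (\<lambda>k l. f k l * g (i - k) (j - l))\<bar> \<le> h\<^sup>2 * (real m * real n * (M * G))"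
    unfolding grid_sum_const by (intro mult_left_mono) auto
  also have "\<dots> = M * G * (L1 * L2)" by (simp add: L power2_eq_square)
  finally show ?thesis by (simp add: discrete_conv_eq abs_mult)
qed

section \<open>Closure properties of smooth functions and the constants of the scheme\<close>

lemma st_smooth_lift:
  assumes "smooth_periodic L1 L2 J"
  shows "st_smooth L1 L2 T k (\<lambda>x t. J x)"
proof -
  have "Ck_on k (\<lambda>p :: (real \<times> real) \<times> real. J (fst p)) (UNIV \<times> {0..T})"
    using assms by (intro Ck_on_fst) (simp add: smooth_periodic_def smooth_on_def)
  moreover have "(\<lambda>p :: (real \<times> real) \<times> real. J (fst p)) = (\<lambda>(x, t). J x)" by (simp add: fun_eq_iff)
  ultimately show ?thesis using assms by (simp add: st_smooth_def smooth_periodic_def)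
qed

lemma st_smooth_const: "st_smooth L1 L2 T k (\<lambda>_ _. c)"
  using Ck_on_const[of k c "UNIV \<times> {0..T}"] by (simp add: st_smooth_def periodic_fun_def case_prod_beta')

lemma st_smooth_add: "st_smooth L1 L2 T k f \<Longrightarrow> st_smooth L1 L2 T k g \<Longrightarrow> st_smooth L1 L2 T k (\<lambda>x t. f x t + g x t)"
  using Ck_on_add[of k "\<lambda>(x, t). f x t" "UNIV \<times> {0..T}" "\<lambda>(x, t). g x t"]
  by (simp add: st_smooth_def periodic_fun_def case_prod_beta')

lemma st_smooth_mult: "st_smooth L1 L2 T k f \<Longrightarrow> st_smooth L1 L2 T k g \<Longrightarrow> st_smooth L1 L2 T k (\<lambda>x t. f x t * g x t)"
  using Ck_on_mult[of k "\<lambda>(x, t). f x t" "UNIV \<times> {0..T}" "\<lambda>(x, t). g x t"]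
  by (simp add: st_smooth_def periodic_fun_def case_prod_beta')

lemma st_smooth_solution:
  assumes "nCH_solution L1 L2 T \<gamma>c \<gamma>e J \<Phi>0 \<Phi>"
  shows "st_smooth L1 L2 T k \<Phi>"
  using assms unfolding nCH_solution_def st_smooth_def smooth_on_def by (elim conjE) (intro conjI, erule spec)

lemma integral_Omega_diff:
  fixes f g :: "real \<times> real \<Rightarrow> real"
  assumes "continuous_on UNIV f" "continuous_on UNIV g"
  shows "integral (Omega L1 L2) (\<lambda>x. f x - g x) = integral (Omega L1 L2) f - integral (Omega L1 L2) g"
  unfolding Omega_eq_box integral_open_interval
  by (intro Henstock_Kurzweil_Integration.integral_diff integrable_continuous continuous_on_subset[OF assms(1)] continuous_on_subset[OF assms(2)]) simp_all

lemma smooth_periodic_continuous: "smooth_periodic L1 L2 J \<Longrightarrow> continuous_on UNIV J"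
  unfolding smooth_periodic_def smooth_on_def by (elim conjE allE[of _ 0]) simp

lemma B_const_quadrature:
  assumes J: "smooth_periodic L1 L2 J" and L: "0 < L1" "0 < L2"
  shows "\<exists>M\<ge>0. \<forall>h m n. 0 < h \<longrightarrow> L1 = real m * h \<longrightarrow> L2 = real n * h \<longrightarrow>
     \<bar>B_const h m n J \<gamma> - (integral (Omega L1 L2) J + \<gamma>)\<bar> \<le> M * h\<^sup>2"
proof -
  \<comment> \<open>The kernel and the constant 1 are regarded as functions of time on a dummy
    interval, so that the space-time quadrature lemma applies.\<close>
  have "\<exists>M\<ge>0. \<forall>t\<in>{0..1 :: real}. \<forall>h m n i j. 0 < h \<longrightarrow> L1 = real m * h \<longrightarrow> L2 = real n * h \<longrightarrow>
     \<bar>discrete_conv h m n (vertex_restrict h J) (cell_restrict h (\<lambda>z. 1)) i j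
        - periodic_conv L1 L2 J (\<lambda>z. 1) (grid_pt h (of_int i), grid_pt h (of_int j))\<bar> \<le> M * h\<^sup>2"
    by (rule conv_quadrature[where w = "\<lambda>_ _. 1", OF st_smooth_lift[OF J, of 1 "Suc (Suc 0)"]
        st_smooth_const[of L1 L2 1 "Suc (Suc 0)" 1] L zero_less_one])
  then obtain M where M: "0 \<le> M" "\<forall>t\<in>{0..1 :: real}. \<forall>h m n i j. 0 < h \<longrightarrow> L1 = real m * h \<longrightarrow> L2 = real n * h \<longrightarrow>
     \<bar>discrete_conv h m n (vertex_restrict h J) (cell_restrict h (\<lambda>z. 1)) i j
        - periodic_conv L1 L2 J (\<lambda>z. 1) (grid_pt h (of_int i), grid_pt h (of_int j))\<bar> \<le> M * h\<^sup>2"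
    by (elim exE conjE)
  have "\<bar>B_const h m n J \<gamma> - (integral (Omega L1 L2) J + \<gamma>)\<bar> \<le> M * h\<^sup>2"
    if "0 < h" "L1 = real m * h" "L2 = real n * h" for h m n
  proof -
    have one: "(0 :: real) \<in> {0..1}" by simp
    have "cell_restrict h (\<lambda>z. 1) = (\<lambda>_ _. 1)" by (simp add: cell_restrict_def fun_eq_iff)
    then show ?thesis using M(2)[rule_format, OF one that, of 0 0]
      by (simp add: B_const_def periodic_conv_def)
  qed
  then show ?thesis by (intro exI[of _ M] conjI M(1) allI impI)
qed

section \<open>Truncation error of the scheme\<close>

definition truncation_error :: "real \<Rightarrow> real \<Rightarrow> nat \<Rightarrow> nat \<Rightarrow> real \<Rightarrow> real \<Rightarrow> (real \<times> real \<Rightarrow> real) \<Rightarrow>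
    (real \<times> real \<Rightarrow> real) \<Rightarrow> grid_fun \<Rightarrow> grid_fun \<Rightarrow> grid_fun \<Rightarrow> grid_fun" where
  "truncation_error s h m n \<gamma>c \<gamma>e Jc Je p q r i j =
     (r i j - q i j) / s - discrete_laplacian h (chem_potential h m n \<gamma>c \<gamma>e Jc Je p q r) i j"

text \<open>Everything is compared with the differential equation at the midpoint
  \<open>t + s / 2\<close>, where the time difference and the averages are of second order and the
  extrapolation is of order \<open>\<rho>\<close>. The bound \<open>h \<le> 1\<close> makes the
  constants \<open>Bc\<close> and \<open>Be\<close> bounded uniformly in the grid.\<close>

lemma nCH_consistency:
  assumes L: "0 < L1" "0 < L2" and T: "0 < T"
    and Jc: "smooth_periodic L1 L2 Jc" and Je: "smooth_periodic L1 L2 Je"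
    and sol: "nCH_solution L1 L2 T \<gamma>c \<gamma>e (\<lambda>x. Jc x - Je x) \<Phi>0 \<Phi>"
  shows "\<exists>D\<ge>0. \<forall>s t tm \<rho> h m n i j. step_times T t s tm \<rho> \<longrightarrow> 0 < h \<longrightarrow> h \<le> 1 \<longrightarrow> L1 = real m * h \<longrightarrow> L2 = real n * h \<longrightarrow>
     \<bar>truncation_error s h m n \<gamma>c \<gamma>e Jc Je (cell_restrict h (\<lambda>z. \<Phi> z tm))
       (cell_restrict h (\<lambda>z. \<Phi> z t)) (cell_restrict h (\<lambda>z. \<Phi> z (t + s))) i j\<bar> \<le> D * (h\<^sup>2 + \<rho>)"
proof -
  define J where "J = (\<lambda>x. Jc x - Je x)"
  define c0 where "c0 = \<gamma>c - \<gamma>e + integral (Omega L1 L2) J"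
  define F where "F = (\<lambda>z t. \<Phi> z t ^ 3 + c0 * \<Phi> z t)"
  let ?C = "periodic_conv L1 L2 J"
  note cJc = smooth_periodic_continuous[OF Jc] and cJe = smooth_periodic_continuous[OF Je]
  have cJ: "continuous_on UNIV J" unfolding J_def by (intro continuous_on_diff cJc cJe)
  note \<Phi>s = st_smooth_solution[OF sol]
  have Js: "st_smooth L1 L2 T k (\<lambda>x t. J x)" for k
  proof -
    have "st_smooth L1 L2 T k (\<lambda>x t. Jc x + (- 1) * Je x)"
      by (intro st_smooth_add st_smooth_mult st_smooth_const st_smooth_lift Jc Je)
    then show ?thesis by (simp add: J_def)
  qed
  have Fs: "st_smooth L1 L2 T k F" for k
  proof -
    have "st_smooth L1 L2 T k (\<lambda>x t. \<Phi> x t * (\<Phi> x t * \<Phi> x t) + c0 * \<Phi> x t)"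
      by (intro st_smooth_add st_smooth_mult st_smooth_const \<Phi>s)
    then show ?thesis by (simp add: F_def power3_eq_cube mult.assoc)
  qed
  obtain fx fxx fy fyy where f: "second_partials T \<Phi> fx fxx fy fyy" "st_smooth L1 L2 T (Suc (Suc (Suc 0))) fx"
    "st_smooth L1 L2 T (Suc (Suc 0)) fxx" "st_smooth L1 L2 T (Suc (Suc (Suc 0))) fy" "st_smooth L1 L2 T (Suc (Suc 0)) fyy"
    using st_smooth_second_partials[OF \<Phi>s T] by blast
  obtain Fx Fxx Fy Fyy where F: "second_partials T F Fx Fxx Fy Fyy"
    "st_smooth L1 L2 T (Suc (Suc 0)) Fxx" "st_smooth L1 L2 T (Suc (Suc 0)) Fyy"
    using st_smooth_second_partials[OF Fs T] by blast
  define fl where "fl = (\<lambda>z t. fxx z t + fyy z t)"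
  have fls: "st_smooth L1 L2 T (Suc (Suc 0)) fl" unfolding fl_def by (intro st_smooth_add f)
  define Ft where "Ft = (\<lambda>p t. (Fxx p t + Fyy p t) - ?C (\<lambda>z. fl z t) p)"
  have Ft: "(\<Phi> p has_real_derivative Ft p t) (at t within {0..T})" if "t \<in> {0..T}" for t p
    unfolding Ft_def fl_def
    by (rule nCH_solution_time_derivative[OF sol[folded J_def] c0_def cJ f(1) \<Phi>s f(2-5) F(1)[unfolded F_def] that])
  obtain M1 where M1: "0 \<le> M1" "\<forall>t s tm \<rho> h p. step_times T t s tm \<rho> \<longrightarrow> 0 < h \<longrightarrow>
     \<bar>dlap h (\<lambda>z. \<Phi> z (t + s / 2)) p\<bar> \<le> M1 \<and>
     \<bar>dlap h (\<lambda>z. \<Phi> z t + \<Phi> z (t + s) - 2 * \<Phi> z (t + s / 2)) p\<bar> \<le> M1 * s\<^sup>2 \<and>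
     \<bar>dlap h (\<lambda>z. 3 / 2 * \<Phi> z t - 1 / 2 * \<Phi> z tm - \<Phi> z (t + s / 2)) p\<bar> \<le> M1 * \<rho> \<and>
     \<bar>dlap h (\<lambda>z. eta (\<Phi> z t) (\<Phi> z (t + s)) - \<Phi> z (t + s / 2) ^ 3) p\<bar> \<le> M1 * s\<^sup>2"
    using st_smooth_dlap_bounds[OF \<Phi>s L T] by blast
  obtain M2 where M2: "0 \<le> M2" "\<forall>t\<in>{0..T}. \<forall>h>0. \<forall>p. \<bar>dlap h (\<lambda>z. \<Phi> z t) p - (fxx p t + fyy p t)\<bar> \<le> M2 * h\<^sup>2"
    using dlap_consistency[OF f(1,3,5) L T] by blast
  obtain M3 where M3: "0 \<le> M3" "\<forall>t\<in>{0..T}. \<forall>h>0. \<forall>p. \<bar>dlap h (\<lambda>z. F z t) p - (Fxx p t + Fyy p t)\<bar> \<le> M3 * h\<^sup>2"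
    using dlap_consistency[OF F L T] by blast
  obtain M4 where M4: "0 \<le> M4" "\<forall>t s tm \<rho> p. step_times T t s tm \<rho> \<longrightarrow>
     \<bar>(\<Phi> p (t + s) - \<Phi> p t) / s - Ft p (t + s / 2)\<bar> \<le> M4 * s\<^sup>2"
    using time_derivative_midpoint[OF \<Phi>s L T Ft] by blast
  obtain M5 where M5: "0 \<le> M5" "\<forall>t\<in>{0..T}. \<forall>h m n i j. 0 < h \<longrightarrow> L1 = real m * h \<longrightarrow> L2 = real n * h \<longrightarrow>
     \<bar>discrete_conv h m n (vertex_restrict h J) (cell_restrict h (\<lambda>z. fl z t)) i j
        - ?C (\<lambda>z. fl z t) (grid_pt h (of_int i), grid_pt h (of_int j))\<bar> \<le> M5 * h\<^sup>2"
    using conv_quadrature[OF Js fls L T] by blast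
  obtain M6 where M6: "0 \<le> M6" "\<forall>h m n. 0 < h \<longrightarrow> L1 = real m * h \<longrightarrow> L2 = real n * h \<longrightarrow>
     \<bar>B_const h m n Jc \<gamma>c - (integral (Omega L1 L2) Jc + \<gamma>c)\<bar> \<le> M6 * h\<^sup>2"
    using B_const_quadrature[OF Jc L] by blast
  obtain M7 where M7: "0 \<le> M7" "\<forall>h m n. 0 < h \<longrightarrow> L1 = real m * h \<longrightarrow> L2 = real n * h \<longrightarrow>
     \<bar>B_const h m n Je \<gamma>e - (integral (Omega L1 L2) Je + \<gamma>e)\<bar> \<le> M7 * h\<^sup>2"
    using B_const_quadrature[OF Je L] by blast
  obtain MJ where MJ: "0 \<le> MJ" "\<forall>t\<in>{0..T}. \<forall>p. \<bar>J p\<bar> \<le> MJ"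
    using st_smooth_bounded[OF Js L] by blast
  define MB where "MB = \<bar>integral (Omega L1 L2) Jc + \<gamma>c\<bar> + M6 + (\<bar>integral (Omega L1 L2) Je + \<gamma>e\<bar> + M7)"
  define D where "D = M4 + M3 + (M1 + (M6 + M7) * M1 + MB * M1 + MB * M1) + (MJ * (M1 + M2) * (L1 * L2) + M5)"
  have MB: "0 \<le> MB" using M6(1) M7(1) by (simp add: MB_def)
  have D: "0 \<le> D" using M1(1) M2(1) M3(1) M4(1) M5(1) M6(1) M7(1) MJ(1) MB L unfolding D_def by simp
  have "\<bar>truncation_error s h m n \<gamma>c \<gamma>e Jc Je (cell_restrict h (\<lambda>z. \<Phi> z tm))
       (cell_restrict h (\<lambda>z. \<Phi> z t)) (cell_restrict h (\<lambda>z. \<Phi> z (t + s))) i j\<bar> \<le> D * (h\<^sup>2 + \<rho>)"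
    if st: "step_times T t s tm \<rho>" and h: "0 < h" "h \<le> 1" and mn: "L1 = real m * h" "L2 = real n * h"
    for s t tm \<rho> h m n i j
  proof -
    define p where "p = (grid_pt h (of_int i), grid_pt h (of_int j))"
    define t' where "t' = t + s / 2"
    define Bc where "Bc = B_const h m n Jc \<gamma>c"
    define Be where "Be = B_const h m n Je \<gamma>e"
    define V where "V = vertex_restrict h J"
    define hat where "hat = (\<lambda>z. 3 / 2 * \<Phi> z t - 1 / 2 * \<Phi> z tm)"
    define q where "q = (\<lambda>z. eta (\<Phi> z t) (\<Phi> z (t + s)) + Bc * ((\<Phi> z t + \<Phi> z (t + s)) / 2) - Be * hat z)"
    note mem = step_times_mem[OF st]
    have t': "t' \<in> {0..T}" using mem(3) by (simp add: t'_def)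
    have \<rho>: "s\<^sup>2 \<le> \<rho>" "0 \<le> \<rho>" using step_times_square_le[OF st] st by (auto simp: step_times_def)
    have \<Phi>1: "\<bar>dlap h (\<lambda>z. \<Phi> z t') p\<bar> \<le> M1"
      "\<bar>dlap h (\<lambda>z. \<Phi> z t + \<Phi> z (t + s) - 2 * \<Phi> z t') p\<bar> \<le> M1 * s\<^sup>2"
      "\<bar>dlap h (\<lambda>z. hat z - \<Phi> z t') p\<bar> \<le> M1 * \<rho>"
      "\<bar>dlap h (\<lambda>z. eta (\<Phi> z t) (\<Phi> z (t + s)) - \<Phi> z t' ^ 3) p\<bar> \<le> M1 * s\<^sup>2" for p
      using M1(2)[rule_format, OF st h(1), of p] unfolding t'_def hat_def by blast+
    have Bc6: "\<bar>Bc - (integral (Omega L1 L2) Jc + \<gamma>c)\<bar> \<le> M6 * h\<^sup>2"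
      unfolding Bc_def by (rule M6(2)[rule_format, OF h(1) mn])
    have Be7: "\<bar>Be - (integral (Omega L1 L2) Je + \<gamma>e)\<bar> \<le> M7 * h\<^sup>2"
      unfolding Be_def by (rule M7(2)[rule_format, OF h(1) mn])
    have h2: "h\<^sup>2 \<le> 1" using h by (simp add: power_le_one)
    have "M6 * h\<^sup>2 \<le> M6" "M7 * h\<^sup>2 \<le> M7" using h2 M6(1) M7(1) by (simp_all add: mult_left_le)
    note near6 = order_trans[OF Bc6 this(1)] and near7 = order_trans[OF Be7 this(2)]
    have near: "\<bar>x\<bar> \<le> \<bar>y\<bar> + M" if "\<bar>x - y\<bar> \<le> M" for x y M :: real using that by linarith
    have "\<bar>integral (Omega L1 L2) Jc + \<gamma>c\<bar> + M6 \<le> MB" "\<bar>integral (Omega L1 L2) Je + \<gamma>e\<bar> + M7 \<le> MB"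
      unfolding MB_def using M6(1) M7(1) by simp_all
    note BcM = order_trans[OF near[OF near6] this(1)] and BeM = order_trans[OF near[OF near7] this(2)]
    have c0B: "\<bar>c0 - (Bc - Be)\<bar> \<le> (M6 + M7) * h\<^sup>2"
    proof -
      have "c0 = (integral (Omega L1 L2) Jc + \<gamma>c) - (integral (Omega L1 L2) Je + \<gamma>e)"
        unfolding c0_def J_def integral_Omega_diff[OF cJc cJe] by simp
      then show ?thesis using Bc6 Be7 by (simp add: distrib_right)
    qed
    have chem: "chem_potential h m n \<gamma>c \<gamma>e Jc Je (cell_restrict h (\<lambda>z. \<Phi> z tm))
           (cell_restrict h (\<lambda>z. \<Phi> z t)) (cell_restrict h (\<lambda>z. \<Phi> z (t + s)))
         = (\<lambda>i j. cell_restrict h q i j - discrete_conv h m n V (cell_restrict h hat) i j)"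
    proof -
      have "(\<lambda>i j. 3 / 2 * cell_restrict h (\<lambda>z. \<Phi> z t) i j - 1 / 2 * cell_restrict h (\<lambda>z. \<Phi> z tm) i j) = cell_restrict h hat"
        by (simp add: cell_restrict_def hat_def fun_eq_iff)
      then show ?thesis unfolding chem_potential_def Let_def J_def[symmetric] V_def[symmetric] Bc_def[symmetric] Be_def[symmetric]
        by (simp only:) (simp only: cell_restrict_def q_def hat_def)
    qed
    have laphat: "discrete_laplacian h (cell_restrict h hat) = cell_restrict h (dlap h hat)"
      by (intro ext) (simp only: discrete_laplacian_restrict cell_restrict_def)
    \<comment> \<open>The equation at \<open>t'\<close> is inserted. \<open>X1\<close> is the error
      of the time difference, \<open>X2\<close> that of the discrete Laplacian on the local part,
      \<open>X3\<close> compares the exact with the discrete local potential, and \<open>X4\<close>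
      collects the convolution.\<close>
    define X1 where "X1 = (\<Phi> p (t + s) - \<Phi> p t) / s - Ft p t'"
    define X2 where "X2 = dlap h (\<lambda>z. F z t') p - (Fxx p t' + Fyy p t')"
    define X3 where "X3 = dlap h (\<lambda>z. F z t') p - dlap h q p"
    define X4 where "X4 = discrete_conv h m n V (cell_restrict h (dlap h hat)) i j - ?C (\<lambda>z. fl z t') p"
    have split: "truncation_error s h m n \<gamma>c \<gamma>e Jc Je (cell_restrict h (\<lambda>z. \<Phi> z tm))
       (cell_restrict h (\<lambda>z. \<Phi> z t)) (cell_restrict h (\<lambda>z. \<Phi> z (t + s))) i j = X1 - X2 + X3 + X4"
      unfolding truncation_error_def chem discrete_laplacian_diff discrete_laplacian_conv laphat
      unfolding discrete_laplacian_restrict p_def[symmetric] X1_def X2_def X3_def X4_def Ft_def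
      by (simp add: cell_restrict_def p_def)
    have 1: "\<bar>X1\<bar> \<le> M4 * s\<^sup>2" unfolding X1_def t'_def by (rule M4(2)[rule_format, OF st])
    have 2: "\<bar>X2\<bar> \<le> M3 * h\<^sup>2" unfolding X2_def by (rule M3(2)[rule_format, OF t' h(1)])
    have 3: "\<bar>X3\<bar> \<le> M1 * s\<^sup>2 + (M6 + M7) * h\<^sup>2 * M1 + MB * (M1 * s\<^sup>2) + MB * (M1 * \<rho>)"
    proof -
      \<comment> \<open>\<open>F\<close> and \<open>q\<close> differ in four ways: quadrature of the
        constants, the nonlinearity, averaging and extrapolation. The first is a number times the
        solution, so its order h^2 survives the Laplacian; the others are covered by
        \<open>st_smooth_dlap_bounds\<close>.\<close>
      let ?f1 = "\<lambda>z. (c0 - (Bc - Be)) * \<Phi> z t'" and ?g1 = "\<lambda>z. eta (\<Phi> z t) (\<Phi> z (t + s)) - \<Phi> z t' ^ 3"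
      let ?g2 = "\<lambda>z. \<Phi> z t + \<Phi> z (t + s) - 2 * \<Phi> z t'" and ?g3 = "\<lambda>z. hat z - \<Phi> z t'"
      let ?f2 = "\<lambda>z. ?f1 z - ?g1 z" and ?f3 = "\<lambda>z. ?f1 z - ?g1 z - Bc / 2 * ?g2 z"
      have "(\<lambda>z. F z t' - q z) = (\<lambda>z. ?f3 z + Be * ?g3 z)"
        by (simp add: fun_eq_iff F_def q_def field_simps)
      then have "X3 = dlap h (\<lambda>z. ?f3 z + Be * ?g3 z) p"
        unfolding X3_def dlap_diff[symmetric] by (simp only:)
      also have "\<dots> = (c0 - (Bc - Be)) * dlap h (\<lambda>z. \<Phi> z t') p - dlap h ?g1 p - Bc / 2 * dlap h ?g2 p + Be * dlap h ?g3 p"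
        unfolding dlap_add[of h ?f3] dlap_diff[of h ?f2] dlap_diff[of h ?f1] dlap_cmult ..
      finally have X3: "X3 = (c0 - (Bc - Be)) * dlap h (\<lambda>z. \<Phi> z t') p - dlap h ?g1 p - Bc / 2 * dlap h ?g2 p + Be * dlap h ?g3 p" .
      have a: "\<bar>(c0 - (Bc - Be)) * dlap h (\<lambda>z. \<Phi> z t') p\<bar> \<le> (M6 + M7) * h\<^sup>2 * M1"
        unfolding abs_mult[of "c0 - (Bc - Be)"] by (intro mult_mono c0B \<Phi>1) (use M6(1) M7(1) in simp_all)
      have b: "\<bar>Bc / 2 * dlap h (\<lambda>z. \<Phi> z t + \<Phi> z (t + s) - 2 * \<Phi> z t') p\<bar> \<le> MB * (M1 * s\<^sup>2)"
        unfolding abs_mult[of "Bc / 2"] by (intro mult_mono \<Phi>1) (use BcM MB in simp_all)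
      have c: "\<bar>Be * dlap h (\<lambda>z. hat z - \<Phi> z t') p\<bar> \<le> MB * (M1 * \<rho>)"
        unfolding abs_mult[of Be] by (intro mult_mono \<Phi>1 BeM) (use MB in simp_all)
      have tri: "\<bar>x - y - z + u\<bar> \<le> Y + X + Z + U" if "\<bar>x\<bar> \<le> X" "\<bar>y\<bar> \<le> Y" "\<bar>z\<bar> \<le> Z" "\<bar>u\<bar> \<le> U" for x y z u X Y Z U :: real
        using that by linarith
      show ?thesis unfolding X3 by (rule tri[OF a \<Phi>1(4) b c])
    qed
    \<comment> \<open>The discrete Laplacian of the extrapolation is first replaced in the maximum
      norm by the exact Laplacian at \<open>t'\<close>; only then is the convolution with this
      smooth function compared with its quadrature.\<close>
    have 4: "\<bar>X4\<bar> \<le> MJ * (M1 * \<rho> + M2 * h\<^sup>2) * (L1 * L2) + M5 * h\<^sup>2"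
    proof -
      have "\<bar>discrete_conv h m n V (\<lambda>k l. cell_restrict h (dlap h hat) k l - cell_restrict h (\<lambda>z. fl z t') k l) i j\<bar>
         \<le> MJ * (M1 * \<rho> + M2 * h\<^sup>2) * (L1 * L2)"
      proof (rule discrete_conv_sup[OF _ _ mn])
        show "\<bar>V k l\<bar> \<le> MJ" for k l unfolding V_def vertex_restrict_def by (rule MJ(2)[rule_format, OF t'])
        have "\<bar>dlap h hat z - fl z t'\<bar> \<le> M1 * \<rho> + M2 * h\<^sup>2" for z
        proof -
          have "dlap h hat z - fl z t' = dlap h (\<lambda>z. hat z - \<Phi> z t') z + (dlap h (\<lambda>z. \<Phi> z t') z - (fxx z t' + fyy z t'))"
            unfolding dlap_diff fl_def by simp
          then show ?thesis
            using order_trans[OF abs_triangle_ineq add_mono[OF \<Phi>1(3)[of z] M2(2)[rule_format, OF t' h(1), of z]]] by (simp only:)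
        qed
        then show "\<bar>cell_restrict h (dlap h hat) k l - cell_restrict h (\<lambda>z. fl z t') k l\<bar> \<le> M1 * \<rho> + M2 * h\<^sup>2" for k l
          by (simp add: cell_restrict_def)
      qed
      moreover have "\<bar>discrete_conv h m n V (cell_restrict h (\<lambda>z. fl z t')) i j - ?C (\<lambda>z. fl z t') p\<bar> \<le> M5 * h\<^sup>2"
        unfolding V_def p_def by (rule M5(2)[rule_format, OF t' h(1) mn])
      ultimately show ?thesis unfolding X4_def discrete_conv_diff_right by linarith
    qed
    have tri: "\<bar>x - y + z + u\<bar> \<le> X + Y + Z + U" if "\<bar>x\<bar> \<le> X" "\<bar>y\<bar> \<le> Y" "\<bar>z\<bar> \<le> Z" "\<bar>u\<bar> \<le> U" for x y z u X Y Z U :: real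
      using that by linarith
    let ?e = "h\<^sup>2 + \<rho>"
    have e: "s\<^sup>2 \<le> ?e" "h\<^sup>2 \<le> ?e" "\<rho> \<le> ?e" "0 \<le> ?e" using \<rho> zero_le_power2[of h] by linarith+
    have "\<bar>X1 - X2 + X3 + X4\<bar> \<le> M4 * s\<^sup>2 + M3 * h\<^sup>2
       + (M1 * s\<^sup>2 + (M6 + M7) * h\<^sup>2 * M1 + MB * (M1 * s\<^sup>2) + MB * (M1 * \<rho>))
       + (MJ * (M1 * \<rho> + M2 * h\<^sup>2) * (L1 * L2) + M5 * h\<^sup>2)"
      by (rule tri[OF 1 2 3 4])
    also have "\<dots> \<le> M4 * ?e + M3 * ?e + (M1 * ?e + (M6 + M7) * ?e * M1 + MB * (M1 * ?e) + MB * (M1 * ?e))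
       + (MJ * (M1 * ?e + M2 * ?e) * (L1 * L2) + M5 * ?e)"
      by (intro add_mono mult_left_mono mult_right_mono e) (use M1(1) M2(1) M3(1) M4(1) M5(1) M6(1) M7(1) MJ(1) MB L in simp_all)
    also have "\<dots> = D * ?e" unfolding D_def by (simp add: algebra_simps)
    finally show ?thesis unfolding split .
  qed
  then show ?thesis using D by blast
qed

subsection \<open>Convergence\<close>

lemma periodic_grid_cell_restrict:
  assumes q: "periodic_fun (real m * h) (real n * h) q"
  shows "periodic_grid m n (cell_restrict h q)"
  unfolding periodic_grid_def
proof (intro allI)
  fix i j a b
  have "grid_pt h (of_int (i + a * int m)) = grid_pt h (of_int i) + of_int a * (real m * h)"
    "grid_pt h (of_int (j + b * int n)) = grid_pt h (of_int j) + of_int b * (real n * h)"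
    by (simp_all add: grid_pt_def algebra_simps)
  then show "cell_restrict h q (i + a * int m) (j + b * int n) = cell_restrict h q i j"
    by (simp only: cell_restrict_def periodic_fun_of_int[OF q])
qed

lemma periodic_grid_vertex_restrict:
  assumes q: "periodic_fun (real m * h) (real n * h) q"
  shows "periodic_grid m n (vertex_restrict h q)"
  unfolding periodic_grid_def
proof (intro allI)
  fix i j a b
  have "grid_pt h (of_int (i + a * int m) + 1 / 2) = grid_pt h (of_int i + 1 / 2) + of_int a * (real m * h)"
    "grid_pt h (of_int (j + b * int n) + 1 / 2) = grid_pt h (of_int j + 1 / 2) + of_int b * (real n * h)"
    by (simp_all add: grid_pt_def algebra_simps)
  then show "vertex_restrict h q (i + a * int m) (j + b * int n) = vertex_restrict h q i j"
    by (simp only: vertex_restrict_def periodic_fun_of_int[OF q])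
qed

text \<open>Provides the kernel bound for \<open>discrete_conv_gradient\<close>, uniformly in the
  grid; a dummy time interval again allows the space-time lemmas to be used.\<close>

lemma vertex_restrict_lipschitz:
  assumes J: "st_smooth L1 L2 1 (Suc k) (\<lambda>x t. J x)" and L: "0 < L1" "0 < L2"
  shows "\<exists>M\<ge>0. \<forall>h>0. \<forall>i j. \<bar>vertex_restrict h J (i + 1) j - vertex_restrict h J i j\<bar> \<le> M * h \<and>
    \<bar>vertex_restrict h J i (j + 1) - vertex_restrict h J i j\<bar> \<le> M * h"
proof -
  have I: "(0 :: real) \<in> {0..1}" by simp
  obtain Jx Jy where Jx: "st_smooth L1 L2 1 k Jx"
      "\<And>t x y. t \<in> {0..1} \<Longrightarrow> ((\<lambda>r. J (r, y)) has_real_derivative Jx (x, y) t) (at x)"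
    and Jy: "st_smooth L1 L2 1 k Jy"
      "\<And>t x y. t \<in> {0..1} \<Longrightarrow> ((\<lambda>r. J (x, r)) has_real_derivative Jy (x, y) t) (at y)"
    using st_smooth_partials[OF J zero_less_one] by blast
  obtain M1 where M1: "0 \<le> M1" "\<And>t p. t \<in> {0..1} \<Longrightarrow> \<bar>Jx p t\<bar> \<le> M1" using st_smooth_bounded[OF Jx(1) L] by blast
  obtain M2 where M2: "0 \<le> M2" "\<And>t p. t \<in> {0..1} \<Longrightarrow> \<bar>Jy p t\<bar> \<le> M2" using st_smooth_bounded[OF Jy(1) L] by blast
  have "\<bar>vertex_restrict h J (i + 1) j - vertex_restrict h J i j\<bar> \<le> (M1 + M2) * h \<and>
    \<bar>vertex_restrict h J i (j + 1) - vertex_restrict h J i j\<bar> \<le> (M1 + M2) * h" if h: "0 < h" for h i j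
  proof -
    define a where "a = grid_pt h (of_int i + 1 / 2)"
    define b where "b = grid_pt h (of_int j + 1 / 2)"
    have v: "vertex_restrict h J i j = J (a, b)" "vertex_restrict h J (i + 1) j = J (a + h, b)"
      "vertex_restrict h J i (j + 1) = J (a, b + h)"
      by (simp_all add: vertex_restrict_def a_def b_def grid_pt_def algebra_simps)
    have "\<bar>J (a + h, b) - J (a, b)\<bar> \<le> M1 * \<bar>(a + h) - a\<bar>"
      by (rule taylor_1[where g = "\<lambda>r. J (r, b)" and ?g1.0 = "\<lambda>r. Jx (r, b) 0", OF convex_UNIV UNIV_I UNIV_I])
        (simp_all only: Jx(2)[OF I] M1(2)[OF I])
    moreover have "\<bar>J (a, b + h) - J (a, b)\<bar> \<le> M2 * \<bar>(b + h) - b\<bar>"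
      by (rule taylor_1[where g = "\<lambda>r. J (a, r)" and ?g1.0 = "\<lambda>r. Jy (a, r) 0", OF convex_UNIV UNIV_I UNIV_I])
        (simp_all only: Jy(2)[OF I] M2(2)[OF I])
    moreover have "\<bar>(a + h) - a\<bar> = h" "\<bar>(b + h) - b\<bar> = h" using h by simp_all
    moreover have "M1 * h \<le> (M1 + M2) * h" "M2 * h \<le> (M1 + M2) * h"
      using M1(1) M2(1) h by (auto intro!: mult_right_mono simp del: mult_le_cancel_right_pos)
    ultimately show ?thesis unfolding v by (metis order_trans)
  qed
  then show ?thesis using M1(1) M2(1) by (intro exI[of _ "M1 + M2"]) simp
qed

lemma B_const_nonneg:
  assumes "\<forall>x. 0 \<le> J x" "0 \<le> \<gamma>"
  shows "0 \<le> B_const h m n J \<gamma>"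
  unfolding B_const_def discrete_conv_eq vertex_restrict_def
  by (intro add_nonneg_nonneg mult_nonneg_nonneg grid_sum_nonneg zero_le_power2 zero_le_one assms(2) assms(1)[rule_format])

lemma B_const_bounded:
  assumes J: "smooth_periodic L1 L2 J" and L: "0 < L1" "0 < L2"
  shows "\<exists>M\<ge>0. \<forall>h m n. 0 < h \<longrightarrow> h \<le> 1 \<longrightarrow> L1 = real m * h \<longrightarrow> L2 = real n * h \<longrightarrow> \<bar>B_const h m n J \<gamma>\<bar> \<le> M"
proof -
  obtain M where M: "0 \<le> M" "\<forall>h m n. 0 < h \<longrightarrow> L1 = real m * h \<longrightarrow> L2 = real n * h \<longrightarrow>
     \<bar>B_const h m n J \<gamma> - (integral (Omega L1 L2) J + \<gamma>)\<bar> \<le> M * h\<^sup>2"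
    using B_const_quadrature[OF J L] by blast
  let ?c = "integral (Omega L1 L2) J + \<gamma>"
  have "\<bar>B_const h m n J \<gamma>\<bar> \<le> M + \<bar>?c\<bar>"
    if h: "0 < h" "h \<le> 1" and mn: "L1 = real m * h" "L2 = real n * h" for h m n
  proof -
    have "h\<^sup>2 \<le> 1" using h by (simp add: power_le_one)
    then have "M * h\<^sup>2 \<le> M" using M(1) by (simp add: mult_left_le)
    then have "\<bar>B_const h m n J \<gamma> - ?c\<bar> \<le> M" using M(2)[rule_format, OF h(1) mn] by linarith
    then show ?thesis by linarith
  qed
  then show ?thesis using M(1) by (intro exI[of _ "M + \<bar>?c\<bar>"]) simp
qed

theorem theorem3p10:
  fixes L1 L2 T \<gamma>c \<gamma>e \<alpha>0 Cstar :: real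
    and Jc Je \<Phi>0 :: "real \<times> real \<Rightarrow> real"
    and \<Phi> :: "real \<times> real \<Rightarrow> real \<Rightarrow> real"
  assumes domain: "0 < L1" "0 < L2"
    and A1: "smooth_periodic L1 L2 Jc" "smooth_periodic L1 L2 Je"
            "\<forall>x. 0 \<le> Jc x" "\<forall>x. 0 \<le> Je x"
    and A2: "\<forall>x1 x2. Jc (- x1, - x2) = Jc (x1, x2)" "\<forall>x1 x2. Je (- x1, - x2) = Je (x1, x2)"
    and A3: "integral (Omega L1 L2) (\<lambda>x. Jc x - Je x) > 0"
    and gamma: "0 \<le> \<gamma>c" "0 \<le> \<gamma>e"
    and gamma0: "\<gamma>c - \<gamma>e + integral (Omega L1 L2) (\<lambda>x. Jc x - Je x) > 0"
    and alpha0: "0 < \<alpha>0"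
    and B: "\<exists>h1>0. \<forall>h m n. 0 < h \<and> h \<le> h1 \<and> 0 < m \<and> 0 < n \<and> L1 = real m * h \<and> L2 = real n * h
              \<longrightarrow> \<alpha>0 \<le> B_const h m n Jc \<gamma>c - 3 * B_const h m n Je \<gamma>e"
    and T: "0 < T"
    and initial: "smooth_periodic L1 L2 \<Phi>0"
    and solution: "nCH_solution L1 L2 T \<gamma>c \<gamma>e (\<lambda>x. Jc x - Je x) \<Phi>0 \<Phi>"
    and unique: "\<forall>\<Psi>. nCH_solution L1 L2 T \<gamma>c \<gamma>e (\<lambda>x. Jc x - Je x) \<Phi>0 \<Psi> \<longrightarrow>
                   (\<forall>x. \<forall>t\<in>{0..T}. \<Psi> x t = \<Phi> x t)"
    and Cstar: "0 < Cstar"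
  shows "\<exists>s0>0. \<exists>h0>0. \<exists>C>0. \<forall>s h m n (\<phi> :: nat \<Rightarrow> grid_fun).
           0 < s \<and> s \<le> s0 \<and> 0 < h \<and> h \<le> h0 \<and> s \<le> Cstar * h \<and>
           0 < m \<and> 0 < n \<and> L1 = real m * h \<and> L2 = real n * h \<and>
           nCH_scheme s h m n \<gamma>c \<gamma>e Jc Je \<phi> \<and>
           (\<forall>i j. \<phi> 0 i j = cell_restrict h (\<lambda>x. \<Phi> x 0) i j) \<longrightarrow>
           (\<forall>l. 0 < l \<and> real l * s \<le> T \<longrightarrow>
              grid_norm h m n
                (\<lambda>i j. cell_restrict h (\<lambda>x. \<Phi> x (real l * s)) i j - \<phi> l i j)
              \<le> C * (h\<^sup>2 + s\<^sup>2))"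
proof -
  define J where "J = (\<lambda>x. Jc x - Je x)"
  have Js: "st_smooth L1 L2 1 (Suc 0) (\<lambda>x t. J x)"
  proof -
    have "st_smooth L1 L2 1 (Suc 0) (\<lambda>x t. Jc x + (- 1) * Je x)"
      by (intro st_smooth_add st_smooth_mult st_smooth_const st_smooth_lift A1)
    then show ?thesis by (simp add: J_def)
  qed
  obtain h1 where h1: "0 < h1" "\<forall>h m n. 0 < h \<and> h \<le> h1 \<and> 0 < m \<and> 0 < n \<and> L1 = real m * h \<and> L2 = real n * h
              \<longrightarrow> \<alpha>0 \<le> B_const h m n Jc \<gamma>c - 3 * B_const h m n Je \<gamma>e"
    using B by (elim exE conjE)
  obtain D where D: "0 \<le> D" "\<forall>s t tm \<rho> h m n i j. step_times T t s tm \<rho> \<longrightarrow> 0 < h \<longrightarrow> h \<le> 1 \<longrightarrow> L1 = real m * h \<longrightarrow> L2 = real n * h \<longrightarrow>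
     \<bar>truncation_error s h m n \<gamma>c \<gamma>e Jc Je (cell_restrict h (\<lambda>z. \<Phi> z tm))
       (cell_restrict h (\<lambda>z. \<Phi> z t)) (cell_restrict h (\<lambda>z. \<Phi> z (t + s))) i j\<bar> \<le> D * (h\<^sup>2 + \<rho>)"
    using nCH_consistency[OF domain T A1(1,2) solution] by (elim exE conjE)
  obtain M1 where M1: "0 \<le> M1" "\<forall>t\<in>{0..T}. \<forall>p. \<bar>\<Phi> p t\<bar> \<le> M1"
    using st_smooth_bounded[OF st_smooth_solution[OF solution] domain] by blast
  obtain M2 where M2: "time_bounded T M2 \<Phi>"
    using st_smooth_time_bounds[OF st_smooth_solution[OF solution] domain T] by blast
  obtain M3 where M3: "0 \<le> M3" "\<forall>h>0. \<forall>i j. \<bar>vertex_restrict h J (i + 1) j - vertex_restrict h J i j\<bar> \<le> M3 * h \<and>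
    \<bar>vertex_restrict h J i (j + 1) - vertex_restrict h J i j\<bar> \<le> M3 * h"
    using vertex_restrict_lipschitz[OF Js domain] by blast
  obtain M4 where M4: "0 \<le> M4" "\<forall>h m n. 0 < h \<longrightarrow> h \<le> 1 \<longrightarrow> L1 = real m * h \<longrightarrow> L2 = real n * h \<longrightarrow> \<bar>B_const h m n Jc \<gamma>c\<bar> \<le> M4"
    using B_const_bounded[OF A1(1) domain] by blast
  obtain M5 where M5: "0 \<le> M5" "\<forall>h m n. 0 < h \<longrightarrow> h \<le> 1 \<longrightarrow> L1 = real m * h \<longrightarrow> L2 = real n * h \<longrightarrow> \<bar>B_const h m n Je \<gamma>e\<bar> \<le> M5"
    using B_const_bounded[OF A1(2) domain] by blast
  \<comment> \<open>One constant for all bounds, as \<open>convergence_of_consistency\<close> takes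
    a single \<open>M\<close>; the quantities built from it below depend on neither \<open>h\<close>
    nor \<open>s\<close>.\<close>
  define M where "M = M1 + M2 + M3 + M4 + M5"
  have M: "0 \<le> M" "M1 \<le> M" "M2 \<le> M" "M3 \<le> M" "M4 \<le> M" "M5 \<le> M"
    using M1(1) M2 M3(1) M4(1) M5(1) by (simp_all add: M_def time_bounded_def)
  define N where "N = 5 * M\<^sup>2 * (L1 * L2)\<^sup>2 + (1 + M) * (1 + 2 * M) + 2 * M\<^sup>2 + 2 * M"
  define c where "c = min (1 / 12) (\<alpha>0 / 2)"
  have N: "0 \<le> N" using M(1) by (simp add: N_def)
  have c: "0 < c" using alpha0 by (simp add: c_def)
  define Q where "Q = sqrt (2 / c * (2 * (L1 * L2 * N\<^sup>2 / c) + T * (3 * N * (L1 * L2))) * exp (12 * N / c * T)) * D"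
  have Q: "0 \<le> Q" using D(1) c N T domain by (simp add: Q_def)
  \<comment> \<open>The entry \<open>1 / (2 * (D + 1))\<close>, here and in \<open>h0\<close>, gives
    \<open>s\<close> and \<open>h\<^sup>2\<close> half each of the bound
    \<open>D * (h\<^sup>2 + s) \<le> 1\<close>; the entry with \<open>N\<close> is the absorption
    condition of the Gronwall argument. The added ones exclude zero denominators.\<close>
  define s0 where "s0 = min 1 (min (1 / (2 * (D + 1))) (c / (8 * (N + 1))))"
  define h0 where "h0 = min 1 (min h1 (1 / (2 * (D + 1))))"
  have s0: "0 < s0" using D(1) N c by (simp add: s0_def)
  have h0: "0 < h0" using D(1) h1(1) by (simp add: h0_def)
  have main: "grid_norm h m n (\<lambda>i j. cell_restrict h (\<lambda>x. \<Phi> x (real l * s)) i j - \<phi> l i j) \<le> (Q + 1) * (h\<^sup>2 + s\<^sup>2)"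
    if s: "0 < s" "s \<le> s0" and h: "0 < h" "h \<le> h0" and mn: "0 < m" "0 < n" "L1 = real m * h" "L2 = real n * h"
      and scheme: "nCH_scheme s h m n \<gamma>c \<gamma>e Jc Je \<phi>" and init: "\<forall>i j. \<phi> 0 i j = cell_restrict h (\<lambda>x. \<Phi> x 0) i j"
      and l: "0 < l" "real l * s \<le> T" for s h m n \<phi> l
  proof -
    have s1: "s \<le> 1" "s \<le> 1 / (2 * (D + 1))" "s \<le> c / (8 * (N + 1))" using s by (simp_all add: s0_def)
    have hh: "h \<le> 1" "h \<le> h1" "h \<le> 1 / (2 * (D + 1))" using h by (simp_all add: h0_def)
    text \<open>The time is cut off at \<open>T\<close>, since \<open>\<Phi>\<close> need not be periodic beyond \<open>T\<close>.\<close>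
    define A where "A = (\<lambda>k. cell_restrict h (\<lambda>z. \<Phi> z (min T (real k * s))))"
    have ks: "real k * s \<le> T" if "k \<le> l" for k
    proof -
      have "real k * s \<le> real l * s" using that s by (intro mult_right_mono) auto
      then show ?thesis using l(2) by linarith
    qed
    have Ak: "A k = cell_restrict h (\<lambda>z. \<Phi> z (real k * s))" if "k \<le> l" for k
      using ks[OF that] by (simp add: A_def min_absorb2)
    \<comment> \<open>At \<open>k = 0\<close> subtraction on the naturals makes the previous time
      equal to the current one, which is the first-order case of \<open>step_times\<close>.\<close>
    have times: "step_times T (real k * s) s (real (k - 1) * s) (if k = 0 then s else s\<^sup>2)" if k: "k < l" for k
    proof -
      have "real (Suc k) * s \<le> T" using k by (intro ks) simp
      moreover have "real k = real (k - 1) + 1" if "0 < k" using that by simp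
      ultimately show ?thesis using s s1 by (auto simp: step_times_def algebra_simps)
    qed
    have next_time: "real (k + 1) * s = real k * s + s" for k by (simp add: algebra_simps)
    define \<tau> where "\<tau> = (\<lambda>k. truncation_error s h m n \<gamma>c \<gamma>e Jc Je (A (k - 1)) (A k) (A (k + 1)))"
    have \<tau>: "\<bar>\<tau> k i j\<bar> \<le> D * (h\<^sup>2 + (if k = 0 then s else s\<^sup>2))" if k: "k < l" for k i j
    proof -
      have "k - 1 \<le> l" "k \<le> l" "k + 1 \<le> l" using k by simp_all
      note A3 = this[THEN Ak]
      show ?thesis unfolding \<tau>_def A3 next_time
        by (rule D(2)[rule_format, OF times[OF k] h(1) hh(1) mn(3,4)])
    qed
    have Be: "0 \<le> B_const h m n Je \<gamma>e" by (rule B_const_nonneg[OF A1(4) gamma(2)])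
    have "\<alpha>0 \<le> B_const h m n Jc \<gamma>c - 3 * B_const h m n Je \<gamma>e"
      by (rule h1(2)[rule_format]) (intro conjI h(1) hh(2) mn)
    then have \<alpha>: "\<alpha>0 \<le> B_const h m n Jc \<gamma>c - B_const h m n Je \<gamma>e" using Be by linarith
    have Bb: "B_const h m n Je \<gamma>e \<le> M" "\<bar>B_const h m n Jc \<gamma>c\<bar> \<le> M"
      using M4(2)[rule_format, OF h(1) hh(1) mn(3,4)] M5(2)[rule_format, OF h(1) hh(1) mn(3,4)] M(5,6) by linarith+
    let ?V = "vertex_restrict h (\<lambda>x. Jc x - Je x)"
    have J_per: "periodic_grid m n (?V)"
      by (rule periodic_grid_vertex_restrict)
        (use A1(1,2) in \<open>simp add: smooth_periodic_def periodic_fun_def mn(3,4)[symmetric]\<close>)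
    have J_lip: "\<bar>?V (i + 1) j - ?V i j\<bar> \<le> M * h"
      "\<bar>?V i (j + 1) - ?V i j\<bar> \<le> M * h" for i j
    proof -
      have "M3 * h \<le> M * h" using M(4) h(1) by (intro mult_right_mono) auto
      then show "\<bar>?V (i + 1) j - ?V i j\<bar> \<le> M * h"
        "\<bar>?V i (j + 1) - ?V i j\<bar> \<le> M * h"
        using M3(2)[rule_format, OF h(1), of i j] unfolding J_def by (meson order_trans)+
    qed
    have A_per: "periodic_grid m n (A k)" for k
      unfolding A_def
    proof (rule periodic_grid_cell_restrict)
      have "0 \<le> real k * s" using s by simp
      then have "min T (real k * s) \<in> {0..T}" using T by simp
      from st_smooth_periodic[OF st_smooth_solution[OF solution] this]
      show "periodic_fun (real m * h) (real n * h) (\<lambda>z. \<Phi> z (min T (real k * s)))"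
        unfolding mn(3)[symmetric] mn(4)[symmetric] .
    qed
    have A_bd: "\<bar>A k i j\<bar> \<le> M" if "k \<le> l" for k i j
    proof -
      have "real k * s \<in> {0..T}" using ks[OF that] s by simp
      then show ?thesis unfolding Ak[OF that] cell_restrict_def using M1(2) M(2) order_trans by blast
    qed
    have A_diff: "\<bar>A (k + 1) i j - A k i j\<bar> \<le> M * s" if k: "k < l" for k i j
    proof -
      have "k \<le> l" "k + 1 \<le> l" using k by simp_all
      note A2 = this[THEN Ak]
      show ?thesis unfolding A2 next_time cell_restrict_def
        by (rule time_boundedD(4)[OF time_bounded_mono[OF M2 M(3)] times[OF k]])
    qed
    have err: "A (k + 1) i j - A k i j =
        s * (discrete_laplacian h (chem_potential h m n \<gamma>c \<gamma>e Jc Je (A (k - 1)) (A k) (A (k + 1))) i j + \<tau> k i j)" for k i j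
      using s(1) by (simp add: \<tau>_def truncation_error_def)
    have Ds: "D * (h\<^sup>2 + s) \<le> 1"
    proof -
      have "h\<^sup>2 \<le> h" using h hh(1) by (simp add: power2_eq_square mult_left_le)
      then have "h\<^sup>2 + s \<le> 1 / (2 * (D + 1)) + 1 / (2 * (D + 1))"
        by (intro add_mono s1(2) order_trans[OF _ hh(3)])
      moreover have "1 / (2 * (D + 1)) + 1 / (2 * (D + 1)) = 1 / (D + 1)" using D(1) by (simp add: field_simps)
      ultimately have "h\<^sup>2 + s \<le> 1 / (D + 1)" by (simp only:)
      then have "D * (h\<^sup>2 + s) \<le> D * (1 / (D + 1))" using D(1) by (intro mult_left_mono)
      also have "\<dots> \<le> 1" using D(1) by simp
      finally show ?thesis .
    qed
    have sN: "8 * (s * N) \<le> c"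
    proof -
      have "8 * (s * N) \<le> s * (8 * (N + 1))" using s by (simp add: algebra_simps)
      also have "\<dots> \<le> c" using s1(3) N by (simp add: pos_le_divide_eq)
      finally show ?thesis .
    qed
    have "grid_norm h m n (\<lambda>i j. A l i j - \<phi> l i j) \<le> Q * (h\<^sup>2 + s\<^sup>2)"
      unfolding Q_def
    proof (rule convergence_of_consistency[OF alpha0 \<alpha> Be Bb J_per J_lip s(1) s1(1) h(1) mn(3,4) scheme _ A_per A_bd A_diff err _ _ D(1) Ds l(2) N_def c_def sN])
      show "\<phi> 0 i j = A 0 i j" for i j using init Ak[of 0] by simp
      show "\<bar>\<tau> k i j\<bar> \<le> D * (h\<^sup>2 + s\<^sup>2)" if "0 < k" "k < l" for k i j using \<tau>[OF that(2), of i j] that(1) by simp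
      show "\<bar>\<tau> 0 i j\<bar> \<le> D * (h\<^sup>2 + s)" if "0 < l" for i j using \<tau>[OF that, of i j] by simp
    qed
    also have "\<dots> \<le> (Q + 1) * (h\<^sup>2 + s\<^sup>2)" by (intro mult_right_mono) simp_all
    finally show ?thesis by (simp only: Ak[OF order_refl])
  qed
  \<comment> \<open>\<open>D\<close>, and with it \<open>Q\<close>, may vanish, whereas the constant
    has to be positive.\<close>
  have Q1: "0 < Q + 1" using Q by simp
  show ?thesis
    by (rule exI[of _ s0], intro conjI s0, rule exI[of _ h0], intro conjI h0, rule exI[of _ "Q + 1"], intro conjI Q1)
      (intro allI impI, elim conjE, rule main)
qed

end
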